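(* Let $\alpha,\beta\in(0,1)$ and let $\Phi^{(4)}_\alpha$ be the aggregated test of $f=g$ on $\mathbb{R}^d$ built from a product kernel $k_1=\prod_{i=1}^dk_{1,i}$ and anisotropic dyadic bandwidths, as described in the context. Let $\Delta=(\Delta_1,\ldots,\Delta_d)$ be a vector of positive integers, and assume that for every $i=1,\ldots,d$, $\int_{\mathbb{R}}|k_{1,i}(x_i)||x_i|^{\Delta_i}dx_i<+\infty$ and $\int_{\mathbb{R}}k_{1,i}(x_i)x_i^j\,dx_i=0$ for every $j=1,\ldots,\Delta_i$. Assume that $\ln\ln n\ge1$. For any $\delta=(\delta_1,\ldots,\delta_d)\in\prod_{i=1}^d(0,\Delta_i]$ and $R,R',R''>0$, if $$\mathcal{N}_{2,d}^\delta(R,R',R'')=\left\{(f,g)\ :\ (f-g)\in\mathcal{N}_{2,d}^\delta(R),\ \max(\|f\|_1,\|g\|_1)\le R',\ \max(\|f\|_\infty,\|g\|_\infty)\le R''\right\},$$ then, for $1/\bar\delta=\sum_{i=1}^d1/\delta_i$, $$\rho\left(\Phi^{(4)}_\alpha,\mathcal{N}_{2,d}^\delta(R,R',R''),\beta\right)\le C(\delta,\alpha,\beta,R,R',R'',d)\left(\frac{\ln\ln n}{n}\right)^{\frac{2\bar\delta}{1+4\bar\delta}},$$ where $C(\delta,\alpha,\beta,R,R',R'',d)$ denotes a positive constant that may depend on the indicated parameters.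
   Context: Setting: $\mathbb{X}=\mathbb{R}^d$, $\nu$ is the Lebesgue measure, $n$ is a positive number, $d\mu=n\,d\nu$. $N^1$ and $N^{-1}$ are independent Poisson processes on $\mathbb{X}$ with intensities $f$ and $g$ with respect to $\mu$; $\mathbb{P}_{f,g}$ is their joint distribution; $\|h\|_\infty=\sup|h|$, $\|h\|_1=\int|h|d\nu$, $\|h\|=\|h\|_2=(\int h^2d\nu)^{1/2}$. Standing assumption: $\|f\|_1,\|g\|_1,\|f\|_\infty,\|g\|_\infty<+\infty$. Uniform separation rate of a $\{0,1\}$-valued test $\Phi$ (rejecting $f=g$ when $\Phi=1$) over a class $\mathcal{S}$ of pairs $(f,g)$: $\rho(\Phi,\mathcal{S},\beta)=\inf\{\rho>0:\ \sup_{(f,g)\in\mathcal{S},\,\|f-g\|>\rho}\mathbb{P}_{f,g}(\Phi=0)\le\beta\}$. $N$ is the pooled process ($dN=dN^1+dN^{-1}$), with $N_n$ points $X_1,\ldots,X_{N_n}$; for $x\in N$, $\varepsilon^0_x=1$ if $x$ belongs to $N^1$ and $\varepsilon^0_x=-1$ if $x$ belongs to $N^{-1}$. $(\varepsilon_i)_{i\in\mathbb{N}}$ are i.i.d. Rademacher variables independent of $N$. For a symmetric kernel $K$, $\hat T_K=\sum_{x\ne x'\in N}K(x,x')\varepsilon^0_x\varepsilon^0_{x'}$ and $\hat T_K^{\varepsilon}=\sum_{i\ne i'\in\{1,\ldots,N_n\}}K(X_i,X_{i'})\varepsilon_i\varepsilon_{i'}$. Aggregated test associated with a family of symmetric kernels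 $\{K_m,m\in\mathcal{M}\}$ and weights $w_m>0$ with $\sum_{m\in\mathcal{M}}e^{-w_m}\le1$: for $u\in(0,1)$, $q^{(N)}_{m,1-u}$ is the $(1-u)$ quantile of $\hat T_{K_m}^{\varepsilon}$ conditionally on $N$; $u_\alpha^{(N)}=\sup\{u>0:\mathbb{P}(\sup_{m\in\mathcal{M}}(\hat T_{K_m}^{\varepsilon}-q^{(N)}_{m,1-ue^{-w_m}})>0\,|\,N)\le\alpha\}$; the test is $\mathbf{1}_{\sup_{m\in\mathcal{M}}(\hat T_{K_m}-q^{(N)}_{m,1-u_\alpha^{(N)}e^{-w_m}})>0}$. Test $\Phi^{(4)}_\alpha$: $k_1(x)=\prod_{i=1}^dk_{1,i}(x_i)$ where the $k_{1,i}$ are real valued kernels with $k_{1,i}\in\mathbb{L}^1(\mathbb{R})\cap\mathbb{L}^2(\mathbb{R})$, $k_{1,i}(x_i)=k_{1,i}(-x_i)$ and $\int_{\mathbb{R}}k_{1,i}(x_i)dx_i=1$. The index set is $\mathcal{M}=\{1\}\times\mathbb{N}^d$ ($\mathbb{N}$ including $0$); for $m=(1,m_2)$ with $m_2=(m_{2,1},\ldots,m_{2,d})$, $h_{m_2,i}=2^{-m_{2,i}}$, $K_m(x,x')=\prod_{i=1}^d\frac{1}{h_{m_2,i}}k_{1,i}\left(\frac{x_i-x_i'}{h_{m_2,i}}\right)$ and $w_{(1,m_2)}=2\sum_{i=1}^d\left(\ln(m_{2,i}+1)+\ln(\pi/\sqrt6)\right)$. $\Phi^{(4)}_\alpha$ is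 the aggregated test associated with $\{K_m,m\in\mathcal{M}\}$ and $\{w_m,m\in\mathcal{M}\}$. Anisotropic Nikol'skii-Besov ball: $\mathcal{N}_{2,d}^\delta(R)$ is the set of $s:\mathbb{R}^d\to\mathbb{R}$ having continuous partial derivatives $D_i^{\lfloor\delta_i\rfloor}$ of order $\lfloor\delta_i\rfloor$ with respect to $u_i$ and such that, for all $i=1,\ldots,d$ and $v\in\mathbb{R}$, $\|D_i^{\lfloor\delta_i\rfloor}s(u_1,\ldots,u_i+v,\ldots,u_d)-D_i^{\lfloor\delta_i\rfloor}s(u_1,\ldots,u_d)\|_2\le R|v|^{\delta_i-\lfloor\delta_i\rfloor}$, the norm being the $\mathbb{L}^2(\mathbb{R}^d)$ norm in $(u_1,\ldots,u_d)$.
   Formalization: The constant C may also depend on the fixed kernels k_{1,i} (and formally on Δ), besides δ, α, β, R, R', R'', d; a constant uniform over all kernels is impossible, as rescaling k(x/c)/c with c→0 shows. *)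

theory Defs
  imports "HOL-Probability.Probability"
begin

section \<open>Poisson processes\<close>

text \<open>
  A point process is a random set of points. Only integrable intensities are considered, for which
  a Poisson process is almost surely finite and has no multiple points; so a configuration is taken
  to be a finite set (\<open>card\<close> would count an infinite one as empty).
\<close>

definition config :: "('a::topological_space) set measure" where
  "config = sigma {S. finite S}
     {{S. finite S \<and> card (S \<inter> A) = k} | A k. A \<in> sets borel}"

definition poisson_process ::
  "'w measure \<Rightarrow> ('w \<Rightarrow> 'a::topological_space set) \<Rightarrow> 'a measure \<Rightarrow> ('a \<Rightarrow> real) \<Rightarrow> bool" where
  "poisson_process M N \<mu> f \<longleftrightarrow>
     prob_space M \<and> N \<in> M \<rightarrow>\<^sub>M config \<and>
     (\<forall>A\<in>sets borel. \<forall>k. measure M {\<omega> \<in> space M. card (N \<omega> \<inter> A) = k} =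
        exp (- (LINT x:A|\<mu>. f x)) * (LINT x:A|\<mu>. f x) ^ k / fact k) \<and>
     (\<forall>A :: nat \<Rightarrow> 'a set. disjoint_family A \<longrightarrow> range A \<subseteq> sets borel \<longrightarrow>
        prob_space.indep_vars M (\<lambda>_. count_space UNIV) (\<lambda>j \<omega>. card (N \<omega> \<inter> A j)) UNIV)"

text \<open>
  \<open>P\<close> is the joint distribution of two independent Poisson processes with
  intensities \<open>f\<close> and \<open>g\<close> with respect to \<open>\<mu>\<close>.
\<close>

definition two_sample_law ::
  "'a::topological_space measure \<Rightarrow> ('a \<Rightarrow> real) \<Rightarrow> ('a \<Rightarrow> real) \<Rightarrow> ('a set \<times> 'a set) measure \<Rightarrow> bool" where
  "two_sample_law \<mu> f g P \<longleftrightarrow>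
     prob_space P \<and> sets P = sets (config \<Otimes>\<^sub>M config) \<and>
     poisson_process P fst \<mu> f \<and> poisson_process P snd \<mu> g \<and>
     prob_space.indep_var P config fst config snd"


section \<open>Norms, intensities, Nikol'skii-Besov balls\<close>

definition L1_norm :: "('a::euclidean_space \<Rightarrow> real) \<Rightarrow> real" where
  "L1_norm h = (LINT x|lborel. \<bar>h x\<bar>)"

definition L2_norm :: "('a::euclidean_space \<Rightarrow> real) \<Rightarrow> real" where
  "L2_norm h = sqrt (LINT x|lborel. (h x)\<^sup>2)"

definition sup_norm :: "('a \<Rightarrow> real) \<Rightarrow> real" where
  "sup_norm h = (SUP x. \<bar>h x\<bar>)"

definition intensity :: "('a::euclidean_space \<Rightarrow> real) \<Rightarrow> bool" where
  "intensity f \<longleftrightarrow> (\<forall>x. 0 \<le> f x) \<and> integrable lborel f \<and> bounded (range f)"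

definition partial_deriv :: "'d::finite \<Rightarrow> (real ^ 'd \<Rightarrow> real) \<Rightarrow> real ^ 'd \<Rightarrow> real" where
  "partial_deriv i s u = deriv (\<lambda>t. s (u + t *\<^sub>R axis i 1)) 0"

text \<open>
  \<open>deriv\<close> is total, so the existence of the partial derivatives up to order \<open>k\<close> is a separate
  condition; likewise square integrability, as \<^const>\<open>L2_norm\<close> is \<open>0\<close> outside of the space of
  square integrable functions.
\<close>

definition nikolskii_besov_ball ::
  "('d::finite \<Rightarrow> real) \<Rightarrow> real \<Rightarrow> (real ^ 'd \<Rightarrow> real) set" where
  "nikolskii_besov_ball \<delta> R = {s. \<forall>i.
     let k = nat \<lfloor>\<delta> i\<rfloor>; D = (partial_deriv i ^^ k) s in
       (\<forall>j<k. \<forall>u. (\<lambda>t. (partial_deriv i ^^ j) s (u + t *\<^sub>R axis i 1)) field_differentiable (at 0)) \<and>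
       continuous_on UNIV D \<and>
       (\<forall>v::real.
          integrable lborel (\<lambda>u. (D (u + v *\<^sub>R axis i 1) - D u)\<^sup>2) \<and>
          L2_norm (\<lambda>u. D (u + v *\<^sub>R axis i 1) - D u) \<le> R * \<bar>v\<bar> powr (\<delta> i - of_int \<lfloor>\<delta> i\<rfloor>))}"

definition besov_class ::
  "('d::finite \<Rightarrow> real) \<Rightarrow> real \<Rightarrow> real \<Rightarrow> real \<Rightarrow> ((real ^ 'd \<Rightarrow> real) \<times> (real ^ 'd \<Rightarrow> real)) set" where
  "besov_class \<delta> R R' R'' = {(f, g). intensity f \<and> intensity g \<and>
     (\<lambda>x. f x - g x) \<in> nikolskii_besov_ball \<delta> R \<and>
     max (L1_norm f) (L1_norm g) \<le> R' \<and> max (sup_norm f) (sup_norm g) \<le> R''}"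


section \<open>Tests and uniform separation rates\<close>

text \<open>
  A test is a \<open>{0,1}\<close>-valued function of the pair of observed configurations;
  \<open>P f g\<close> is the distribution of that pair when the intensities are \<open>f\<close> and \<open>g\<close>.
\<close>

definition separation_rate ::
  "(('a::euclidean_space \<Rightarrow> real) \<Rightarrow> ('a \<Rightarrow> real) \<Rightarrow> ('a set \<times> 'a set) measure) \<Rightarrow>
   ('a set \<times> 'a set \<Rightarrow> nat) \<Rightarrow> (('a \<Rightarrow> real) \<times> ('a \<Rightarrow> real)) set \<Rightarrow> real \<Rightarrow> ereal" where
  "separation_rate P \<Phi> \<S> \<beta> =
     (INF \<rho>\<in>{\<rho>. 0 < \<rho> \<and>
        (SUP (f, g)\<in>{(f, g). (f, g) \<in> \<S> \<and> L2_norm (\<lambda>x. f x - g x) > \<rho>}.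
           emeasure (P f g) {\<omega> \<in> space (P f g). \<Phi> \<omega> = 0}) \<le> ennreal \<beta>}. ereal \<rho>)"

definition T_stat :: "('a \<Rightarrow> 'a \<Rightarrow> real) \<Rightarrow> 'a set \<Rightarrow> ('a \<Rightarrow> real) \<Rightarrow> real" where
  "T_stat K N e = (\<Sum>x\<in>N. \<Sum>x'\<in>N - {x}. K x x' * e x * e x')"

text \<open>
  The signs are attached directly to the points of the pooled configuration \<open>N\<close>; as they are
  i.i.d. and independent of \<open>N\<close>, the conditional laws given \<open>N\<close> do not depend on
  how the points are numbered.
\<close>

definition rademacher_signs :: "'a set \<Rightarrow> ('a \<Rightarrow> real) pmf" where
  "rademacher_signs N = Pi_pmf N 0 (\<lambda>_. pmf_of_set {-1, 1})"

definition boot_cdf :: "('a \<Rightarrow> 'a \<Rightarrow> real) \<Rightarrow> 'a set \<Rightarrow> real \<Rightarrow> real" where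
  "boot_cdf K N t = measure_pmf.prob (rademacher_signs N) {e. T_stat K N e \<le> t}"

text \<open>
  Quantile of order \<open>p\<close>. For \<open>0 < p < 1\<close> the condition \<open>0 < boot_cdf K N t\<close> is redundant. It makes
  the quantile of order \<open>0\<close> the essential infimum, and order \<open>0\<close> does occur at the level
  \<open>u_alpha\<close> below: if all statistics vanish (say, \<open>N = {}\<close>), then \<open>u_alpha * exp (- w m) = 1\<close>
  for the smallest weight \<open>w m\<close>.
\<close>

definition boot_quantile :: "('a \<Rightarrow> 'a \<Rightarrow> real) \<Rightarrow> 'a set \<Rightarrow> real \<Rightarrow> real" where
  "boot_quantile K N p = Inf {t. 0 < boot_cdf K N t \<and> p \<le> boot_cdf K N t}"

definition u_alpha ::
  "('m \<Rightarrow> 'a \<Rightarrow> 'a \<Rightarrow> real) \<Rightarrow> ('m \<Rightarrow> real) \<Rightarrow> real \<Rightarrow> 'a set \<Rightarrow> real" where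
  "u_alpha K w \<alpha> N = Sup {u. 0 < u \<and> (\<forall>m. u * exp (- w m) < 1) \<and>
     measure_pmf.prob (rademacher_signs N)
       {e. (SUP m. ereal (T_stat (K m) N e - boot_quantile (K m) N (1 - u * exp (- w m)))) > 0} \<le> \<alpha>}"

text \<open>
  The two processes are almost surely disjoint, so the sign of a common point is irrelevant.
\<close>

definition aggregated_test ::
  "('m \<Rightarrow> 'a \<Rightarrow> 'a \<Rightarrow> real) \<Rightarrow> ('m \<Rightarrow> real) \<Rightarrow> real \<Rightarrow> 'a set \<times> 'a set \<Rightarrow> nat" where
  "aggregated_test K w \<alpha> = (\<lambda>(N1, N2).
     let N = N1 \<union> N2; \<epsilon>0 = (\<lambda>x. if x \<in> N1 then 1 else - 1) in
       if (SUP m. ereal (T_stat (K m) N \<epsilon>0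
             - boot_quantile (K m) N (1 - u_alpha K w \<alpha> N * exp (- w m)))) > 0
       then 1 else 0)"


section \<open>The product kernel test with anisotropic dyadic bandwidths\<close>

definition bandwidth :: "nat ^ 'd \<Rightarrow> 'd \<Rightarrow> real" where
  "bandwidth m i = 2 powr (- real (m $ i))"

definition product_kernel ::
  "('d::finite \<Rightarrow> real \<Rightarrow> real) \<Rightarrow> nat ^ 'd \<Rightarrow> real ^ 'd \<Rightarrow> real ^ 'd \<Rightarrow> real" where
  "product_kernel k m x x' =
     (\<Prod>i\<in>UNIV. 1 / bandwidth m i * k i ((x $ i - x' $ i) / bandwidth m i))"

definition product_weight :: "nat ^ 'd::finite \<Rightarrow> real" where
  "product_weight m = 2 * (\<Sum>i\<in>UNIV. ln (real (m $ i) + 1) + ln (pi / sqrt 6))"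

definition Phi4 ::
  "('d::finite \<Rightarrow> real \<Rightarrow> real) \<Rightarrow> real \<Rightarrow> (real ^ 'd) set \<times> (real ^ 'd) set \<Rightarrow> nat" where
  "Phi4 k \<alpha> = aggregated_test (product_kernel k) product_weight \<alpha>"

definition product_kernel_assms :: "('d \<Rightarrow> real \<Rightarrow> real) \<Rightarrow> bool" where
  "product_kernel_assms k \<longleftrightarrow> (\<forall>i.
     integrable lborel (k i) \<and> integrable lborel (\<lambda>x. (k i x)\<^sup>2) \<and>
     (\<forall>x. k i x = k i (- x)) \<and> (LINT x|lborel. k i x) = 1)"

end

theory Submission
  imports Defs
begin

text \<open>
  Let \<open>s = f - g\<close>, and let \<open>u\<close> be \<open>s\<close> smoothed by the kernel with bandwidths \<open>h\<close>. The test
  can accept only if every statistic \<open>T\<close> stays below its own bootstrap quantile, so it is enough to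
  find one index whose statistic exceeds its quantile with probability at least \<open>1 - \<beta>\<close>. Four ingredients
  do this.

  The quantile. The weights sum to at most 1, so a union bound gives \<open>u_alpha \<ge> \<alpha>\<close>, and the
  index \<open>m\<close> is tested at least at the level \<open>\<alpha> * exp (- w m)\<close>. Under random signs the statistic is
  a Rademacher chaos of order two. Its moments obey Bonami's hypercontractive inequality
  (\<open>quadratic_chaos_moment\<close>), and Markov's inequality for a moment of order about \<open>ln (1 / p)\<close>
  bounds its quantile of level \<open>p\<close> by a multiple of \<open>ln (1 / p)\<close> standard deviations. The
  quantile therefore pays for the weight only linearly: acceptance forces
  \<open>T \<le> const * (1 + w m) * sqrt (\<Sum> K\<^sup>2)\<close> (\<open>aggregated_test_accept\<close>).

  The moments of the statistic. The pooled sample, with the origin of a point as its mark, has the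
  factorial moments of a Poisson process: the expected sum of a function over tuples of distinct
  points is its integral over the product of the mean measures (\<open>factorial_moment\<close>). Hence
  \<open>T\<close> has mean \<open>n\<^sup>2 \<langle>u, s\<rangle>\<close>, which equals half of \<open>n\<^sup>2 (\<parallel>s\<parallel>\<^sup>2 + \<parallel>u\<parallel>\<^sup>2 - \<parallel>u - s\<parallel>\<^sup>2)\<close>, and its variance
  is bounded by a multiple of \<open>n\<^sup>3 \<parallel>u\<parallel>\<^sup>2 + n\<^sup>2 / \<Prod> h\<close>. The square root of the first term is absorbed by
  the \<open>\<parallel>u\<parallel>\<^sup>2\<close> in the mean. By the inequalities of Chebyshev and Markov the error of the second kind is
  at most \<open>\<beta>\<close> as soon as \<open>\<parallel>s\<parallel>\<^sup>2\<close> exceeds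
  \<open>\<parallel>u - s\<parallel>\<^sup>2 + const / n + const * (1 + w m) / (n * sqrt (\<Prod> h))\<close> (\<open>kernel_type_two\<close>).

  The bias. Along one axis the vanishing moments of the kernel annihilate the Taylor polynomial of
  \<open>s\<close>, and the Nikol'skii-Besov condition bounds the smoothed remainder in \<open>L\<^sup>2\<close> by a multiple of
  \<open>h\<^sub>i\<close> to the power \<open>\<delta>\<^sub>i\<close> (\<open>smoothing_bias\<close>). Smoothing along the other axes only costs the \<open>L\<^sup>1\<close> norms of the
  kernels, so the biases of the axes add up (\<open>product_smoothing_bias\<close>).

  The bandwidths. With \<open>r = ln (ln n) / n\<close> the bandwidths are chosen to give all axes a bias of the order
  of the claimed rate. Up to rounding they are powers of \<open>r\<close>, so the indices are of order \<open>ln n\<close> and the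
  weights, being logarithms of the indices, of order \<open>ln (ln n)\<close> (\<open>bandwidth_choice\<close>). All terms in the
  separation condition are then of the order of the squared rate (\<open>rate_arithmetic\<close>).
\<close>

section \<open>Moments of Rademacher chaos of order two\<close>

text \<open>
  The weighted inequality of arithmetic and geometric means for \<open>u ^ q\<close> and \<open>v ^ q\<close>. It plays the part
  of the Hoelder inequality in the moment bounds.
\<close>

lemma young_powers:
  fixes u v :: real
  assumes "0 \<le> u" "0 \<le> v" "j \<le> q" "0 < q"
  shows "u ^ (q - j) * v ^ j \<le> (real (q - j) * u ^ q + real j * v ^ q) / real q"
proof (cases "j = 0 \<or> j = q \<or> u = 0 \<or> v = 0")
  case True
  have "0 \<le> (real (q - j) * u ^ q + real j * v ^ q) / real q"
    using assms by (intro divide_nonneg_nonneg add_nonneg_nonneg mult_nonneg_nonneg) auto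
  with True assms show ?thesis
    by (cases "j = 0"; cases "j = q") (auto simp: zero_power)
next
  case False
  with assms have uv: "0 < u" "0 < v" and j: "0 < j" "j < q" by auto
  have root: "(w ^ q) powr (real i / real q) = w ^ i" if "0 < w" for w :: real and i
    using that \<open>0 < q\<close>
    by (simp add: powr_realpow [symmetric] powr_powr)
  have "(u ^ q) powr (real (q - j) / real q) * (v ^ q) powr (real j / real q)
      \<le> real (q - j) / real q * u ^ q + real j / real q * v ^ q"
    using uv j by (intro Youngs_inequality_0) (auto simp: field_simps)
  then show ?thesis
    using uv by (simp only: root) (simp add: add_divide_distrib)
qed

text \<open>
  The combinatorial core of hypercontractivity. When \<open>j\<close> grows by 1, the left side is multiplied
  by the factor of \<open>q choose j\<close> times \<open>(2 * q - 2 * j - 1) / (2 * j + 1)\<close>, which is at most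
  \<open>2 * q - 1\<close>.
\<close>

lemma even_binomial_le:
  assumes "j \<le> q" "0 < q"
  shows "real ((2 * q) choose (2 * j)) \<le> real (q choose j) * (2 * real q - 1) ^ j"
  using \<open>j \<le> q\<close>
proof (induction j)
  case 0
  then show ?case by simp
next
  case (Suc j)
  have jq: "j < q" using Suc.prems by simp
  have step: "real (n choose Suc k) * real (Suc k) = real (n choose k) * (real n - real k)"
    if "k \<le> n" for n k
  proof -
    have "Suc k * (n choose Suc k) = (n - k) * (n choose k)"
      by (simp only: binomial_absorption binomial_absorb_comp)
    then show ?thesis
      using that by (metis mult.commute of_nat_diff of_nat_mult)
  qed
  define c1 c2 where "c1 = real ((2 * q) choose Suc (2 * j))" and "c2 = real ((2 * q) choose (2 * Suc j))"
  define b c where "b = real (q choose j)" and "c = real ((2 * q) choose (2 * j))"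
  have 1: "c1 * (2 * real j + 1) = c * (2 * (real q - real j))"
    using step[of "2 * j" "2 * q"] jq by (simp add: c1_def c_def add.commute)
  have 2: "c2 * (2 * (real j + 1)) = c1 * (2 * real q - 2 * real j - 1)"
    using step[of "Suc (2 * j)" "2 * q"] jq by (simp add: c1_def c2_def algebra_simps)
  have 3: "real (q choose Suc j) * (real j + 1) = b * (real q - real j)"
    using step[of j q] jq by (simp add: b_def algebra_simps)
  have c2: "c2 = c * ((real q - real j) / (real j + 1)) * ((2 * real q - 2 * real j - 1) / (2 * real j + 1))"
  proof -
    have "c2 = c1 * (2 * real q - 2 * real j - 1) / (2 * (real j + 1))"
      using 2 by (simp add: field_simps)
    moreover have "c1 = c * (2 * (real q - real j)) / (2 * real j + 1)"
      using 1 by (simp add: field_simps)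
    ultimately have "c2 = c * ((2 * (real q - real j)) / (2 * (real j + 1))) * ((2 * real q - 2 * real j - 1) / (2 * real j + 1))"
      by (simp only: times_divide_eq_right times_divide_eq_left divide_divide_eq_left mult_ac)
    then show ?thesis by (simp only: mult_divide_mult_cancel_left_if) simp
  qed
  have "(2 * real q - 2 * real j - 1) / (2 * real j + 1) \<le> (2 * real q - 1) / 1"
    using jq by (intro frac_le) auto
  moreover have "c \<le> b * (2 * real q - 1) ^ j"
    using Suc.IH jq by (simp add: b_def c_def)
  ultimately have "c2 \<le> (b * (2 * real q - 1) ^ j) * ((real q - real j) / (real j + 1)) * (2 * real q - 1)"
    unfolding c2 using jq by (intro mult_mono) (auto simp: b_def c_def)
  also have "\<dots> = real (q choose Suc j) * (2 * real q - 1) ^ Suc j"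
  proof -
    have "real (q choose Suc j) = b * ((real q - real j) / (real j + 1))"
      using 3 by (simp add: field_simps)
    then show ?thesis by simp
  qed
  finally show ?case by (simp add: c2_def)
qed

lemma even_part_binomial:
  fixes a b :: real
  shows "((a + b) ^ (2 * q) + (a - b) ^ (2 * q)) / 2
       = (\<Sum>j\<le>q. real ((2 * q) choose (2 * j)) * (a ^ (2 * (q - j)) * b ^ (2 * j)))"
proof -
  let ?t = "\<lambda>c k. real ((2 * q) choose k) * a ^ (2 * q - k) * c ^ k"
  have pm: "(a + c) ^ (2 * q) = (\<Sum>k\<le>2 * q. ?t c k)" for c
    by (subst add.commute, subst binomial_ring) (simp add: mult_ac)
  have "((a + b) ^ (2 * q) + (a - b) ^ (2 * q)) / 2
      = (\<Sum>k\<le>2 * q. (?t b k + ?t (-b) k) / 2)"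
    using pm[of b] pm[of "-b"] by (simp add: sum.distrib sum_divide_distrib[symmetric])
  also have "\<dots> = (\<Sum>k\<in>(\<lambda>j. 2 * j) ` {..q}. (?t b k + ?t (-b) k) / 2)"
  proof (rule sum.mono_neutral_right)
    show "\<forall>k\<in>{..2 * q} - (\<lambda>j. 2 * j) ` {..q}. (?t b k + ?t (-b) k) / 2 = 0"
    proof
      fix k assume k: "k \<in> {..2 * q} - (\<lambda>j. 2 * j) ` {..q}"
      have "odd k"
      proof
        assume "even k"
        then obtain i where "k = 2 * i" by (elim evenE)
        with k show False by auto
      qed
      then show "(?t b k + ?t (-b) k) / 2 = 0" by simp
    qed
  qed auto
  also have "\<dots> = (\<Sum>j\<le>q. (?t b (2 * j) + ?t (-b) (2 * j)) / 2)"
    by (subst sum.reindex) (auto simp: inj_on_def)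
  also have "\<dots> = (\<Sum>j\<le>q. real ((2 * q) choose (2 * j)) * (a ^ (2 * (q - j)) * b ^ (2 * j)))"
    by (intro sum.cong) (auto simp: diff_mult_distrib2)
  finally show ?thesis .
qed

text \<open>
  The Hoelder inequality with upper bounds in place of the norms: after division by \<open>a\<close> and \<open>b\<close> it is
  the mean of a pointwise inequality.
\<close>

lemma moment_interpolation:
  fixes p :: "'a pmf" and x y :: "'a \<Rightarrow> real"
  assumes fin: "finite (set_pmf p)" and "\<And>e. 0 \<le> x e" "\<And>e. 0 \<le> y e"
    and Ex: "measure_pmf.expectation p (\<lambda>e. x e ^ q) \<le> a ^ q"
    and Ey: "measure_pmf.expectation p (\<lambda>e. y e ^ q) \<le> b ^ q"
    and pos: "0 < a" "0 < b" "0 < q" and "j \<le> q"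
  shows "measure_pmf.expectation p (\<lambda>e. x e ^ (q - j) * y e ^ j) \<le> a ^ (q - j) * b ^ j"
proof -
  note [simp] = integrable_measure_pmf_finite[OF fin]
  have "x e ^ (q - j) * y e ^ j
      \<le> a ^ (q - j) * b ^ j * ((real (q - j) / (real q * a ^ q)) * x e ^ q + (real j / (real q * b ^ q)) * y e ^ q)" for e
  proof -
    have "(x e / a) ^ (q - j) * (y e / b) ^ j
        \<le> (real (q - j) * (x e / a) ^ q + real j * (y e / b) ^ q) / real q"
      using assms by (intro young_powers) auto
    then have "a ^ (q - j) * b ^ j * ((x e / a) ^ (q - j) * (y e / b) ^ j)
        \<le> a ^ (q - j) * b ^ j * ((real (q - j) * (x e / a) ^ q + real j * (y e / b) ^ q) / real q)"
      using pos by (intro mult_left_mono) auto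
    then show ?thesis using pos by (simp add: power_divide add_divide_distrib mult_ac)
  qed
  then have "measure_pmf.expectation p (\<lambda>e. x e ^ (q - j) * y e ^ j)
     \<le> measure_pmf.expectation p (\<lambda>e. a ^ (q - j) * b ^ j *
          ((real (q - j) / (real q * a ^ q)) * x e ^ q + (real j / (real q * b ^ q)) * y e ^ q))"
    by (intro integral_mono) auto
  also have "\<dots> = a ^ (q - j) * b ^ j *
          ((real (q - j) / (real q * a ^ q)) * measure_pmf.expectation p (\<lambda>e. x e ^ q)
          + (real j / (real q * b ^ q)) * measure_pmf.expectation p (\<lambda>e. y e ^ q))"
    by simp
  also have "\<dots> \<le> a ^ (q - j) * b ^ j *
          ((real (q - j) / (real q * a ^ q)) * a ^ q + (real j / (real q * b ^ q)) * b ^ q)"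
    using pos Ex Ey by (intro mult_left_mono add_mono) auto
  also have "\<dots> = a ^ (q - j) * b ^ j"
    using pos \<open>j \<le> q\<close> by (simp add: field_simps)
  finally show ?thesis .
qed

text \<open>
  The induction step of Bonami's inequality. Averaging over the sign of \<open>B\<close> leaves the even powers of
  \<open>B\<close>, whose binomial coefficients are at most those of a \<open>q\<close>-th power times powers of \<open>2 * q - 1\<close>.
\<close>

lemma two_point_moment:
  fixes p :: "'a pmf" and A B :: "'a \<Rightarrow> real"
  assumes fin: "finite (set_pmf p)"
    and EA: "measure_pmf.expectation p (\<lambda>e. A e ^ (2 * q)) \<le> a ^ q"
    and EB: "measure_pmf.expectation p (\<lambda>e. B e ^ (2 * q)) \<le> b ^ q"
    and nn: "0 \<le> a" "0 \<le> b" and q: "0 < q"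
  shows "measure_pmf.expectation p (\<lambda>e. ((A e + B e) ^ (2 * q) + (A e - B e) ^ (2 * q)) / 2)
       \<le> (a + (2 * real q - 1) * b) ^ q"
proof -
  note [simp] = integrable_measure_pmf_finite[OF fin]
  let ?E = "measure_pmf.expectation p"
  let ?c = "2 * real q - 1"
  have pos: "?E (\<lambda>e. ((A e + B e) ^ (2 * q) + (A e - B e) ^ (2 * q)) / 2) \<le> (a' + ?c * b') ^ q"
    if a': "a < a'" and b': "b < b'" for a' b'
  proof -
    have le: "?E (\<lambda>e. A e ^ (2 * (q - j)) * B e ^ (2 * j)) \<le> a' ^ (q - j) * b' ^ j" if "j \<le> q" for j
      unfolding power_mult
    proof (rule moment_interpolation[OF fin])
      have "a ^ q \<le> a' ^ q" "b ^ q \<le> b' ^ q"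
        using a' b' nn by (auto intro!: power_mono)
      then show "?E (\<lambda>e. ((A e)\<^sup>2) ^ q) \<le> a' ^ q" "?E (\<lambda>e. ((B e)\<^sup>2) ^ q) \<le> b' ^ q"
        using EA EB by (simp_all add: power_mult[symmetric])
    qed (use a' b' nn q that in auto)
    have "?E (\<lambda>e. ((A e + B e) ^ (2 * q) + (A e - B e) ^ (2 * q)) / 2)
        = (\<Sum>j\<le>q. real ((2 * q) choose (2 * j)) * ?E (\<lambda>e. A e ^ (2 * (q - j)) * B e ^ (2 * j)))"
      by (simp only: even_part_binomial) simp
    also have "\<dots> \<le> (\<Sum>j\<le>q. (real (q choose j) * ?c ^ j) * (a' ^ (q - j) * b' ^ j))"
      using le even_binomial_le[OF _ q] q by (intro sum_mono mult_mono) auto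
    also have "\<dots> = (a' + ?c * b') ^ q"
      by (subst add.commute, subst binomial_ring) (simp add: power_mult_distrib mult_ac)
    finally show ?thesis .
  qed
  \<comment> \<open>Interpolation divides by the bounds, so vanishing bounds are reached as limits.\<close>
  have lim: "((\<lambda>t. ((a + t) + ?c * (b + t)) ^ q) \<longlongrightarrow> ((a + 0) + ?c * (b + 0)) ^ q) (at_right 0)"
    by (intro tendsto_intros)
  have "?E (\<lambda>e. ((A e + B e) ^ (2 * q) + (A e - B e) ^ (2 * q)) / 2) \<le> ((a + 0) + ?c * (b + 0)) ^ q"
    by (rule tendsto_lowerbound[OF lim])
       (use pos in \<open>auto intro!: eventually_at_rightI[of 0 1] simp del: integral_divide_zero integral_add\<close>)
  then show ?thesis by simp
qed

lemma finite_set_rademacher_signs [simp]: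
  "finite N \<Longrightarrow> finite (set_pmf (rademacher_signs N))"
  unfolding rademacher_signs_def
  by (rule finite_subset[OF set_Pi_pmf_subset']) auto

lemma expectation_rademacher_insert:
  fixes F :: "('a \<Rightarrow> real) \<Rightarrow> real"
  assumes "finite N" "x \<notin> N"
  shows "measure_pmf.expectation (rademacher_signs (insert x N)) F
    = measure_pmf.expectation (rademacher_signs N) (\<lambda>e. (F (e(x := 1)) + F (e(x := -1))) / 2)"
proof -
  have "rademacher_signs (insert x N)
      = rademacher_signs N \<bind> (\<lambda>e. map_pmf (\<lambda>y. e(x := y)) (pmf_of_set {-1, 1}))"
    unfolding rademacher_signs_def using assms
    by (subst Pi_pmf_insert') (auto simp: map_pmf_def bind_commute_pmf[of "pmf_of_set _"])
  also have "measure_pmf.expectation \<dots> F = measure_pmf.expectation (rademacher_signs N)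
     (\<lambda>e. measure_pmf.expectation (map_pmf (\<lambda>y. e(x := y)) (pmf_of_set {-1, 1})) F)"
    using assms
    by (subst pmf_expectation_bind[where A = "set_pmf (rademacher_signs N)"])
       (auto simp: integral_measure_pmf[where A = "set_pmf (rademacher_signs N)"])
  also have "\<dots> = measure_pmf.expectation (rademacher_signs N) (\<lambda>e. (F (e(x := 1)) + F (e(x := -1))) / 2)"
    by (intro Bochner_Integration.integral_cong) (auto simp: integral_pmf_of_set)
  finally show ?thesis .
qed

text \<open>
  Khintchine's inequality, with the constant that hypercontractivity gives.
\<close>

lemma linear_chaos_moment:
  fixes b :: "'a \<Rightarrow> real"
  assumes "finite N" and q: "0 < q"
  shows "measure_pmf.expectation (rademacher_signs N) (\<lambda>e. (\<Sum>i\<in>N. b i * e i) ^ (2 * q))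
       \<le> ((2 * real q - 1) * (\<Sum>i\<in>N. (b i)\<^sup>2)) ^ q"
  using \<open>finite N\<close>
proof induction
  case empty
  then show ?case using q by (simp add: zero_power)
next
  case (insert x N)
  let ?A = "\<lambda>e. \<Sum>i\<in>N. b i * e i"
  have upd: "(\<Sum>i\<in>N. b i * (e(x := t)) i) = ?A e" for e t
    using insert.hyps by (intro sum.cong) auto
  have "measure_pmf.expectation (rademacher_signs (insert x N)) (\<lambda>e. (\<Sum>i\<in>insert x N. b i * e i) ^ (2 * q))
      = measure_pmf.expectation (rademacher_signs N)
          (\<lambda>e. ((?A e + b x) ^ (2 * q) + (?A e - b x) ^ (2 * q)) / 2)"
    using insert.hyps
    by (subst expectation_rademacher_insert) (auto simp: upd add_ac simp del: fun_upd_apply, auto simp: algebra_simps)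
  also have "\<dots> \<le> ((2 * real q - 1) * (\<Sum>i\<in>N. (b i)\<^sup>2) + (2 * real q - 1) * (b x)\<^sup>2) ^ q"
    using insert q by (intro two_point_moment) (auto simp: power_mult[symmetric] intro!: mult_nonneg_nonneg sum_nonneg)
  also have "\<dots> = ((2 * real q - 1) * (\<Sum>i\<in>insert x N. (b i)\<^sup>2)) ^ q"
    using insert.hyps by (simp add: algebra_simps)
  finally show ?case .
qed

lemma T_stat_insert:
  assumes "finite N" "x \<notin> N" and sym: "\<And>y z. K y z = K z y"
  shows "T_stat K (insert x N) e = T_stat K N e + e x * (\<Sum>y\<in>N. 2 * K x y * e y)"
proof -
  have "T_stat K (insert x N) e
      = (\<Sum>y\<in>N. K x y * e x * e y) + (\<Sum>y\<in>N. \<Sum>z\<in>insert x N - {y}. K y z * e y * e z)"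
    unfolding T_stat_def using assms by simp
  also have "(\<Sum>y\<in>N. \<Sum>z\<in>insert x N - {y}. K y z * e y * e z)
      = (\<Sum>y\<in>N. K y x * e y * e x + (\<Sum>z\<in>N - {y}. K y z * e y * e z))"
  proof (rule sum.cong)
    fix y assume "y \<in> N"
    with assms have "insert x N - {y} = insert x (N - {y})" by auto
    then show "(\<Sum>z\<in>insert x N - {y}. K y z * e y * e z) = K y x * e y * e x + (\<Sum>z\<in>N - {y}. K y z * e y * e z)"
      using assms by simp
  qed simp
  finally show ?thesis
    unfolding T_stat_def by (simp add: sum.distrib sum_distrib_left sym[of _ x] mult_ac flip: sum_distrib_right)
qed

text \<open>
  For a symmetric kernel, twice this sum is the variance of \<open>T_stat\<close> under random signs.
\<close>

definition offdiag_sq_sum :: "('a \<Rightarrow> 'a \<Rightarrow> real) \<Rightarrow> 'a set \<Rightarrow> real" where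
  "offdiag_sq_sum K N = (\<Sum>x\<in>N. \<Sum>y\<in>N - {x}. (K x y)\<^sup>2)"

lemma offdiag_sq_sum_nonneg [simp]: "0 \<le> offdiag_sq_sum K N"
  unfolding offdiag_sq_sum_def by (intro sum_nonneg) auto

lemma offdiag_sq_sum_insert:
  assumes "finite N" "x \<notin> N" and sym: "\<And>y z. K y z = K z y"
  shows "offdiag_sq_sum K (insert x N) = offdiag_sq_sum K N + 2 * (\<Sum>y\<in>N. (K x y)\<^sup>2)"
proof -
  have "T_stat (\<lambda>x y. (K x y)\<^sup>2) M (\<lambda>_. 1) = offdiag_sq_sum K M" for M
    by (simp add: T_stat_def offdiag_sq_sum_def)
  with T_stat_insert[OF assms(1,2), of "\<lambda>x y. (K x y)\<^sup>2" "\<lambda>_. 1"] sym show ?thesis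
    by (simp add: sum_distrib_left)
qed

text \<open>
  Bonami's inequality for a homogeneous chaos of order two. The statistic is affine in each sign, and
  the coefficient of a sign is a chaos of order one in the others; the latter contributes one factor
  \<open>2 * q - 1\<close> and \<open>two_point_moment\<close> a second one.
\<close>

lemma quadratic_chaos_moment:
  fixes K :: "'a \<Rightarrow> 'a \<Rightarrow> real"
  assumes "finite N" and sym: "\<And>y z. K y z = K z y" and q: "0 < q"
  shows "measure_pmf.expectation (rademacher_signs N) (\<lambda>e. T_stat K N e ^ (2 * q))
       \<le> ((2 * real q - 1)\<^sup>2 * (2 * offdiag_sq_sum K N)) ^ q"
  using \<open>finite N\<close>
proof induction
  case empty
  then show ?case using q by (simp add: zero_power T_stat_def offdiag_sq_sum_def)
next
  case (insert x N)
  let ?B = "\<lambda>e. \<Sum>y\<in>N. 2 * K x y * e y"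
  have updA: "T_stat K N (e(x := t)) = T_stat K N e" for e t
    unfolding T_stat_def using insert.hyps by (intro sum.cong refl) auto
  have updB: "?B (e(x := t)) = ?B e" for e t
    using insert.hyps by (intro sum.cong) auto
  have "measure_pmf.expectation (rademacher_signs (insert x N)) (\<lambda>e. T_stat K (insert x N) e ^ (2 * q))
      = measure_pmf.expectation (rademacher_signs N)
          (\<lambda>e. ((T_stat K N e + ?B e) ^ (2 * q) + (T_stat K N e - ?B e) ^ (2 * q)) / 2)"
    unfolding expectation_rademacher_insert[OF insert.hyps] T_stat_insert[OF insert.hyps sym] updA updB
    by simp
  also have "\<dots> \<le> ((2 * real q - 1)\<^sup>2 * (2 * offdiag_sq_sum K N)
      + (2 * real q - 1) * ((2 * real q - 1) * (\<Sum>y\<in>N. (2 * K x y)\<^sup>2))) ^ q"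
    using insert q
    by (intro two_point_moment linear_chaos_moment) (auto intro!: mult_nonneg_nonneg sum_nonneg)
  also have "\<dots> = ((2 * real q - 1)\<^sup>2 * (2 * offdiag_sq_sum K (insert x N))) ^ q"
  proof -
    have "(\<Sum>y\<in>N. (2 * K x y)\<^sup>2) = 4 * (\<Sum>y\<in>N. (K x y)\<^sup>2)"
      by (simp add: power_mult_distrib sum_distrib_left)
    then show ?thesis
      by (simp add: offdiag_sq_sum_insert[OF insert.hyps sym] power2_eq_square distrib_left mult_ac)
  qed
  finally show ?case .
qed

section \<open>Bootstrap quantiles and the acceptance region\<close>

text \<open>
  Markov's inequality for the moment of order \<open>2 * q\<close>, where \<open>2 * q\<close> is at least \<open>ln (1 / u)\<close>: at the stated
  threshold it gives the bound \<open>exp (- (2 * q))\<close>.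
\<close>

lemma T_stat_tail:
  assumes fin: "finite N" and sym: "\<And>y z. K y z = K z y" and u: "0 < u" "u < 1"
  shows "measure_pmf.prob (rademacher_signs N)
           {e. T_stat K N e > exp 1 * (ln (1 / u) + 2) * sqrt (2 * offdiag_sq_sum K N)} \<le> u"
proof (cases "offdiag_sq_sum K N = 0")
  case True
  then have "T_stat K N e = 0" for e
    using fin unfolding offdiag_sq_sum_def T_stat_def
    by (intro sum.neutral ballI) (auto simp: sum_nonneg_eq_0_iff sum_nonneg)
  with True u show ?thesis by simp
next
  case False
  let ?M = "rademacher_signs N"
  let ?T = "T_stat K N"
  define \<sigma> where "\<sigma> = sqrt (2 * offdiag_sq_sum K N)"
  define t where "t = exp 1 * (ln (1 / u) + 2) * \<sigma>"
  \<comment> \<open>The order of the moment grows with the logarithm of the level.\<close>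
  define q where "q = nat \<lceil>ln (1 / u) / 2\<rceil>"
  note [simp] = integrable_measure_pmf_finite[OF finite_set_rademacher_signs[OF fin]]
  have l: "0 < ln (1 / u)" using u by simp
  then have q: "0 < q" unfolding q_def by simp
  have q1: "ln (1 / u) \<le> 2 * real q" and q2: "2 * real q \<le> ln (1 / u) + 2"
    using l unfolding q_def by (simp_all, linarith+)
  have \<sigma>: "0 < \<sigma>" "\<sigma>\<^sup>2 = 2 * offdiag_sq_sum K N"
    using False offdiag_sq_sum_nonneg[of K N] unfolding \<sigma>_def by (simp_all add: less_le)
  have t: "0 < t" using l \<sigma> unfolding t_def by (intro mult_pos_pos) auto
  have "measure_pmf.prob ?M {e. ?T e > t} = measure_pmf.expectation ?M (indicator {e. ?T e > t})"
    by simp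
  also have "\<dots> \<le> measure_pmf.expectation ?M (\<lambda>e. ?T e ^ (2 * q) / t ^ (2 * q))"
  proof (intro integral_mono)
    fix e
    show "indicator {e. ?T e > t} e \<le> ?T e ^ (2 * q) / t ^ (2 * q)"
      using t by (auto simp: indicator_def intro!: power_mono)
  qed auto
  also have "\<dots> \<le> ((2 * real q - 1)\<^sup>2 * (2 * offdiag_sq_sum K N)) ^ q / t ^ (2 * q)"
    using quadratic_chaos_moment[OF fin sym q] t by (simp add: divide_right_mono)
  also have "\<dots> = ((2 * real q - 1) * \<sigma> / t) ^ (2 * q)"
    by (simp add: power_mult power_divide power_mult_distrib \<sigma>)
  also have "\<dots> \<le> exp (-1) ^ (2 * q)"
  proof (rule power_mono)
    have "(2 * real q - 1) * \<sigma> \<le> (ln (1 / u) + 2) * \<sigma>"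
      using q2 \<sigma> by (intro mult_right_mono) auto
    also have "\<dots> = exp (-1) * t" unfolding t_def by (simp add: exp_minus)
    finally show "(2 * real q - 1) * \<sigma> / t \<le> exp (-1)"
      using t by (simp add: field_simps)
    show "0 \<le> (2 * real q - 1) * \<sigma> / t"
      using q t \<sigma> by (intro divide_nonneg_pos mult_nonneg_nonneg) auto
  qed
  also have "\<dots> = exp (- (2 * real q))" by (simp add: exp_of_nat_mult[symmetric])
  also have "\<dots> \<le> exp (- ln (1 / u))" using q1 by simp
  also have "\<dots> = u" using u by (simp add: ln_div)
  finally show ?thesis unfolding t_def \<sigma>_def .
qed

lemma boot_cdf_eq: "boot_cdf K N t = 1 - measure_pmf.prob (rademacher_signs N) {e. T_stat K N e > t}"
proof -
  have "{e. T_stat K N e \<le> t} = space (measure_pmf (rademacher_signs N)) - {e. T_stat K N e > t}"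
    by auto
  then show ?thesis
    unfolding boot_cdf_def by (subst measure_pmf.prob_compl[symmetric]) auto
qed

text \<open>
  A level with a positive value of the distribution function is at least the smallest value of the
  statistic.
\<close>

lemma boot_levels_bdd_below:
  assumes "finite N"
  shows "bdd_below {t. 0 < boot_cdf K N t \<and> p \<le> boot_cdf K N t}"
proof (rule bdd_belowI)
  fix t assume t: "t \<in> {t. 0 < boot_cdf K N t \<and> p \<le> boot_cdf K N t}"
  have "\<exists>e\<in>set_pmf (rademacher_signs N). T_stat K N e \<le> t"
  proof (rule ccontr)
    assume "\<not> ?thesis"
    then have "boot_cdf K N t = 0"
      unfolding boot_cdf_def by (subst measure_pmf_zero_iff) auto
    with t show False by simp
  qed
  then show "Min (T_stat K N ` set_pmf (rademacher_signs N)) \<le> t"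
    using assms by (subst Min_le_iff) (auto intro!: set_pmf_not_empty)
qed

lemma boot_quantile_le:
  assumes "finite N" "0 < boot_cdf K N t" "p \<le> boot_cdf K N t"
  shows "boot_quantile K N p \<le> t"
  unfolding boot_quantile_def using assms by (intro cInf_lower boot_levels_bdd_below) auto

lemma boot_levels_nonempty:
  assumes "finite N" "p \<le> 1"
  shows "{t. 0 < boot_cdf K N t \<and> p \<le> boot_cdf K N t} \<noteq> {}"
proof -
  let ?V = "T_stat K N ` set_pmf (rademacher_signs N)"
  have "boot_cdf K N (Max ?V) = 1"
    unfolding boot_cdf_def using assms
    by (subst measure_pmf.prob_eq_1) (auto simp: AE_measure_pmf_iff)
  with \<open>p \<le> 1\<close> show ?thesis by (auto intro!: exI[of _ "Max ?V"])
qed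

lemma boot_quantile_mono:
  assumes "finite N" "p \<le> p'" "p' \<le> 1"
  shows "boot_quantile K N p \<le> boot_quantile K N p'"
  unfolding boot_quantile_def using assms
  by (intro cInf_superset_mono boot_levels_bdd_below boot_levels_nonempty) auto

text \<open>
  The distribution function is constant from the quantile up to the next value of the statistic. If it
  were below \<open>1 - u\<close> there, the quantile could not be smaller than that next value.
\<close>

lemma prob_gt_boot_quantile:
  assumes fin: "finite N" and u: "0 \<le> u" "u < 1"
  shows "measure_pmf.prob (rademacher_signs N) {e. T_stat K N e > boot_quantile K N (1 - u)} \<le> u"
proof (rule ccontr)
  let ?M = "rademacher_signs N" and ?q = "boot_quantile K N (1 - u)"
  let ?V = "{v \<in> T_stat K N ` set_pmf ?M. ?q < v}"
  assume "\<not> ?thesis"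
  then have gt: "u < measure_pmf.prob ?M {e. T_stat K N e > ?q}" by simp
  have "?V \<noteq> {}"
  proof
    assume "?V = {}"
    then have "measure_pmf.prob ?M {e. T_stat K N e > ?q} = 0"
      by (subst measure_pmf_zero_iff) auto
    with gt u show False by simp
  qed
  moreover have finV: "finite ?V" using fin by auto
  ultimately have v: "?q < Min ?V" by (subst Min_gr_iff) auto
  have "Min ?V \<le> Inf {t. 0 < boot_cdf K N t \<and> 1 - u \<le> boot_cdf K N t}"
  proof (rule cInf_greatest[OF boot_levels_nonempty])
    fix t assume t: "t \<in> {t. 0 < boot_cdf K N t \<and> 1 - u \<le> boot_cdf K N t}"
    show "Min ?V \<le> t"
    proof (rule ccontr)
      assume "\<not> ?thesis"
      then have "measure_pmf.prob ?M {e. T_stat K N e > ?q} \<le> measure_pmf.prob ?M {e. T_stat K N e > t}"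
        using finV by (intro measure_pmf.finite_measure_mono_AE) (auto simp: AE_measure_pmf_iff not_le intro: less_le_trans[OF _ Min_le[OF finV]])
      with gt t show False by (simp add: boot_cdf_eq)
    qed
  qed (use fin u in auto)
  with v show False by (simp add: boot_quantile_def)
qed

lemma boot_quantile_bound:
  assumes fin: "finite N" and sym: "\<And>y z. K y z = K z y" and u: "0 < u" "u < 1"
  shows "boot_quantile K N (1 - u) \<le> exp 1 * (ln (1 / u) + 2) * sqrt (2 * offdiag_sq_sum K N)"
  using T_stat_tail[OF fin, of K u] sym u by (intro boot_quantile_le[OF fin]) (auto simp: boot_cdf_eq)

text \<open>
  The union bound. As only finitely many sign patterns occur, finitely many indices witness the bad
  event, and finite sums of the weights suffice.
\<close>

lemma level_le_u_alpha:
  fixes w :: "'m \<Rightarrow> real"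
  assumes fin: "finite N" and \<alpha>: "0 < \<alpha>" "\<alpha> < 1" and w: "\<And>m. 0 < w m"
    and sum: "\<And>M. finite M \<Longrightarrow> (\<Sum>m\<in>M. exp (- w m)) \<le> 1"
  shows "\<alpha> \<le> u_alpha K w \<alpha> N" and "u_alpha K w \<alpha> N * exp (- w m) \<le> 1"
proof -
  let ?P = "rademacher_signs N"
  let ?U = "{u. 0 < u \<and> (\<forall>m. u * exp (- w m) < 1) \<and>
     measure_pmf.prob ?P {e. (SUP m. ereal (T_stat (K m) N e - boot_quantile (K m) N (1 - u * exp (- w m)))) > 0} \<le> \<alpha>}"
  let ?B = "\<lambda>m. {e. T_stat (K m) N e > boot_quantile (K m) N (1 - \<alpha> * exp (- w m))}"
  have lt1: "\<alpha> * exp (- w m) < 1" for m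
  proof -
    have "\<alpha> * exp (- w m) < 1 * 1" using \<alpha> w by (intro mult_strict_mono) auto
    then show ?thesis by simp
  qed
  have ev: "{e. (SUP m. ereal (T_stat (K m) N e - boot_quantile (K m) N (1 - \<alpha> * exp (- w m)))) > 0} = (\<Union>m. ?B m)"
    by (auto simp: less_SUP_iff)
  have "measure_pmf.prob ?P (\<Union>m. ?B m) \<le> \<alpha>"
  proof -
    let ?E = "(\<Union>m. ?B m) \<inter> set_pmf ?P"
    \<comment> \<open>One bad index for each sign pattern of positive probability.\<close>
    define c where "c e = (SOME m. e \<in> ?B m)" for e
    have c: "e \<in> ?B (c e)" if "e \<in> ?E" for e
      unfolding c_def using that by (intro someI_ex[of "\<lambda>m. e \<in> ?B m"]) auto
    have finE: "finite ?E" using fin by auto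
    have "measure_pmf.prob ?P (\<Union>m. ?B m) = measure_pmf.prob ?P ?E"
      by (simp add: measure_Int_set_pmf)
    also have "\<dots> \<le> measure_pmf.prob ?P (\<Union>m\<in>c ` ?E. ?B m)"
      using c by (intro measure_pmf.finite_measure_mono) auto
    also have "\<dots> \<le> (\<Sum>m\<in>c ` ?E. measure_pmf.prob ?P (?B m))"
      using finE by (intro measure_pmf.finite_measure_subadditive_finite) auto
    also have "\<dots> \<le> (\<Sum>m\<in>c ` ?E. \<alpha> * exp (- w m))"
      using fin \<alpha> lt1 by (intro sum_mono prob_gt_boot_quantile) auto
    also have "\<dots> \<le> \<alpha> * 1"
      unfolding sum_distrib_left[symmetric] using \<alpha> finE by (intro mult_left_mono sum) auto
    finally show ?thesis by simp
  qed
  then have mem: "\<alpha> \<in> ?U" using \<alpha> lt1 by (simp add: ev)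
  have le: "u \<le> exp (w m)" if "u \<in> ?U" for u m
  proof -
    have "u * exp (- w m) < 1" using that by auto
    then show ?thesis by (simp add: exp_minus field_simps)
  qed
  have bdd: "bdd_above ?U" using le[of _ undefined] by (intro bdd_aboveI[where M = "exp (w undefined)"]) auto
  show "\<alpha> \<le> u_alpha K w \<alpha> N"
    unfolding u_alpha_def using mem bdd by (intro cSup_upper) auto
  have "u_alpha K w \<alpha> N \<le> exp (w m)"
    unfolding u_alpha_def using mem le by (intro cSup_least) blast+
  then show "u_alpha K w \<alpha> N * exp (- w m) \<le> 1"
    by (simp add: exp_minus field_simps)
qed

text \<open>
  This is all that is used of the test: acceptance bounds each statistic by a threshold in which its
  weight enters linearly.
\<close>

lemma aggregated_test_accept:
  fixes w :: "'m \<Rightarrow> real"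
  assumes acc: "aggregated_test K w \<alpha> (N1, N2) = 0"
    and fin: "finite N1" "finite N2" and \<alpha>: "0 < \<alpha>" "\<alpha> < 1" and w: "\<And>m. 0 < w m"
    and sum: "\<And>M. finite M \<Longrightarrow> (\<Sum>m\<in>M. exp (- w m)) \<le> 1"
    and sym: "\<And>y z. K m y z = K m z y"
  shows "T_stat (K m) (N1 \<union> N2) (\<lambda>x. if x \<in> N1 then 1 else - 1)
      \<le> exp 1 * (ln (1 / \<alpha>) + w m + 2) * sqrt (2 * offdiag_sq_sum (K m) (N1 \<union> N2))"
proof -
  let ?N = "N1 \<union> N2" and ?u = "u_alpha K w \<alpha> (N1 \<union> N2)"
  have finN: "finite ?N" using fin by simp
  note u = level_le_u_alpha[OF finN \<alpha> w sum, of K]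
  have "\<not> (SUP m. ereal (T_stat (K m) ?N (\<lambda>x. if x \<in> N1 then 1 else - 1)
             - boot_quantile (K m) ?N (1 - ?u * exp (- w m)))) > 0"
    using acc unfolding aggregated_test_def by (auto simp: Let_def split: if_splits)
  then have "T_stat (K m) ?N (\<lambda>x. if x \<in> N1 then 1 else - 1) \<le> boot_quantile (K m) ?N (1 - ?u * exp (- w m))"
    by (auto simp: less_SUP_iff not_less)
  also have "\<dots> \<le> boot_quantile (K m) ?N (1 - \<alpha> * exp (- w m))"
    using u \<alpha> by (intro boot_quantile_mono[OF finN]) auto
  also have "\<dots> \<le> exp 1 * (ln (1 / (\<alpha> * exp (- w m))) + 2) * sqrt (2 * offdiag_sq_sum (K m) ?N)"
  proof (rule boot_quantile_bound[OF finN sym])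
    have "\<alpha> * exp (- w m) < 1 * 1" using \<alpha> w by (intro mult_strict_mono) auto
    then show "\<alpha> * exp (- w m) < 1" by simp
  qed (use \<alpha> in auto)
  also have "ln (1 / (\<alpha> * exp (- w m))) = ln (1 / \<alpha>) + w m"
    using \<alpha> by (simp add: ln_div ln_mult)
  finally show ?thesis .
qed

lemma ln_pi_sqrt6_pos: "0 < ln (pi / sqrt 6)"
proof -
  have "(3::real)\<^sup>2 < pi\<^sup>2" using pi_gt3 by (intro power_strict_mono) auto
  then have "sqrt 6 < pi" by (intro real_less_lsqrt) auto
  then show ?thesis by (intro ln_gt_zero) (auto simp: field_simps)
qed

lemma product_weight_pos: "0 < product_weight m"
proof -
  have "0 < ln (real (m $ i) + 1) + ln (pi / sqrt 6)" for i
    using ln_pi_sqrt6_pos by (intro add_nonneg_pos) auto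
  then show ?thesis unfolding product_weight_def by (auto intro!: sum_pos)
qed

text \<open>
  The exponential factorises over the coordinates, and by the Basel series each factor is a probability
  mass function on the natural numbers.
\<close>

lemma sum_exp_product_weight:
  fixes M :: "(nat ^ 'd::finite) set"
  assumes "finite M"
  shows "(\<Sum>m\<in>M. exp (- product_weight m)) \<le> 1"
proof -
  define B where "B = Suc (Max (insert 0 ((\<lambda>(m, i). m $ i) ` (M \<times> UNIV))))"
  let ?p = "\<lambda>j::nat. 6 / pi\<^sup>2 * (1 / (real j + 1)\<^sup>2)"
  have lt: "m $ i < B" if "m \<in> M" for m i
    unfolding B_def using that assms by (intro le_imp_less_Suc Max_ge) (auto intro!: image_eqI[of _ _ "(m, i)"])
  have e: "exp (- product_weight m) = (\<Prod>i\<in>UNIV. ?p (m $ i))" for m :: "nat ^ 'd"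
  proof -
    have "exp (- product_weight m) = (\<Prod>i\<in>UNIV. exp (- 2 * (ln (real (m $ i) + 1) + ln (pi / sqrt 6))))"
      unfolding product_weight_def by (subst exp_sum[symmetric]) (auto simp: sum_distrib_left sum_negf[symmetric])
    also have "\<dots> = (\<Prod>i\<in>UNIV. ?p (m $ i))"
    proof (intro prod.cong refl)
      fix i :: 'd
      have "exp (- 2 * s) = inverse ((exp s)\<^sup>2)" for s :: real
        by (simp add: exp_minus exp_double)
      then have "exp (- 2 * (ln (real (m $ i) + 1) + ln (pi / sqrt 6)))
          = inverse ((exp (ln (real (m $ i) + 1)) * exp (ln (pi / sqrt 6)))\<^sup>2)"
        by (simp only: exp_add)
      also have "\<dots> = ?p (m $ i)"
        by (simp add: power_mult_distrib power_divide inverse_eq_divide)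
      finally show "exp (- 2 * (ln (real (m $ i) + 1) + ln (pi / sqrt 6))) = ?p (m $ i)" .
    qed
    finally show ?thesis .
  qed
  have "(\<Sum>m\<in>M. exp (- product_weight m)) = (\<Sum>g\<in>vec_nth ` M. \<Prod>i\<in>UNIV. ?p (g i))"
    by (subst sum.reindex) (auto simp: inj_on_def vec_nth_inject e)
  also have "\<dots> \<le> (\<Sum>g\<in>PiE (UNIV :: 'd set) (\<lambda>_. {..<B}). \<Prod>i\<in>UNIV. ?p (g i))"
    by (rule sum_mono2) (use lt in \<open>auto intro!: finite_PiE prod_nonneg\<close>)
  also have "\<dots> = (\<Prod>i\<in>(UNIV :: 'd set). \<Sum>j<B. ?p j)"
    by (subst prod_sum_PiE) auto
  also have "\<dots> \<le> (\<Prod>i\<in>(UNIV :: 'd set). 1)"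
  proof (intro prod_mono conjI)
    have "(\<Sum>j<B. 1 / (real j + 1)\<^sup>2) \<le> pi\<^sup>2 / 6"
      using sum_le_suminf[OF sums_summable[OF inverse_squares_sums], of "{..<B}"]
        sums_unique[OF inverse_squares_sums] by (simp add: add_ac)
    then show "(\<Sum>j<B. ?p j) \<le> 1"
      unfolding sum_distrib_left[symmetric] by (simp add: field_simps)
  qed (auto intro!: sum_nonneg)
  finally show ?thesis by simp
qed

section \<open>Factorial moments of the pooled Poisson process\<close>

text \<open>
  The falling factorial; for \<open>r > n\<close> truncated subtraction makes it 0.
\<close>

definition ffall :: "nat \<Rightarrow> nat \<Rightarrow> nat" where
  "ffall n r = (\<Prod>i<r. n - i)"

lemma ffall_Suc: "ffall n (Suc r) = ffall n r * (n - r)"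
  by (simp add: ffall_def)

lemma ffall_eq_0: "k < r \<Longrightarrow> ffall k r = 0"
  unfolding ffall_def by (subst prod_zero_iff) auto

lemma fact_eq_ffall: "fact (k + r) = ffall (k + r) r * fact k"
proof (induction r arbitrary: k)
  case (Suc r)
  have "fact (k + Suc r) = (fact (Suc k + r) :: nat)" by simp
  also have "\<dots> = ffall (k + Suc r) r * fact (Suc k)" using Suc[of "Suc k"] by simp
  also have "\<dots> = ffall (k + Suc r) (Suc r) * fact k"
    by (simp add: ffall_Suc distrib_left distrib_right mult_ac)
  finally show ?case .
qed (simp add: ffall_def)

text \<open>
  The terms below \<open>r\<close> of the series vanish, and the others form a shifted exponential series.
\<close>

lemma poisson_factorial_moment:
  assumes "prob_space M" and X: "X \<in> M \<rightarrow>\<^sub>M count_space (UNIV :: nat set)" and \<theta>: "0 \<le> \<theta>"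
    and pois: "\<And>k. measure M {\<omega> \<in> space M. X \<omega> = k} = exp (- \<theta>) * \<theta> ^ k / fact k"
  shows "(\<integral>\<^sup>+\<omega>. of_nat (ffall (X \<omega>) r) \<partial>M) = ennreal (\<theta> ^ r)"
proof -
  interpret prob_space M by fact
  note X[measurable]
  have "(\<integral>\<^sup>+\<omega>. of_nat (ffall (X \<omega>) r) \<partial>M)
      = (\<integral>\<^sup>+\<omega>. (\<Sum>k. of_nat (ffall k r) * indicator {\<omega> \<in> space M. X \<omega> = k} \<omega>) \<partial>M)"
  proof (intro nn_integral_cong)
    fix \<omega> assume "\<omega> \<in> space M"
    then have "(\<Sum>k. of_nat (ffall k r) * indicator {\<omega> \<in> space M. X \<omega> = k} \<omega>)
        = (\<Sum>k\<in>{X \<omega>}. of_nat (ffall k r) * indicator {\<omega> \<in> space M. X \<omega> = k} \<omega> :: ennreal)"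
      by (intro suminf_finite) auto
    with \<open>\<omega> \<in> space M\<close> show "of_nat (ffall (X \<omega>) r)
        = (\<Sum>k. of_nat (ffall k r) * indicator {\<omega> \<in> space M. X \<omega> = k} \<omega> :: ennreal)" by simp
  qed
  also have "\<dots> = (\<Sum>k. of_nat (ffall k r) * emeasure M {\<omega> \<in> space M. X \<omega> = k})"
    by (subst nn_integral_suminf) (auto simp: nn_integral_cmult)
  also have "\<dots> = (\<Sum>k. ennreal (real (ffall k r) * (exp (- \<theta>) * \<theta> ^ k / fact k)))"
    by (subst ennreal_mult) (use \<theta> in \<open>auto simp: emeasure_eq_measure pois ennreal_of_nat_eq_real_of_nat\<close>)
  also have "\<dots> = ennreal (\<theta> ^ r)"
  proof (rule suminf_ennreal_eq)
    have "real (ffall (k + r) r) * (exp (- \<theta>) * \<theta> ^ (k + r) / fact (k + r)) = exp (- \<theta>) * \<theta> ^ r * (\<theta> ^ k /\<^sub>R fact k)" for k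
    proof -
      have "fact (k + r) = real (ffall (k + r) r) * fact k"
        by (metis fact_eq_ffall of_nat_fact of_nat_mult)
      moreover have "real (ffall (k + r) r) \<noteq> 0"
        unfolding ffall_def by (subst of_nat_eq_0_iff, subst prod_zero_iff) auto
      ultimately show ?thesis by (simp add: power_add field_simps)
    qed
    moreover have "(\<lambda>k. exp (- \<theta>) * \<theta> ^ r * (\<theta> ^ k /\<^sub>R fact k)) sums (exp (- \<theta>) * \<theta> ^ r * exp \<theta>)"
      by (intro sums_mult exp_converges)
    moreover have "exp (- \<theta>) * \<theta> ^ r * exp \<theta> = \<theta> ^ r"
      by (simp add: exp_minus)
    ultimately have "(\<lambda>k. real (ffall (k + r) r) * (exp (- \<theta>) * \<theta> ^ (k + r) / fact (k + r))) sums (\<theta> ^ r)"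
      by (simp only:)
    then show "(\<lambda>k. real (ffall k r) * (exp (- \<theta>) * \<theta> ^ k / fact k)) sums (\<theta> ^ r)"
      by (subst (asm) sums_zero_iff_shift) (auto simp: ffall_eq_0)
  qed (use \<theta> in auto)
  finally show ?thesis .
qed

lemma (in prob_space) indep_var_nn_integral:
  assumes ind: "indep_var S X T Y" and u: "u \<in> borel_measurable S" and v: "v \<in> borel_measurable T"
  shows "(\<integral>\<^sup>+\<omega>. u (X \<omega>) * v (Y \<omega>) \<partial>M) = (\<integral>\<^sup>+\<omega>. u (X \<omega>) \<partial>M) * (\<integral>\<^sup>+\<omega>. v (Y \<omega>) \<partial>M)"
proof -
  have "indep_vars (\<lambda>_. borel) (\<lambda>b \<omega>. (case b of True \<Rightarrow> u (X \<omega>) | False \<Rightarrow> v (Y \<omega>))) UNIV"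
  proof -
    have "indep_vars (\<lambda>_. borel)
        (\<lambda>b \<omega>. (case b of True \<Rightarrow> u | False \<Rightarrow> v) ((case b of True \<Rightarrow> X | False \<Rightarrow> Y) \<omega>)) UNIV"
      using u v by (intro indep_vars_compose2[OF ind[unfolded indep_var_def]]) (auto split: bool.splits)
    also have "(\<lambda>b \<omega>. (case b of True \<Rightarrow> u | False \<Rightarrow> v) ((case b of True \<Rightarrow> X | False \<Rightarrow> Y) \<omega>))
        = (\<lambda>b \<omega>. (case b of True \<Rightarrow> u (X \<omega>) | False \<Rightarrow> v (Y \<omega>)))"
      by (auto simp: fun_eq_iff split: bool.splits)
    finally show ?thesis .
  qed
  from indep_vars_nn_integral[OF _ this] show ?thesis
    by (simp add: UNIV_bool mult.commute)
qed

lemma space_config: "space config = {S. finite S}"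
  unfolding config_def by (subst space_measure_of) auto

lemma measurable_card_config [measurable]:
  assumes "A \<in> sets borel"
  shows "(\<lambda>S. card (S \<inter> A)) \<in> config \<rightarrow>\<^sub>M count_space UNIV"
  unfolding measurable_count_space_eq2_countable
proof safe
  fix k
  have "(\<lambda>S. card (S \<inter> A)) -` {k} \<inter> space config = {S. finite S \<and> card (S \<inter> A) = k}"
    by (auto simp: space_config)
  also have "\<dots> \<in> sets config"
    unfolding config_def using assms by (subst sets_measure_of) auto
  finally show "(\<lambda>S. card (S \<inter> A)) -` {k} \<inter> space config \<in> sets config" .
qed auto

text \<open>
  The counts of disjoint sets are independent, so their factorial moments multiply.
\<close>

lemma poisson_process_factorial_moment:
  fixes N :: "'w \<Rightarrow> 'a::topological_space set"
  assumes pp: "poisson_process M N \<mu> f" and \<mu>: "sets \<mu> = sets borel"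
    and f: "\<And>x. 0 \<le> f x" "integrable \<mu> f"
    and J: "finite J" and A: "\<And>j. j \<in> J \<Longrightarrow> A j \<in> sets borel" and disj: "disjoint_family_on A J"
  shows "(\<integral>\<^sup>+\<omega>. (\<Prod>j\<in>J. of_nat (ffall (card (N \<omega> \<inter> A j)) (r j))) \<partial>M)
       = (\<Prod>j\<in>J. (\<integral>\<^sup>+x\<in>A j. ennreal (f x) \<partial>\<mu>) ^ r j)"
proof -
  from pp interpret prob_space M by (simp add: poisson_process_def)
  have N[measurable]: "N \<in> M \<rightarrow>\<^sub>M config" using pp by (simp add: poisson_process_def)
  obtain e where e: "bij_betw e {..<card J} J"
    using ex_bij_betw_nat_finite[OF J] by (auto simp: atLeast0LessThan)
  define B where "B i = (if i < card J then A (e i) else {})" for i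
  have B: "range B \<subseteq> sets borel"
    using A bij_betwE[OF e] by (auto simp: B_def)
  have "disjoint_family B"
    unfolding disjoint_family_on_def
  proof (intro ballI impI)
    fix m n :: nat assume "m \<noteq> n"
    show "B m \<inter> B n = {}"
    proof (cases "m < card J \<and> n < card J")
      case True
      then have "e m \<in> J" "e n \<in> J" "e m \<noteq> e n"
        using e \<open>m \<noteq> n\<close> by (auto simp: bij_betw_def inj_on_def)
      with disj True show ?thesis by (auto simp: B_def disjoint_family_on_def)
    qed (auto simp: B_def)
  qed
  with pp B have "indep_vars (\<lambda>_. count_space UNIV) (\<lambda>j \<omega>. card (N \<omega> \<inter> B j)) UNIV"
    unfolding poisson_process_def by blast
  then have "indep_vars (\<lambda>_. count_space UNIV) (\<lambda>j \<omega>. card (N \<omega> \<inter> B j)) {..<card J}"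
    by (rule indep_vars_subset) auto
  then have ind: "indep_vars (\<lambda>_. borel) (\<lambda>i \<omega>. of_nat (ffall (card (N \<omega> \<inter> B i)) (r (e i))) :: ennreal) {..<card J}"
    by (rule indep_vars_compose2) auto
  have "(\<integral>\<^sup>+\<omega>. (\<Prod>j\<in>J. of_nat (ffall (card (N \<omega> \<inter> A j)) (r j))) \<partial>M)
      = (\<integral>\<^sup>+\<omega>. (\<Prod>i<card J. of_nat (ffall (card (N \<omega> \<inter> B i)) (r (e i)))) \<partial>M)"
    by (subst prod.reindex_bij_betw[OF e, symmetric]) (auto simp: B_def intro!: nn_integral_cong prod.cong)
  also have "\<dots> = (\<Prod>i<card J. \<integral>\<^sup>+\<omega>. of_nat (ffall (card (N \<omega> \<inter> B i)) (r (e i))) \<partial>M)"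
    by (intro indep_vars_nn_integral ind) auto
  also have "\<dots> = (\<Prod>i<card J. (\<integral>\<^sup>+x\<in>A (e i). ennreal (f x) \<partial>\<mu>) ^ r (e i))"
  proof (intro prod.cong refl)
    fix i assume i: "i \<in> {..<card J}"
    then have Bi: "B i = A (e i)" and Ai[measurable]: "A (e i) \<in> sets borel" 
      using A bij_betwE[OF e] by (auto simp: B_def)
    let ?\<theta> = "LINT x:A (e i)|\<mu>. f x"
    have "A (e i) \<in> sets \<mu>" using \<mu> Ai by simp
    then have int: "set_integrable \<mu> (A (e i)) f"
      unfolding set_integrable_def using f(2) by (rule integrable_mult_indicator)
    have \<theta>: "0 \<le> ?\<theta>" unfolding set_lebesgue_integral_def using f by (intro integral_nonneg_AE) auto
    have "(\<integral>\<^sup>+\<omega>. of_nat (ffall (card (N \<omega> \<inter> B i)) (r (e i))) \<partial>M) = ennreal (?\<theta> ^ r (e i))"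
      unfolding Bi
    proof (rule poisson_factorial_moment[OF prob_space_axioms])
      show "measure M {\<omega> \<in> space M. card (N \<omega> \<inter> A (e i)) = k} = exp (- ?\<theta>) * ?\<theta> ^ k / fact k" for k
        using pp Ai unfolding poisson_process_def by blast
      show "(\<lambda>\<omega>. card (N \<omega> \<inter> A (e i))) \<in> M \<rightarrow>\<^sub>M count_space UNIV"
        by (rule measurable_compose[OF N measurable_card_config[OF Ai]])
    qed (rule \<theta>)
    also have "\<dots> = (ennreal ?\<theta>) ^ r (e i)" using \<theta> by (simp add: ennreal_power)
    also have "ennreal ?\<theta> = (\<integral>\<^sup>+x\<in>A (e i). ennreal (f x) \<partial>\<mu>)"
      unfolding set_lebesgue_integral_def
      using int f unfolding set_integrable_def
      by (subst nn_integral_eq_integral[symmetric])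
         (auto intro!: nn_integral_cong simp: indicator_def)
    finally show "(\<integral>\<^sup>+\<omega>. of_nat (ffall (card (N \<omega> \<inter> B i)) (r (e i))) \<partial>M)
       = (\<integral>\<^sup>+x\<in>A (e i). ennreal (f x) \<partial>\<mu>) ^ r (e i)" .
  qed
  also have "\<dots> = (\<Prod>j\<in>J. (\<integral>\<^sup>+x\<in>A j. ennreal (f x) \<partial>\<mu>) ^ r j)"
    by (rule prod.reindex_bij_betw[OF e])
  finally show ?thesis .
qed

text \<open>
  Tuples of distinct points. They are extensional functions and hence belong to the space of a
  product measure over \<open>I\<close>.
\<close>

definition inj_tuples :: "'i set \<Rightarrow> 'a set \<Rightarrow> ('i \<Rightarrow> 'a) set" where
  "inj_tuples I Z = {x \<in> PiE I (\<lambda>_. Z). inj_on x I}"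

lemma finite_inj_tuples [simp]: "finite I \<Longrightarrow> finite Z \<Longrightarrow> finite (inj_tuples I Z)"
  unfolding inj_tuples_def by (auto intro: finite_subset[OF _ finite_PiE[of I "\<lambda>_. Z"]])

lemma bij_betw_inj_tuples_insert:
  assumes j: "j \<notin> I"
  shows "bij_betw (\<lambda>(x, y). x(j := y)) (SIGMA x:inj_tuples I Z. Z - x ` I) (inj_tuples (insert j I) Z)"
    (is "bij_betw ?f ?S ?D")
  unfolding bij_betw_def
proof (intro conjI equalityI subsetI)
  show "inj_on ?f ?S"
  proof (rule inj_onI, clarify)
    fix x y x' y'
    assume "x \<in> inj_tuples I Z" "x' \<in> inj_tuples I Z" and eq: "x(j := y) = x'(j := y')"
    then have "x j = undefined" "x' j = undefined"
      using j by (auto simp: inj_tuples_def PiE_iff extensional_def)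
    then have "x i = x' i" for i using fun_cong[OF eq, of i] by (cases "i = j") auto
    moreover have "y = y'" using fun_cong[OF eq, of j] by simp
    ultimately show "x = x' \<and> y = y'" by auto
  qed
next
  fix x assume x: "x \<in> ?D"
  have "x = ?f (x(j := undefined), x j)" by simp
  moreover have "(x(j := undefined), x j) \<in> ?S"
    using x j unfolding inj_tuples_def
    by (auto simp: PiE_iff extensional_def inj_on_def split: if_splits)
  ultimately show "x \<in> ?f ` ?S" by (rule image_eqI)
next
  fix x assume "x \<in> ?f ` ?S"
  then obtain x' y where x: "x = x'(j := y)" and x': "x' \<in> PiE I (\<lambda>_. Z)" "inj_on x' I"
    and y: "y \<in> Z" "y \<notin> x' ` I"
    unfolding inj_tuples_def by auto
  have "x \<in> PiE (insert j I) (\<lambda>_. Z)"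
    unfolding x using x'(1) y(1) by (intro PiE_fun_upd)
  moreover have "inj_on x (insert j I)"
    unfolding inj_on_insert x using x' y j
    by (auto intro!: inj_on_fun_updI simp: image_iff)
  ultimately show "x \<in> ?D" by (simp add: inj_tuples_def)
qed

lemma sum_inj_tuples_insert:
  assumes "finite I" "finite Z" "j \<notin> I"
  shows "(\<Sum>x\<in>inj_tuples (insert j I) Z. h x) = (\<Sum>x\<in>inj_tuples I Z. \<Sum>y\<in>Z - x ` I. h (x(j := y)))"
proof -
  have "(\<Sum>x\<in>inj_tuples (insert j I) Z. h x)
      = (\<Sum>p\<in>(SIGMA x:inj_tuples I Z. Z - x ` I). h (case p of (x, y) \<Rightarrow> x(j := y)))"
    by (rule sum.reindex_bij_betw[OF bij_betw_inj_tuples_insert[OF assms(3)], symmetric])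
  also have "\<dots> = (\<Sum>x\<in>inj_tuples I Z. \<Sum>y\<in>Z - x ` I. h (x(j := y)))"
    using assms by (subst sum.Sigma) (auto simp: case_prod_unfold)
  finally show ?thesis .
qed

lemma inj_tuples_empty [simp]: "inj_tuples {} Z = {\<lambda>_. undefined}"
  by (auto simp: inj_tuples_def)

text \<open>
  The points are drawn one after another: a point with a given label is any point with this label that
  has not been drawn yet.
\<close>

lemma card_inj_tuples_labels:
  assumes Z: "finite Z" and I: "finite I" and L: "finite L" "\<sigma> ` I \<subseteq> L"
  shows "card {x \<in> inj_tuples I Z. \<forall>i\<in>I. \<l> (x i) = \<sigma> i}
       = (\<Prod>l\<in>L. ffall (card {z \<in> Z. \<l> z = l}) (card {i \<in> I. \<sigma> i = l}))"
  using I L(2)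
proof (induction I)
  case empty
  then show ?case by (simp add: ffall_def)
next
  case (insert j I)
  let ?D = "\<lambda>I. {x \<in> inj_tuples I Z. \<forall>i\<in>I. \<l> (x i) = \<sigma> i}"
  let ?F = "{z \<in> Z. \<l> z = \<sigma> j}" and ?r = "\<lambda>I l. card {i \<in> I. \<sigma> i = l}"
  let ?c = "\<lambda>l. card {z \<in> Z. \<l> z = l}"
  have fibre: "card (?F - x ` I) = ?c (\<sigma> j) - ?r I (\<sigma> j)" if x: "x \<in> ?D I" for x
  proof -
    have "?F - x ` I = ?F - x ` {i \<in> I. \<sigma> i = \<sigma> j}" using x by auto
    also have "card \<dots> = card ?F - card (x ` {i \<in> I. \<sigma> i = \<sigma> j})"
      using x insert.hyps by (intro card_Diff_subset) (auto simp: inj_tuples_def)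
    also have "card (x ` {i \<in> I. \<sigma> i = \<sigma> j}) = ?r I (\<sigma> j)"
      using x by (intro card_image) (auto simp: inj_tuples_def intro: inj_on_subset)
    finally show ?thesis .
  qed
  have as_sum: "card (?D J) = (\<Sum>x\<in>inj_tuples J Z. if \<forall>i\<in>J. \<l> (x i) = \<sigma> i then 1 else 0)" if "finite J" for J
    using that Z by (simp add: sum.If_cases Int_def)
  have "card (?D (insert j I))
      = (\<Sum>x\<in>inj_tuples I Z. \<Sum>y\<in>Z - x ` I. if \<forall>i\<in>insert j I. \<l> ((x(j := y)) i) = \<sigma> i then 1 else 0)"
    unfolding as_sum[OF finite.insertI[OF insert.hyps(1)]]
    by (rule sum_inj_tuples_insert[OF insert.hyps(1) Z insert.hyps(2)])
  also have "\<dots> = (\<Sum>x\<in>inj_tuples I Z. if \<forall>i\<in>I. \<l> (x i) = \<sigma> i then ?c (\<sigma> j) - ?r I (\<sigma> j) else 0)"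
  proof (rule sum.cong[OF refl])
    fix x assume x: "x \<in> inj_tuples I Z"
    have "(\<Sum>y\<in>Z - x ` I. if \<forall>i\<in>insert j I. \<l> ((x(j := y)) i) = \<sigma> i then 1 else 0)
        = (\<Sum>y\<in>Z - x ` I. if (\<forall>i\<in>I. \<l> (x i) = \<sigma> i) \<and> \<l> y = \<sigma> j then 1 else 0 :: nat)"
    proof (rule sum.cong[OF refl])
      fix y
      have "(\<forall>i\<in>insert j I. \<l> ((x(j := y)) i) = \<sigma> i) \<longleftrightarrow> (\<forall>i\<in>I. \<l> (x i) = \<sigma> i) \<and> \<l> y = \<sigma> j"
        using insert.hyps(2) by auto
      then show "(if \<forall>i\<in>insert j I. \<l> ((x(j := y)) i) = \<sigma> i then 1 else 0)
          = (if (\<forall>i\<in>I. \<l> (x i) = \<sigma> i) \<and> \<l> y = \<sigma> j then 1 else 0 :: nat)" by simp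
    qed
    also have "\<dots> = (if \<forall>i\<in>I. \<l> (x i) = \<sigma> i then card {y \<in> Z - x ` I. \<l> y = \<sigma> j} else 0)"
      using Z by (simp add: sum.If_cases Int_def)
    also have "{y \<in> Z - x ` I. \<l> y = \<sigma> j} = ?F - x ` I" by auto
    finally show "(\<Sum>y\<in>Z - x ` I. if \<forall>i\<in>insert j I. \<l> ((x(j := y)) i) = \<sigma> i then 1 else 0)
        = (if \<forall>i\<in>I. \<l> (x i) = \<sigma> i then ?c (\<sigma> j) - ?r I (\<sigma> j) else 0)"
      using fibre[of x] x by simp
  qed
  also have "\<dots> = (\<Prod>l\<in>L. ffall (?c l) (?r I l)) * (?c (\<sigma> j) - ?r I (\<sigma> j))"
    using insert Z by (simp add: sum.If_cases Int_def)
  also have "\<dots> = (\<Prod>l\<in>L. ffall (?c l) (?r (insert j I) l))"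
  proof -
    have rj: "?r (insert j I) (\<sigma> j) = Suc (?r I (\<sigma> j))"
    proof -
      have "{i \<in> insert j I. \<sigma> i = \<sigma> j} = insert j {i \<in> I. \<sigma> i = \<sigma> j}" by auto
      then show ?thesis using insert.hyps by simp
    qed
    have rl: "?r (insert j I) l = ?r I l" if "l \<noteq> \<sigma> j" for l
      using that by (intro arg_cong[where f = card]) auto
    have jL: "\<sigma> j \<in> L" using insert.prems by auto
    have rest: "(\<Prod>l\<in>L - {\<sigma> j}. ffall (?c l) (?r (insert j I) l)) = (\<Prod>l\<in>L - {\<sigma> j}. ffall (?c l) (?r I l))"
    proof (rule prod.cong[OF refl])
      fix l assume "l \<in> L - {\<sigma> j}"
      then have "l \<noteq> \<sigma> j" by simp
      from rl[OF this] show "ffall (?c l) (?r (insert j I) l) = ffall (?c l) (?r I l)" by (rule arg_cong)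
    qed
    show ?thesis
      by (simp only: prod.remove[OF L(1) jL] rj rest ffall_Suc mult_ac)
  qed
  finally show ?case .
qed

text \<open>
  The pooled sample, where the mark tells the origin of a point. A point that is common to both samples
  gives two marked points.
\<close>

definition marked :: "'a set \<times> 'a set \<Rightarrow> ('a \<times> bool) set" where
  "marked \<omega> = fst \<omega> \<times> {True} \<union> snd \<omega> \<times> {False}"

abbreviation mark_space :: "('a::euclidean_space \<times> bool) measure" where
  "mark_space \<equiv> borel \<Otimes>\<^sub>M count_space UNIV"

text \<open>
  The mean measure of the marked sample.
\<close>

definition mark_measure :: "real \<Rightarrow> ('a::euclidean_space \<Rightarrow> real) \<Rightarrow> ('a \<Rightarrow> real) \<Rightarrow> ('a \<times> bool) measure" where
  "mark_measure n f g = density (lborel \<Otimes>\<^sub>M count_space UNIV)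
     (\<lambda>(x, b). ennreal (n * (if b then f x else g x)))"

lemma sets_mark_measure [measurable_cong, simp]: "sets (mark_measure n f g) = sets mark_space"
  unfolding mark_measure_def sets_density by (rule sets_pair_measure_cong) simp_all

lemma space_mark_measure [simp]: "space (mark_measure n f g) = UNIV"
  using sets_eq_imp_space_eq[OF sets_mark_measure, of n f g] by (simp add: space_pair_measure)

lemma nn_integral_mark_measure:
  fixes f g :: "'a::euclidean_space \<Rightarrow> real"
  assumes [measurable]: "f \<in> borel_measurable borel" "g \<in> borel_measurable borel"
    and h[measurable]: "h \<in> borel_measurable mark_space"
  shows "(\<integral>\<^sup>+z. h z \<partial>mark_measure n f g)
    = (\<integral>\<^sup>+x. ennreal (n * f x) * h (x, True) \<partial>lborel) + (\<integral>\<^sup>+x. ennreal (n * g x) * h (x, False) \<partial>lborel)"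
proof -
  interpret C: sigma_finite_measure "count_space (UNIV :: bool set)"
    by (rule sigma_finite_measure_count_space_finite) simp
  have [measurable]: "h \<in> borel_measurable (lborel \<Otimes>\<^sub>M count_space UNIV)"
    using h by (simp cong: measurable_cong_sets)
  have "(\<integral>\<^sup>+z. h z \<partial>mark_measure n f g)
      = (\<integral>\<^sup>+z. (case z of (x, b) \<Rightarrow> ennreal (n * (if b then f x else g x))) * h z \<partial>(lborel \<Otimes>\<^sub>M count_space UNIV))"
    unfolding mark_measure_def by (subst nn_integral_density) auto
  also have "\<dots> = (\<integral>\<^sup>+x. \<integral>\<^sup>+b. ennreal (n * (if b then f x else g x)) * h (x, b) \<partial>count_space UNIV \<partial>lborel)"
    by (subst C.nn_integral_fst[symmetric]) auto
  also have "\<dots> = (\<integral>\<^sup>+x. ennreal (n * f x) * h (x, True) + ennreal (n * g x) * h (x, False) \<partial>lborel)"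
    by (intro nn_integral_cong) (simp add: nn_integral_count_space_finite UNIV_bool add_ac)
  also have "\<dots> = (\<integral>\<^sup>+x. ennreal (n * f x) * h (x, True) \<partial>lborel) + (\<integral>\<^sup>+x. ennreal (n * g x) * h (x, False) \<partial>lborel)"
    by (intro nn_integral_add) auto
  finally show ?thesis .
qed

lemma finite_measure_mark_measure:
  assumes f: "intensity f" and g: "intensity g" and n: "0 < n"
  shows "finite_measure (mark_measure n f g)"
proof
  have [measurable]: "f \<in> borel_measurable borel" "g \<in> borel_measurable borel"
    using f g unfolding intensity_def by (auto dest!: borel_measurable_integrable)
  have "emeasure (mark_measure n f g) (space (mark_measure n f g)) = (\<integral>\<^sup>+z. 1 \<partial>mark_measure n f g)"
    by simp
  also have "\<dots> = (\<integral>\<^sup>+x. ennreal (n * f x) \<partial>lborel) + (\<integral>\<^sup>+x. ennreal (n * g x) \<partial>lborel)"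
    by (subst nn_integral_mark_measure) auto
  also have "\<dots> < \<infinity>"
    using f g n unfolding intensity_def
    by (subst (1 2) nn_integral_eq_integral) auto
  finally show "emeasure (mark_measure n f g) (space (mark_measure n f g)) \<noteq> \<infinity>" by simp
qed

text \<open>
  If the label of a point records its mark, then each label counts points of one sample only, and the
  independence of the samples makes the factorial moments multiply across the marks as well.
\<close>

lemma two_sample_label_moment:
  fixes f g :: "'a::euclidean_space \<Rightarrow> real" and \<l> :: "'a \<times> bool \<Rightarrow> 'l"
  assumes law: "two_sample_law (scale_measure (ennreal n) lborel) f g P"
    and f: "intensity f" and g: "intensity g" and n: "0 < n"
    and L: "finite L" and meas: "\<And>l b. l \<in> L \<Longrightarrow> {x. \<l> (x, b) = l} \<in> sets borel"
  shows "(\<integral>\<^sup>+\<omega>. (\<Prod>p\<in>UNIV \<times> L. of_nat (ffall (card {z \<in> marked \<omega>. (snd z, \<l> z) = p}) (r p))) \<partial>P)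
       = (\<Prod>p\<in>UNIV \<times> L. emeasure (mark_measure n f g) {z. (snd z, \<l> z) = p} ^ r p)"
proof -
  let ?\<mu> = "scale_measure (ennreal n) (lborel :: 'a measure)"
  interpret P: prob_space P using law by (simp add: two_sample_law_def)
  have fg[measurable]: "f \<in> borel_measurable borel" "g \<in> borel_measurable borel"
    using f g unfolding intensity_def by (auto dest!: borel_measurable_integrable)
  define A where "A b l = {x. \<l> (x, b) = l}" for b l
  have A[measurable]: "l \<in> L \<Longrightarrow> A b l \<in> sets borel" for b l using meas by (simp add: A_def)
  define F where "F b l S = (of_nat (ffall (card (S \<inter> A b l)) (r (b, l))) :: ennreal)" for b l S
  have F: "(\<lambda>S. \<Prod>l\<in>L. F b l S) \<in> borel_measurable config" for b
    unfolding F_def by (intro borel_measurable_prod_ennreal measurable_compose[OF measurable_card_config[OF A]]) auto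
  have int: "integrable ?\<mu> h" if "intensity h" for h
  proof -
    have "integrable lborel h" using that by (simp add: intensity_def)
    then show ?thesis
      unfolding integrable_iff_bounded
      by (subst nn_integral_scale_measure) (auto simp: ennreal_mult_less_top cong: measurable_cong_sets)
  qed
  have split: "(\<Prod>p\<in>UNIV \<times> L. h p) = (\<Prod>l\<in>L. h (True, l)) * (\<Prod>l\<in>L. h (False, l))" for h :: "bool \<times> 'l \<Rightarrow> ennreal"
  proof -
    have "(\<Prod>p\<in>UNIV \<times> L. h p) = (\<Prod>b\<in>UNIV. \<Prod>l\<in>L. h (b, l))"
      by (subst prod.cartesian_product) (simp add: case_prod_unfold)
    then show ?thesis by (simp add: UNIV_bool mult.commute)
  qed
  have cardT: "card {z \<in> marked \<omega>. (snd z, \<l> z) = (True, l)} = card (fst \<omega> \<inter> A True l)" for \<omega> l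
  proof -
    have "{z \<in> marked \<omega>. (snd z, \<l> z) = (True, l)} = (\<lambda>x. (x, True)) ` (fst \<omega> \<inter> A True l)"
      unfolding marked_def A_def by auto
    then show ?thesis by (simp add: card_image inj_on_def)
  qed
  have cardF: "card {z \<in> marked \<omega>. (snd z, \<l> z) = (False, l)} = card (snd \<omega> \<inter> A False l)" for \<omega> l
  proof -
    have "{z \<in> marked \<omega>. (snd z, \<l> z) = (False, l)} = (\<lambda>x. (x, False)) ` (snd \<omega> \<inter> A False l)"
      unfolding marked_def A_def by auto
    then show ?thesis by (simp add: card_image inj_on_def)
  qed
  have "(\<integral>\<^sup>+\<omega>. (\<Prod>p\<in>UNIV \<times> L. of_nat (ffall (card {z \<in> marked \<omega>. (snd z, \<l> z) = p}) (r p))) \<partial>P)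
      = (\<integral>\<^sup>+\<omega>. (\<Prod>l\<in>L. F True l (fst \<omega>)) * (\<Prod>l\<in>L. F False l (snd \<omega>)) \<partial>P)"
    by (simp only: split cardT cardF F_def)
  also have "\<dots> = (\<integral>\<^sup>+\<omega>. (\<Prod>l\<in>L. F True l (fst \<omega>)) \<partial>P) * (\<integral>\<^sup>+\<omega>. (\<Prod>l\<in>L. F False l (snd \<omega>)) \<partial>P)"
    using law F by (intro P.indep_var_nn_integral) (auto simp: two_sample_law_def)
  also have "(\<integral>\<^sup>+\<omega>. (\<Prod>l\<in>L. F True l (fst \<omega>)) \<partial>P) = (\<Prod>l\<in>L. (\<integral>\<^sup>+x\<in>A True l. ennreal (f x) \<partial>?\<mu>) ^ r (True, l))"
    unfolding F_def
  proof (rule poisson_process_factorial_moment)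
    show "integrable ?\<mu> f" using f by (rule int)
  qed (use law f L in \<open>auto simp: two_sample_law_def intensity_def disjoint_family_on_def A_def meas\<close>)
  also have "(\<integral>\<^sup>+\<omega>. (\<Prod>l\<in>L. F False l (snd \<omega>)) \<partial>P) = (\<Prod>l\<in>L. (\<integral>\<^sup>+x\<in>A False l. ennreal (g x) \<partial>?\<mu>) ^ r (False, l))"
    unfolding F_def
  proof (rule poisson_process_factorial_moment)
    show "integrable ?\<mu> g" using g by (rule int)
  qed (use law g L in \<open>auto simp: two_sample_law_def intensity_def disjoint_family_on_def A_def meas\<close>)
  also have "(\<Prod>l\<in>L. (\<integral>\<^sup>+x\<in>A True l. ennreal (f x) \<partial>?\<mu>) ^ r (True, l)) * (\<Prod>l\<in>L. (\<integral>\<^sup>+x\<in>A False l. ennreal (g x) \<partial>?\<mu>) ^ r (False, l))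
     = (\<Prod>p\<in>UNIV \<times> L. emeasure (mark_measure n f g) {z. (snd z, \<l> z) = p} ^ r p)"
  proof -
    have em: "emeasure (mark_measure n f g) {z. (snd z, \<l> z) = (b, l)}
        = (\<integral>\<^sup>+x\<in>A b l. ennreal (if b then f x else g x) \<partial>?\<mu>)" if l: "l \<in> L" for b l
    proof -
      have set: "{z. (snd z, \<l> z) = (b, l)} = A b l \<times> {b}" by (auto simp: A_def)
      have S[measurable]: "A b l \<times> {b} \<in> sets mark_space" using A[OF l] by auto
      have "emeasure (mark_measure n f g) (A b l \<times> {b}) = (\<integral>\<^sup>+z. indicator (A b l \<times> {b}) z \<partial>mark_measure n f g)"
        by simp
      also have "\<dots> = (\<integral>\<^sup>+x. ennreal n * (ennreal (if b then f x else g x) * indicator (A b l) x) \<partial>lborel)"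
      proof -
        have mult: "ennreal (n * h x) = ennreal n * ennreal (h x)" if "intensity h" for h :: "'a \<Rightarrow> real" and x
          using that n by (simp add: ennreal_mult intensity_def)
        have "(\<integral>\<^sup>+z. indicator (A b l \<times> {b}) z \<partial>mark_measure n f g)
            = (\<integral>\<^sup>+x. ennreal (n * f x) * indicator (A b l \<times> {b}) (x, True) \<partial>lborel)
            + (\<integral>\<^sup>+x. ennreal (n * g x) * indicator (A b l \<times> {b}) (x, False) \<partial>lborel)"
          by (rule nn_integral_mark_measure) (use S in auto)
        also have "\<dots> = (\<integral>\<^sup>+x. ennreal n * (ennreal (if b then f x else g x) * indicator (A b l) x) \<partial>lborel)"
          by (cases b) (simp_all add: indicator_times mult[OF f] mult[OF g] mult.assoc)
        finally show ?thesis .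
      qed
      also have "\<dots> = (\<integral>\<^sup>+x\<in>A b l. ennreal (if b then f x else g x) \<partial>?\<mu>)"
        using A[OF l] by (subst nn_integral_cmult) (auto simp: nn_integral_scale_measure)
      finally show ?thesis unfolding set .
    qed
    show ?thesis
      unfolding split by (intro arg_cong2[where f = "(*)"] prod.cong refl) (simp only: em if_True if_False)+
  qed
  finally show ?thesis .
qed

lemma finite_marked: "finite (fst \<omega>) \<Longrightarrow> finite (snd \<omega>) \<Longrightarrow> finite (marked \<omega>)"
  unfolding marked_def by auto

locale two_sample =
  fixes n :: real and f g :: "'a::euclidean_space \<Rightarrow> real" and P :: "('a set \<times> 'a set) measure"
  assumes law: "two_sample_law (scale_measure (ennreal n) lborel) f g P"
    and f: "intensity f" and g: "intensity g" and n: "0 < n"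
begin

sublocale prob_space P
  using law by (simp add: two_sample_law_def)

abbreviation \<nu> :: "('a \<times> bool) measure" where
  "\<nu> \<equiv> mark_measure n f g"

sublocale mark: finite_measure \<nu>
  by (rule finite_measure_mark_measure[OF f g n])

lemma product_sigma_finite_mark: "product_sigma_finite (\<lambda>_. \<nu>)"
  by (simp add: product_sigma_finite_def mark.sigma_finite_measure_axioms)

lemma sets_P [measurable_cong]: "sets P = sets (config \<Otimes>\<^sub>M config)"
  using law by (simp add: two_sample_law_def)

lemma space_P: "space P = {S. finite S} \<times> {S. finite S}"
  using sets_eq_imp_space_eq[OF sets_P] by (simp add: space_pair_measure space_config)

lemma finite_marked_P: "\<omega> \<in> space P \<Longrightarrow> finite (marked \<omega>)"
  by (rule finite_marked) (auto simp: space_P)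

lemma measurable_card_marked:
  assumes A: "{x. (x, True) \<in> A} \<in> sets borel" "{x. (x, False) \<in> A} \<in> sets borel"
  shows "(\<lambda>\<omega>. card (marked \<omega> \<inter> A)) \<in> P \<rightarrow>\<^sub>M count_space UNIV"
proof -
  let ?A = "\<lambda>b. {x. (x, b) \<in> A}"
  have "card (marked \<omega> \<inter> A) = card (fst \<omega> \<inter> ?A True) + card (snd \<omega> \<inter> ?A False)" if "\<omega> \<in> space P" for \<omega>
  proof -
    have fin: "finite (fst \<omega>)" "finite (snd \<omega>)"
      using that by (auto simp: space_P)
    have "marked \<omega> \<inter> A = (\<lambda>x. (x, True)) ` (fst \<omega> \<inter> ?A True) \<union> (\<lambda>x. (x, False)) ` (snd \<omega> \<inter> ?A False)"
      unfolding marked_def by auto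
    moreover have "card ((\<lambda>x. (x, True)) ` (fst \<omega> \<inter> ?A True) \<union> (\<lambda>x. (x, False)) ` (snd \<omega> \<inter> ?A False))
        = card ((\<lambda>x. (x, True)) ` (fst \<omega> \<inter> ?A True)) + card ((\<lambda>x. (x, False)) ` (snd \<omega> \<inter> ?A False))"
      using fin by (intro card_Un_disjoint) auto
    ultimately show ?thesis
      by (simp add: card_image inj_on_def)
  qed
  moreover have "(\<lambda>\<omega>. card (fst \<omega> \<inter> ?A True) + card (snd \<omega> \<inter> ?A False)) \<in> P \<rightarrow>\<^sub>M count_space UNIV"
  proof -
    have [measurable]: "(\<lambda>\<omega>. card (fst \<omega> \<inter> ?A True)) \<in> P \<rightarrow>\<^sub>M count_space UNIV"
      by (rule measurable_compose[OF _ measurable_card_config[OF A(1)]]) measurable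
    have [measurable]: "(\<lambda>\<omega>. card (snd \<omega> \<inter> ?A False)) \<in> P \<rightarrow>\<^sub>M count_space UNIV"
      by (rule measurable_compose[OF _ measurable_card_config[OF A(2)]]) measurable
    show ?thesis by measurable
  qed
  ultimately show ?thesis by (simp cong: measurable_cong)
qed

definition tuple_sum :: "'i set \<Rightarrow> (('i \<Rightarrow> 'a \<times> bool) \<Rightarrow> 'b::comm_monoid_add) \<Rightarrow> ('a set \<times> 'a set) \<Rightarrow> 'b" where
  "tuple_sum I h \<omega> = (\<Sum>x\<in>inj_tuples I (marked \<omega>). h x)"

text \<open>
  Each point is labelled by its mark and by the set of those sides of the box that contain it. The
  tuples in the box are sorted by the labels of their points. The number of tuples in each class is
  a product of falling factorials with known expectation, and by distributivity these expectations
  sum up to the measure of the box.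
\<close>

lemma box_moment:
  fixes I :: "'i set"
  assumes I: "finite I" and A: "\<And>i. i \<in> I \<Longrightarrow> A i \<in> sets mark_space"
  shows "tuple_sum I (indicator (PiE I A) :: _ \<Rightarrow> ennreal) \<in> borel_measurable P" (is ?meas)
    and "(\<integral>\<^sup>+\<omega>. tuple_sum I (indicator (PiE I A)) \<omega> \<partial>P) = (\<Prod>i\<in>I. emeasure \<nu> (A i))" (is ?int)
proof -
  define \<l> where "\<l> z = {i \<in> I. z \<in> A i}" for z
  \<comment> \<open>All ways to label the points of a tuple in the box.\<close>
  define \<Sigma> where "\<Sigma> = PiE I (\<lambda>i. (UNIV :: bool set) \<times> {S \<in> Pow I. i \<in> S})"
  let ?m = "\<lambda>z. (snd z, \<l> z)"
  define F where "F \<sigma> p \<omega> = (of_nat (ffall (card {z \<in> marked \<omega>. ?m z = p}) (card {i \<in> I. \<sigma> i = p})) :: ennreal)" for \<sigma> p \<omega>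
  have fin\<Sigma>: "finite \<Sigma>" unfolding \<Sigma>_def using I by (intro finite_PiE) auto
  have lab: "{x. \<l> (x, b) = l} \<in> sets borel" if "l \<in> Pow I" for l b
  proof -
    have [measurable]: "{x. (x, b) \<in> A i} \<in> sets borel" if "i \<in> I" for i
    proof -
      have "(\<lambda>x. (x, b)) -` A i \<inter> space borel \<in> sets borel"
        using A[OF that] by (intro measurable_sets[of _ borel mark_space]) auto
      then show ?thesis by (simp add: vimage_def)
    qed
    have "{x. \<l> (x, b) = l} = {x \<in> space borel. \<forall>i\<in>I. x \<in> {x. (x, b) \<in> A i} \<longleftrightarrow> i \<in> l}"
      unfolding \<l>_def using that by auto
    also have "\<dots> \<in> sets borel" using I by measurable
    finally show ?thesis .
  qed
  have count: "(\<Sum>x\<in>inj_tuples I (marked \<omega>). indicator (PiE I A) x) = (\<Sum>\<sigma>\<in>\<Sigma>. \<Prod>p\<in>UNIV \<times> Pow I. F \<sigma> p \<omega>)"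
    if \<omega>: "\<omega> \<in> space P" for \<omega>
  proof -
    let ?D = "inj_tuples I (marked \<omega>)"
    let ?L = "\<lambda>\<sigma>. {x \<in> ?D. \<forall>i\<in>I. ?m (x i) = \<sigma> i}"
    have finD: "finite ?D" using finite_marked_P[OF \<omega>] I by simp
    have "{x \<in> ?D. x \<in> PiE I A} = (\<Union>\<sigma>\<in>\<Sigma>. ?L \<sigma>)"
    proof (intro equalityI subsetI)
      fix x assume x: "x \<in> {x \<in> ?D. x \<in> PiE I A}"
      then have "restrict (\<lambda>i. ?m (x i)) I \<in> \<Sigma>"
        unfolding \<Sigma>_def \<l>_def by (auto simp: PiE_iff)
      moreover have "x \<in> ?L (restrict (\<lambda>i. ?m (x i)) I)" using x by simp
      ultimately show "x \<in> (\<Union>\<sigma>\<in>\<Sigma>. ?L \<sigma>)" by blast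
    next
      fix x assume "x \<in> (\<Union>\<sigma>\<in>\<Sigma>. ?L \<sigma>)"
      then obtain \<sigma> where \<sigma>: "\<sigma> \<in> \<Sigma>" and x: "x \<in> ?D" "\<And>i. i \<in> I \<Longrightarrow> ?m (x i) = \<sigma> i" by blast
      have "x i \<in> A i" if "i \<in> I" for i
      proof -
        have "i \<in> snd (\<sigma> i)" using \<sigma> that by (auto simp: \<Sigma>_def PiE_iff)
        also have "snd (\<sigma> i) = \<l> (x i)" using x(2)[OF that] by (metis snd_conv)
        finally show ?thesis by (simp add: \<l>_def)
      qed
      with x(1) show "x \<in> {x \<in> ?D. x \<in> PiE I A}"
        by (auto simp: inj_tuples_def PiE_iff)
    qed
    moreover have "card (\<Union>\<sigma>\<in>\<Sigma>. ?L \<sigma>) = (\<Sum>\<sigma>\<in>\<Sigma>. card (?L \<sigma>))"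
    proof (rule card_UN_disjoint[OF fin\<Sigma>])
      show "\<forall>\<sigma>\<in>\<Sigma>. finite (?L \<sigma>)" using finD by auto
      show "\<forall>\<sigma>\<in>\<Sigma>. \<forall>\<tau>\<in>\<Sigma>. \<sigma> \<noteq> \<tau> \<longrightarrow> ?L \<sigma> \<inter> ?L \<tau> = {}"
      proof (intro ballI impI)
        fix \<sigma> \<tau> assume "\<sigma> \<in> \<Sigma>" "\<tau> \<in> \<Sigma>" "\<sigma> \<noteq> \<tau>"
        have "\<exists>i\<in>I. \<sigma> i \<noteq> \<tau> i"
        proof (rule ccontr)
          assume "\<not> ?thesis"
          then have "\<sigma> = \<tau>"
            using \<open>\<sigma> \<in> \<Sigma>\<close> \<open>\<tau> \<in> \<Sigma>\<close> unfolding \<Sigma>_def by (intro PiE_ext) auto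
          with \<open>\<sigma> \<noteq> \<tau>\<close> show False by contradiction
        qed
        then obtain i where i: "i \<in> I" "\<sigma> i \<noteq> \<tau> i" by blast
        have False if x: "x \<in> ?L \<sigma>" "x \<in> ?L \<tau>" for x
        proof -
          have "?m (x i) = \<sigma> i" "?m (x i) = \<tau> i" using x i(1) by blast+
          with i(2) show False by simp
        qed
        then show "?L \<sigma> \<inter> ?L \<tau> = {}" by blast
      qed
    qed
    moreover have "card (?L \<sigma>) = (\<Prod>p\<in>UNIV \<times> Pow I. ffall (card {z \<in> marked \<omega>. ?m z = p}) (card {i \<in> I. \<sigma> i = p}))"
      if "\<sigma> \<in> \<Sigma>" for \<sigma>
      using that I finite_marked_P[OF \<omega>] unfolding \<Sigma>_def
      by (intro card_inj_tuples_labels) (auto simp: PiE_iff image_subset_iff)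
    ultimately have "card {x \<in> ?D. x \<in> PiE I A}
        = (\<Sum>\<sigma>\<in>\<Sigma>. \<Prod>p\<in>UNIV \<times> Pow I. ffall (card {z \<in> marked \<omega>. ?m z = p}) (card {i \<in> I. \<sigma> i = p}))"
      by simp
    moreover have "(\<Sum>x\<in>?D. indicator (PiE I A) x) = (of_nat (card {x \<in> ?D. x \<in> PiE I A}) :: ennreal)"
      using finD by (simp add: indicator_def sum.If_cases Int_def)
    ultimately show ?thesis unfolding F_def by simp
  qed
  have Fm: "F \<sigma> p \<in> borel_measurable P" if pI: "p \<in> UNIV \<times> Pow I" for \<sigma> p
  proof -
    obtain b l where p: "p = (b, l)" and l: "l \<in> Pow I" using pI by (cases p) auto
    have "(\<lambda>\<omega>. card (marked \<omega> \<inter> {z. ?m z = p})) \<in> P \<rightarrow>\<^sub>M count_space UNIV"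
      using lab[OF l] by (intro measurable_card_marked) (cases b; simp add: p)+
    from measurable_compose[OF this, of "\<lambda>k. of_nat (ffall k (card {i \<in> I. \<sigma> i = p})) :: ennreal" borel]
    show ?thesis
      by (simp add: F_def[abs_def] Int_def)
  qed
  have "(\<lambda>\<omega>. \<Sum>\<sigma>\<in>\<Sigma>. \<Prod>p\<in>UNIV \<times> Pow I. F \<sigma> p \<omega>) \<in> borel_measurable P"
    using Fm by (intro borel_measurable_sum borel_measurable_prod_ennreal) auto
  then show ?meas
    unfolding tuple_sum_def by (subst measurable_cong[OF count])
  have "(\<integral>\<^sup>+\<omega>. tuple_sum I (indicator (PiE I A)) \<omega> \<partial>P) = (\<integral>\<^sup>+\<omega>. (\<Sum>\<sigma>\<in>\<Sigma>. \<Prod>p\<in>UNIV \<times> Pow I. F \<sigma> p \<omega>) \<partial>P)"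
    unfolding tuple_sum_def by (rule nn_integral_cong[OF count])
  also have "\<dots> = (\<Sum>\<sigma>\<in>\<Sigma>. \<integral>\<^sup>+\<omega>. (\<Prod>p\<in>UNIV \<times> Pow I. F \<sigma> p \<omega>) \<partial>P)"
    using Fm by (intro nn_integral_sum borel_measurable_prod_ennreal) auto
  also have "\<dots> = (\<Sum>\<sigma>\<in>\<Sigma>. \<Prod>i\<in>I. emeasure \<nu> {z. ?m z = \<sigma> i})"
  proof (intro sum.cong refl)
    fix \<sigma> assume \<sigma>: "\<sigma> \<in> \<Sigma>"
    have "(\<integral>\<^sup>+\<omega>. (\<Prod>p\<in>UNIV \<times> Pow I. F \<sigma> p \<omega>) \<partial>P)
        = (\<Prod>p\<in>UNIV \<times> Pow I. emeasure \<nu> {z. ?m z = p} ^ card {i \<in> I. \<sigma> i = p})"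
      unfolding F_def using I lab by (intro two_sample_label_moment[OF law f g n]) auto
    also have "\<dots> = (\<Prod>p\<in>UNIV \<times> Pow I. \<Prod>i\<in>{i \<in> I. \<sigma> i = p}. emeasure \<nu> {z. ?m z = \<sigma> i})"
      by (intro prod.cong refl) simp
    also have "\<dots> = (\<Prod>i\<in>I. emeasure \<nu> {z. ?m z = \<sigma> i})"
    proof (rule prod.group)
      have "\<sigma> i \<in> UNIV \<times> Pow I" if "i \<in> I" for i
        using PiE_mem[OF \<sigma>[unfolded \<Sigma>_def] that] by (cases "\<sigma> i") auto
      then show "\<sigma> ` I \<subseteq> UNIV \<times> Pow I" by blast
    qed (use I in auto)
    finally show "(\<integral>\<^sup>+\<omega>. (\<Prod>p\<in>UNIV \<times> Pow I. F \<sigma> p \<omega>) \<partial>P) = (\<Prod>i\<in>I. emeasure \<nu> {z. ?m z = \<sigma> i})" .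
  qed
  also have "\<dots> = (\<Prod>i\<in>I. \<Sum>p\<in>UNIV \<times> {S \<in> Pow I. i \<in> S}. emeasure \<nu> {z. ?m z = p})"
    unfolding \<Sigma>_def using I by (intro prod_sum_PiE[symmetric]) auto
  also have "\<dots> = (\<Prod>i\<in>I. emeasure \<nu> (A i))"
  proof (intro prod.cong refl)
    fix i assume i: "i \<in> I"
    have "A i = (\<Union>p\<in>UNIV \<times> {S \<in> Pow I. i \<in> S}. {z. ?m z = p})"
    proof (intro equalityI subsetI)
      fix z assume "z \<in> A i"
      then have "?m z \<in> UNIV \<times> {S \<in> Pow I. i \<in> S}" using i by (simp add: \<l>_def)
      then show "z \<in> (\<Union>p\<in>UNIV \<times> {S \<in> Pow I. i \<in> S}. {z. ?m z = p})" by blast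
    next
      fix z assume "z \<in> (\<Union>p\<in>UNIV \<times> {S \<in> Pow I. i \<in> S}. {z. ?m z = p})"
      then obtain p where "p \<in> UNIV \<times> {S \<in> Pow I. i \<in> S}" "?m z = p" by blast
      then have "i \<in> \<l> z" by auto
      then show "z \<in> A i" by (simp add: \<l>_def)
    qed
    moreover have "emeasure \<nu> (\<Union>p\<in>UNIV \<times> {S \<in> Pow I. i \<in> S}. {z. ?m z = p})
        = (\<Sum>p\<in>UNIV \<times> {S \<in> Pow I. i \<in> S}. emeasure \<nu> {z. ?m z = p})"
    proof (rule sum_emeasure[symmetric])
      show "(\<lambda>p. {z. ?m z = p}) ` (UNIV \<times> {S \<in> Pow I. i \<in> S}) \<subseteq> sets \<nu>"
      proof (clarsimp, rename_tac b l)
        fix b l assume l: "l \<subseteq> I"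
        have "{z. snd z = b \<and> \<l> z = l} = {x. \<l> (x, b) = l} \<times> {b}" by auto
        also have "\<dots> \<in> sets mark_space" using l by (intro pair_measureI lab) auto
        finally show "{z. snd z = b \<and> \<l> z = l} \<in> sets mark_space" .
      qed
    qed (use I in \<open>auto simp: disjoint_family_on_def\<close>)
    ultimately show "(\<Sum>p\<in>UNIV \<times> {S \<in> Pow I. i \<in> S}. emeasure \<nu> {z. ?m z = p}) = emeasure \<nu> (A i)" by simp
  qed
  finally show ?int .
qed

lemma tuple_sum_indicator_measurable:
  assumes I: "finite I" and C: "C \<in> sets (PiM I (\<lambda>_. \<nu>))"
  shows "tuple_sum I (indicator C :: _ \<Rightarrow> ennreal) \<in> borel_measurable P"
proof -
  let ?\<Omega> = "PiE I (\<lambda>_. UNIV) :: ('b \<Rightarrow> 'a \<times> bool) set"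
  let ?G = "prod_algebra I (\<lambda>_. \<nu>)"
  have sp: "space (PiM I (\<lambda>_. \<nu>)) = ?\<Omega>" by (simp add: space_PiM)
  have gen: "C \<in> sigma_sets ?\<Omega> ?G" using C by (simp add: sets_PiM)
  have G: "?G \<subseteq> Pow ?\<Omega>" using prod_algebra_sets_into_space[of I "\<lambda>_. \<nu>"] by simp
  have base: "tuple_sum I (indicator B :: _ \<Rightarrow> ennreal) \<in> borel_measurable P" if B: "B \<in> ?G" for B
  proof -
    obtain X where "B = PiE I X" "\<And>i. i \<in> I \<Longrightarrow> X i \<in> sets mark_space"
      using B unfolding prod_algebra_eq_finite[OF I] by (auto simp: Pi_iff)
    then show ?thesis using box_moment(1)[OF I] by simp
  qed
  have sub: "inj_tuples I (marked \<omega>) \<subseteq> ?\<Omega>" for \<omega> by (auto simp: inj_tuples_def)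
  from Int_stable_prod_algebra G gen show ?thesis
  proof (induction rule: sigma_sets_induct_disjoint)
    case (basic B)
    then show ?case by (rule base)
  next
    case empty
    then show ?case by (simp add: tuple_sum_def)
  next
    case (compl B)
    have top: "?\<Omega> \<in> ?G" unfolding prod_algebra_eq_finite[OF I]
      using sets.top[of \<nu>] by (auto intro!: exI[of _ "\<lambda>_. UNIV"])
    have "tuple_sum I (indicator (?\<Omega> - B)) \<omega> = tuple_sum I (indicator ?\<Omega>) \<omega> - (tuple_sum I (indicator B) \<omega> :: ennreal)"
      if \<omega>: "\<omega> \<in> space P" for \<omega>
    proof -
      have "tuple_sum I (indicator B) \<omega> + tuple_sum I (indicator (?\<Omega> - B)) \<omega> = (tuple_sum I (indicator ?\<Omega>) \<omega> :: ennreal)"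
        unfolding tuple_sum_def sum.distrib[symmetric] using sub[of \<omega>]
        by (intro sum.cong refl) (auto simp: indicator_def)
      moreover have "tuple_sum I (indicator B) \<omega> \<noteq> (top :: ennreal)"
      proof -
        have "tuple_sum I (indicator B) \<omega> \<le> (\<Sum>x\<in>inj_tuples I (marked \<omega>). 1 :: ennreal)"
          unfolding tuple_sum_def by (intro sum_mono) (auto simp: indicator_def)
        also have "\<dots> < top" by (simp add: of_nat_less_top)
        finally show ?thesis by simp
      qed
      ultimately show ?thesis by (metis ennreal_add_diff_cancel_left)
    qed
    with compl base[OF top] show ?case by (simp cong: measurable_cong)
  next
    case (union B)
    have "tuple_sum I (indicator (\<Union>i. B i)) = (\<lambda>\<omega>. \<Sum>i. tuple_sum I (indicator (B i)) \<omega> :: ennreal)"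
      unfolding tuple_sum_def using union(1)
      by (subst suminf_sum) (auto simp: suminf_indicator)
    with union show ?case by simp
  qed
qed

text \<open>
  The factorial moment measure agrees with the product measure on boxes, hence everywhere.
\<close>

lemma emeasure_factorial_moment:
  assumes I: "finite I" and C: "C \<in> sets (PiM I (\<lambda>_. \<nu>))"
  shows "(\<integral>\<^sup>+\<omega>. tuple_sum I (indicator C) \<omega> \<partial>P) = emeasure (PiM I (\<lambda>_. \<nu>)) C"
proof -
  let ?\<Lambda> = "measure_of (space (PiM I (\<lambda>_. \<nu>))) (sets (PiM I (\<lambda>_. \<nu>)))
     (\<lambda>C. \<integral>\<^sup>+\<omega>. tuple_sum I (indicator C) \<omega> \<partial>P)"
  have sets [simp]: "sets ?\<Lambda> = sets (PiM I (\<lambda>_. \<nu>))" by simp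
  have em: "emeasure ?\<Lambda> C = (\<integral>\<^sup>+\<omega>. tuple_sum I (indicator C) \<omega> \<partial>P)" if "C \<in> sets (PiM I (\<lambda>_. \<nu>))" for C
  proof (rule emeasure_measure_of[OF refl sets.space_closed])
    show "positive (sets ?\<Lambda>) (\<lambda>C. \<integral>\<^sup>+\<omega>. tuple_sum I (indicator C) \<omega> \<partial>P)"
      by (simp add: positive_def tuple_sum_def)
    show "countably_additive (sets ?\<Lambda>) (\<lambda>C. \<integral>\<^sup>+\<omega>. tuple_sum I (indicator C) \<omega> \<partial>P)"
    proof (rule countably_additiveI)
      fix B :: "nat \<Rightarrow> _" assume B: "range B \<subseteq> sets ?\<Lambda>" "disjoint_family B"
      have "tuple_sum I (indicator (\<Union>i. B i)) = (\<lambda>\<omega>. \<Sum>i. tuple_sum I (indicator (B i)) \<omega> :: ennreal)"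
        unfolding tuple_sum_def using B by (subst suminf_sum) (auto simp: suminf_indicator)
      then show "(\<Sum>i. \<integral>\<^sup>+\<omega>. tuple_sum I (indicator (B i)) \<omega> \<partial>P) = (\<integral>\<^sup>+\<omega>. tuple_sum I (indicator (\<Union>i. B i)) \<omega> \<partial>P)"
        using B by (subst nn_integral_suminf[symmetric]) (auto intro!: tuple_sum_indicator_measurable I)
    qed
    show "C \<in> sets ?\<Lambda>" using that by simp
  qed
  have "?\<Lambda> = PiM I (\<lambda>_. \<nu>)"
  proof (rule product_sigma_finite.PiM_eqI[OF product_sigma_finite_mark I sets])
    fix A :: "'b \<Rightarrow> ('a \<times> bool) set" assume "\<And>i. i \<in> I \<Longrightarrow> A i \<in> sets \<nu>"
    then have A: "\<And>i. i \<in> I \<Longrightarrow> A i \<in> sets mark_space" by simp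
    have "PiE I A \<in> sets (PiM I (\<lambda>_. \<nu>))" using I A by (intro sets_PiM_I_finite) auto
    from em[OF this] show "emeasure ?\<Lambda> (PiE I A) = (\<Prod>i\<in>I. emeasure \<nu> (A i))"
      by (simp add: box_moment(2)[OF I A])
  qed
  with em[OF C] show ?thesis by simp
qed

lemma nn_factorial_moment:
  assumes I: "finite I" and h: "h \<in> borel_measurable (PiM I (\<lambda>_. \<nu>))"
  shows "tuple_sum I h \<in> borel_measurable P"
    and "(\<integral>\<^sup>+\<omega>. tuple_sum I h \<omega> \<partial>P) = (\<integral>\<^sup>+x. h x \<partial>PiM I (\<lambda>_. \<nu>))"
proof -
  let ?Q = "\<lambda>h. tuple_sum I h \<in> borel_measurable P \<and> (\<integral>\<^sup>+\<omega>. tuple_sum I h \<omega> \<partial>P) = (\<integral>\<^sup>+x. h x \<partial>PiM I (\<lambda>_. \<nu>))"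
  have sub: "x \<in> space (PiM I (\<lambda>_. \<nu>))" if "x \<in> inj_tuples I (marked \<omega>)" for x \<omega>
    using that by (auto simp: inj_tuples_def space_PiM)
  from h have "?Q h"
  proof (induction rule: borel_measurable_induct)
    case (cong u v)
    have "tuple_sum I u = tuple_sum I v"
      unfolding tuple_sum_def using cong(3) sub by (intro ext sum.cong refl) auto
    moreover have "(\<integral>\<^sup>+x. u x \<partial>PiM I (\<lambda>_. \<nu>)) = (\<integral>\<^sup>+x. v x \<partial>PiM I (\<lambda>_. \<nu>))"
      using cong(3) by (intro nn_integral_cong) auto
    ultimately show ?case using cong(4) by simp
  next
    case (set C)
    show ?case using tuple_sum_indicator_measurable[OF I set] emeasure_factorial_moment[OF I set] set by simp
  next
    case (mult u c)
    have "tuple_sum I (\<lambda>x. c * u x) = (\<lambda>\<omega>. c * tuple_sum I u \<omega>)"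
      by (simp add: tuple_sum_def[abs_def] sum_distrib_left)
    moreover have "tuple_sum I u \<in> borel_measurable P" using mult by simp
    then have "(\<lambda>\<omega>. c * tuple_sum I u \<omega>) \<in> borel_measurable P" by measurable
    ultimately show ?case using mult by (simp add: nn_integral_cmult)
  next
    case (add u v)
    have "tuple_sum I (\<lambda>x. v x + u x) = (\<lambda>\<omega>. tuple_sum I v \<omega> + tuple_sum I u \<omega>)"
      by (simp add: tuple_sum_def[abs_def] sum.distrib)
    moreover have "tuple_sum I u \<in> borel_measurable P" "tuple_sum I v \<in> borel_measurable P" using add by simp_all
    then have "(\<lambda>\<omega>. tuple_sum I v \<omega> + tuple_sum I u \<omega>) \<in> borel_measurable P" by measurable
    ultimately show ?case using add by (simp add: nn_integral_add)
  next
    case (seq U)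
    have IH: "?Q (U i)" for i using seq by blast
    have incU: "incseq U" using seq by blast
    have inc: "incseq (\<lambda>i. U i x)" for x using incU by (auto simp: incseq_def le_fun_def)
    have eq: "tuple_sum I (SUP i. U i) = (\<lambda>\<omega>. SUP i. tuple_sum I (U i) \<omega>)"
      unfolding tuple_sum_def SUP_apply using inc by (intro ext ennreal_SUP_sum[symmetric]) auto
    have inc': "incseq (\<lambda>i. tuple_sum I (U i))"
      using inc unfolding tuple_sum_def by (auto simp: incseq_def le_fun_def intro!: sum_mono)
    have m: "tuple_sum I (U i) \<in> borel_measurable P" for i using IH by simp
    have "(\<integral>\<^sup>+\<omega>. (SUP i. tuple_sum I (U i) \<omega>) \<partial>P) = (SUP i. \<integral>\<^sup>+\<omega>. tuple_sum I (U i) \<omega> \<partial>P)"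
      using inc' m by (rule nn_integral_monotone_convergence_SUP)
    also have "\<dots> = (SUP i. \<integral>\<^sup>+x. U i x \<partial>PiM I (\<lambda>_. \<nu>))" using IH by simp
    also have "\<dots> = (\<integral>\<^sup>+x. (SUP i. U i x) \<partial>PiM I (\<lambda>_. \<nu>))"
      using seq(1) incU by (intro nn_integral_monotone_convergence_SUP[symmetric]) auto
    finally show ?case using m unfolding eq by (auto simp: image_comp)
  qed
  then show "tuple_sum I h \<in> borel_measurable P"
    and "(\<integral>\<^sup>+\<omega>. tuple_sum I h \<omega> \<partial>P) = (\<integral>\<^sup>+x. h x \<partial>PiM I (\<lambda>_. \<nu>))" by auto
qed

text \<open>
  Campbell's formula for sums over tuples of distinct points.
\<close>

lemma factorial_moment:
  fixes h :: "('i \<Rightarrow> 'a \<times> bool) \<Rightarrow> real"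
  assumes I: "finite I" and h: "integrable (PiM I (\<lambda>_. \<nu>)) h"
  shows "integrable P (tuple_sum I h)"
    and "(\<integral>\<omega>. tuple_sum I h \<omega> \<partial>P) = (\<integral>x. h x \<partial>PiM I (\<lambda>_. \<nu>))"
proof -
  have nonneg: "has_bochner_integral P (tuple_sum I u) (\<integral>x. u x \<partial>PiM I (\<lambda>_. \<nu>))"
    if u: "integrable (PiM I (\<lambda>_. \<nu>)) u" and pos: "\<And>x. 0 \<le> u x" for u :: "('i \<Rightarrow> 'a \<times> bool) \<Rightarrow> real"
  proof -
    have eq: "ennreal (tuple_sum I u \<omega>) = tuple_sum I (\<lambda>x. ennreal (u x)) \<omega>" for \<omega>
      unfolding tuple_sum_def using pos by (intro sum_ennreal[symmetric]) auto
    have um: "(\<lambda>x. ennreal (u x)) \<in> borel_measurable (PiM I (\<lambda>_. \<nu>))" using u by auto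
    note nm = nn_factorial_moment[OF I um]
    have "(\<lambda>\<omega>. enn2real (ennreal (tuple_sum I u \<omega>))) \<in> borel_measurable P"
      unfolding eq using nm(1) by measurable
    moreover have nn: "0 \<le> tuple_sum I u \<omega>" for \<omega> unfolding tuple_sum_def using pos by (intro sum_nonneg) auto
    ultimately have m: "tuple_sum I u \<in> borel_measurable P" by simp
    have "(\<integral>\<^sup>+\<omega>. ennreal (tuple_sum I u \<omega>) \<partial>P) = ennreal (\<integral>x. u x \<partial>PiM I (\<lambda>_. \<nu>))"
      unfolding eq nm(2) using u pos by (intro nn_integral_eq_integral) auto
    then show ?thesis
      using m nn pos by (intro has_bochner_integral_nn_integral) (auto intro!: integral_nonneg_AE)
  qed
  have hp: "integrable (PiM I (\<lambda>_. \<nu>)) (\<lambda>x. max 0 (h x))" "integrable (PiM I (\<lambda>_. \<nu>)) (\<lambda>x. max 0 (- h x))"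
    using h by auto
  have eq: "tuple_sum I h = (\<lambda>\<omega>. tuple_sum I (\<lambda>x. max 0 (h x)) \<omega> - tuple_sum I (\<lambda>x. max 0 (- h x)) \<omega>)"
    unfolding tuple_sum_def sum_subtractf[symmetric] by (intro ext sum.cong) auto
  have "has_bochner_integral P (tuple_sum I h)
     ((\<integral>x. max 0 (h x) \<partial>PiM I (\<lambda>_. \<nu>)) - (\<integral>x. max 0 (- h x) \<partial>PiM I (\<lambda>_. \<nu>)))"
    unfolding eq by (intro has_bochner_integral_diff nonneg hp) auto
  also have "(\<integral>x. max 0 (h x) \<partial>PiM I (\<lambda>_. \<nu>)) - (\<integral>x. max 0 (- h x) \<partial>PiM I (\<lambda>_. \<nu>)) = (\<integral>x. h x \<partial>PiM I (\<lambda>_. \<nu>))"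
    by (subst Bochner_Integration.integral_diff[OF hp, symmetric]) (auto intro!: Bochner_Integration.integral_cong)
  finally have *: "has_bochner_integral P (tuple_sum I h) (\<integral>x. h x \<partial>PiM I (\<lambda>_. \<nu>))" .
  show "integrable P (tuple_sum I h)" using * by (simp add: has_bochner_integral_iff)
  show "(\<integral>\<omega>. tuple_sum I h \<omega> \<partial>P) = (\<integral>x. h x \<partial>PiM I (\<lambda>_. \<nu>))" using * by (rule has_bochner_integral_integral_eq)
qed

end

section \<open>Moments of the U-statistic\<close>

lemma sum_inj_tuples_2:
  assumes "finite Z"
  shows "(\<Sum>x\<in>inj_tuples {0, 1::nat} Z. h (x 1) (x 0)) = (\<Sum>a\<in>Z. \<Sum>b\<in>Z - {a}. h a b)"
  using assms by (simp add: sum_inj_tuples_insert)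

lemma sum_inj_tuples_3:
  assumes "finite Z"
  shows "(\<Sum>x\<in>inj_tuples {0, 1, 2::nat} Z. h (x 2) (x 1) (x 0))
    = (\<Sum>a\<in>Z. \<Sum>b\<in>Z - {a}. \<Sum>c\<in>Z - {a, b}. h a b c)"
  using assms by (simp add: sum_inj_tuples_insert insert_commute)

lemma sum_inj_tuples_4:
  assumes "finite Z"
  shows "(\<Sum>x\<in>inj_tuples {0, 1, 2, 3::nat} Z. h (x 3) (x 2) (x 1) (x 0))
    = (\<Sum>a\<in>Z. \<Sum>b\<in>Z - {a}. \<Sum>c\<in>Z - {a, b}. \<Sum>d\<in>Z - {a, b, c}. h a b c d)"
  using assms by (simp add: sum_inj_tuples_insert insert_commute)

text \<open>
  Two pairs of distinct points have no point, one point or two points in common. These cases yield the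
  three sums.
\<close>

lemma offdiag_sum_square:
  fixes \<phi> :: "'a \<Rightarrow> 'a \<Rightarrow> real"
  assumes Z: "finite Z" and sym: "\<And>x y. \<phi> x y = \<phi> y x"
  shows "(\<Sum>a\<in>Z. \<Sum>b\<in>Z - {a}. \<phi> a b)\<^sup>2
     = (\<Sum>a\<in>Z. \<Sum>b\<in>Z - {a}. \<Sum>c\<in>Z - {a, b}. \<Sum>d\<in>Z - {a, b, c}. \<phi> a b * \<phi> c d)
     + 4 * (\<Sum>a\<in>Z. \<Sum>b\<in>Z - {a}. \<Sum>c\<in>Z - {a, b}. \<phi> a b * \<phi> a c)
     + 2 * (\<Sum>a\<in>Z. \<Sum>b\<in>Z - {a}. (\<phi> a b)\<^sup>2)"
proof -
  define T where "T W = T_stat \<phi> W (\<lambda>_. 1)" for W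
  have T: "T W = (\<Sum>c\<in>W. \<Sum>d\<in>W - {c}. \<phi> c d)" for W by (simp add: T_def T_stat_def)
  have split: "T Z = T (Z - {a, b}) + 2 * (\<Sum>c\<in>Z - {a, b}. \<phi> b c) + 2 * (\<Sum>c\<in>Z - {a, b}. \<phi> a c) + 2 * \<phi> a b"
    if a: "a \<in> Z" and b: "b \<in> Z - {a}" for a b
  proof -
    have "Z = insert a (insert b (Z - {a, b}))" using a b by auto
    then have "T Z = T (insert a (insert b (Z - {a, b})))" by simp
    also have "\<dots> = T (Z - {a, b}) + (\<Sum>c\<in>Z - {a, b}. 2 * \<phi> b c) + (2 * \<phi> a b + (\<Sum>c\<in>Z - {a, b}. 2 * \<phi> a c))"
      unfolding T_def using Z a b
      by (subst T_stat_insert, (auto simp: sym)[3], subst T_stat_insert) (auto simp: sym)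
    finally show ?thesis by (simp add: sum_distrib_left)
  qed
  have "(T Z)\<^sup>2 = (\<Sum>a\<in>Z. \<Sum>b\<in>Z - {a}. \<phi> a b * T Z)"
    by (subst power2_eq_square, subst T) (simp add: sum_distrib_right)
  also have "\<dots> = (\<Sum>a\<in>Z. \<Sum>b\<in>Z - {a}. \<phi> a b * T (Z - {a, b})
      + 2 * (\<Sum>c\<in>Z - {a, b}. \<phi> a b * \<phi> b c) + 2 * (\<Sum>c\<in>Z - {a, b}. \<phi> a b * \<phi> a c) + 2 * (\<phi> a b)\<^sup>2)"
    by (intro sum.cong refl, subst split) (auto simp: algebra_simps sum_distrib_left power2_eq_square)
  also have "\<dots> = (\<Sum>a\<in>Z. \<Sum>b\<in>Z - {a}. \<phi> a b * T (Z - {a, b}))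
      + 2 * (\<Sum>a\<in>Z. \<Sum>b\<in>Z - {a}. \<Sum>c\<in>Z - {a, b}. \<phi> a b * \<phi> b c)
      + 2 * (\<Sum>a\<in>Z. \<Sum>b\<in>Z - {a}. \<Sum>c\<in>Z - {a, b}. \<phi> a b * \<phi> a c)
      + 2 * (\<Sum>a\<in>Z. \<Sum>b\<in>Z - {a}. (\<phi> a b)\<^sup>2)"
    by (simp add: sum.distrib sum_distrib_left)
  also have "(\<Sum>a\<in>Z. \<Sum>b\<in>Z - {a}. \<Sum>c\<in>Z - {a, b}. \<phi> a b * \<phi> b c)
      = (\<Sum>a\<in>Z. \<Sum>b\<in>Z - {a}. \<Sum>c\<in>Z - {a, b}. \<phi> a b * \<phi> a c)"
  proof -
    have swap: "(\<Sum>a\<in>Z. \<Sum>b\<in>Z - {a}. F a b) = (\<Sum>b\<in>Z. \<Sum>a\<in>Z - {b}. F a b)" for F :: "'a \<Rightarrow> 'a \<Rightarrow> real"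
      using sum.swap_restrict[OF Z Z, of F "\<lambda>a b. a \<noteq> b"]
      by (simp add: set_diff_eq eq_commute[of "_ :: 'a"] cong: conj_cong)
    show ?thesis
      by (subst swap) (simp add: insert_commute sym[of _ "_ :: 'a"])
  qed
  also have "(\<Sum>a\<in>Z. \<Sum>b\<in>Z - {a}. \<phi> a b * T (Z - {a, b}))
      = (\<Sum>a\<in>Z. \<Sum>b\<in>Z - {a}. \<Sum>c\<in>Z - {a, b}. \<Sum>d\<in>Z - {a, b, c}. \<phi> a b * \<phi> c d)"
    unfolding T by (simp add: sum_distrib_left Diff_insert2[symmetric] insert_commute Diff_insert[symmetric])
  finally show ?thesis by (simp add: T)
qed

context two_sample
begin

lemma measurable_mark_measure: "h \<in> measurable mark_space M \<Longrightarrow> h \<in> measurable \<nu> M"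
  by (subst measurable_cong_sets[OF sets_mark_measure refl])

lemma component_measurable:
  "i \<in> I \<Longrightarrow> (\<lambda>x. x i) \<in> PiM I (\<lambda>_. \<nu>) \<rightarrow>\<^sub>M mark_space"
  using measurable_component_singleton[of i I "\<lambda>_. \<nu>"]
  unfolding measurable_cong_sets[OF refl sets_mark_measure] .

lemma nn_integral_two_coordinates:
  fixes h :: "'a \<times> bool \<Rightarrow> 'a \<times> bool \<Rightarrow> ennreal" and i j :: 'i
  assumes J: "finite J" "i \<notin> J" "j \<notin> J" and ij: "i \<noteq> j"
    and h: "(\<lambda>(z, z'). h z z') \<in> borel_measurable (mark_space \<Otimes>\<^sub>M mark_space)"
  shows "(\<integral>\<^sup>+x. h (x i) (x j) \<partial>PiM (J \<union> {i, j}) (\<lambda>_. \<nu>))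
    = emeasure \<nu> UNIV ^ card J * (\<integral>\<^sup>+z. \<integral>\<^sup>+z'. h z z' \<partial>\<nu> \<partial>\<nu>)"
proof -
  interpret product_sigma_finite "\<lambda>_::'i. \<nu>" by (rule product_sigma_finite_mark)
  have hm: "(\<lambda>x. h (x i) (x j)) \<in> borel_measurable (PiM I (\<lambda>_. \<nu>))" if "i \<in> I" "j \<in> I" for I
    using measurable_compose[OF measurable_Pair[OF component_measurable component_measurable] h] that by simp
  show ?thesis
    using J
  proof (induction J)
    case empty
    have "(\<integral>\<^sup>+x. h (x i) (x j) \<partial>PiM (insert j {i}) (\<lambda>_. \<nu>))
        = (\<integral>\<^sup>+x. \<integral>\<^sup>+z'. h (x i) z' \<partial>\<nu> \<partial>PiM {i} (\<lambda>_. \<nu>))"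
      using ij by (subst product_nn_integral_insert) (auto intro!: hm)
    also have "\<dots> = (\<integral>\<^sup>+z. \<integral>\<^sup>+z'. h z z' \<partial>\<nu> \<partial>\<nu>)"
    proof (subst product_nn_integral_singleton)
      have "(\<lambda>(z, z'). h z z') \<in> borel_measurable (\<nu> \<Otimes>\<^sub>M \<nu>)" using h by measurable
      then show "(\<lambda>z. \<integral>\<^sup>+z'. h z z' \<partial>\<nu>) \<in> borel_measurable \<nu>"
        by (rule mark.borel_measurable_nn_integral)
    qed simp
    finally show ?case by (simp add: insert_commute)
  next
    case (insert k J)
    have "(\<integral>\<^sup>+x. h (x i) (x j) \<partial>PiM (insert k (J \<union> {i, j})) (\<lambda>_. \<nu>))
        = (\<integral>\<^sup>+x. \<integral>\<^sup>+y. h (x i) (x j) \<partial>\<nu> \<partial>PiM (J \<union> {i, j}) (\<lambda>_. \<nu>))"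
      using insert.hyps insert.prems by (subst product_nn_integral_insert) (auto intro!: hm)
    also have "\<dots> = (\<integral>\<^sup>+x. h (x i) (x j) \<partial>PiM (J \<union> {i, j}) (\<lambda>_. \<nu>)) * emeasure \<nu> UNIV"
      by (simp add: nn_integral_multc hm)
    finally show ?case
      using insert unfolding Un_insert_left by (simp add: mult_ac del: Un_insert_right)
  qed
qed

text \<open>
  The expected number of pairs of marked points at the same position is the measure of the diagonal,
  which is 0 as Lebesgue measure has no atoms.
\<close>

lemma AE_disjoint: "AE \<omega> in P. fst \<omega> \<inter> snd \<omega> = {}"
proof -
  define h where "h z z' = (indicator {(z, z'). fst z = fst z'} (z, z') :: ennreal)" for z z' :: "'a \<times> bool"
  have hm: "(\<lambda>(z, z'). h z z') \<in> borel_measurable (mark_space \<Otimes>\<^sub>M mark_space)"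
  proof -
    have "{p \<in> space (mark_space \<Otimes>\<^sub>M mark_space). fst (fst p) = (fst (snd p) :: 'a)} \<in> sets (mark_space \<Otimes>\<^sub>M mark_space)"
      by measurable
    then have "{(z, z'). fst z = (fst z' :: 'a)} \<in> sets (mark_space \<Otimes>\<^sub>M mark_space)"
      by (simp add: space_pair_measure case_prod_unfold)
    then show ?thesis unfolding h_def by (simp add: case_prod_unfold)
  qed
  have fg[measurable]: "f \<in> borel_measurable borel" "g \<in> borel_measurable borel"
    using f g unfolding intensity_def by (auto dest!: borel_measurable_integrable)
  have zero: "(\<integral>\<^sup>+z'. h z z' \<partial>\<nu>) = 0" for z
  proof -
    have hz: "h z \<in> borel_measurable mark_space"
      using measurable_compose[OF measurable_Pair1' hm, of z] by (simp add: space_pair_measure)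
    have ae: "AE x in lborel. h z (x, b) = 0" for b
      using AE_lborel_singleton[of "fst z"] by eventually_elim (auto simp: h_def)
    have "(\<integral>\<^sup>+x. ennreal (n * u x) * h z (x, b) \<partial>lborel) = 0" for u b
    proof -
      have "(\<integral>\<^sup>+x. ennreal (n * u x) * h z (x, b) \<partial>lborel) = (\<integral>\<^sup>+x. 0 \<partial>(lborel :: 'a measure))"
        by (rule nn_integral_cong_AE) (use ae[of b] in eventually_elim, simp)
      then show ?thesis by simp
    qed
    then show ?thesis by (subst nn_integral_mark_measure[OF fg hz]) simp
  qed
  have m: "(\<lambda>x. h (x (1::nat)) (x 0)) \<in> borel_measurable (PiM {0, 1::nat} (\<lambda>_. \<nu>))"
    using measurable_compose[OF measurable_Pair[OF component_measurable component_measurable] hm, of 1 "{0, 1::nat}" 0] by simp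
  note fm = nn_factorial_moment[OF _ m]
  have "(\<integral>\<^sup>+x. h (x (1::nat)) (x 0) \<partial>PiM ({} \<union> {1, 0}) (\<lambda>_. \<nu>)) = emeasure \<nu> UNIV ^ card ({} :: nat set) * (\<integral>\<^sup>+z. \<integral>\<^sup>+z'. h z z' \<partial>\<nu> \<partial>\<nu>)"
    by (rule nn_integral_two_coordinates[OF _ _ _ _ hm]) auto
  then have "(\<integral>\<^sup>+\<omega>. tuple_sum {0, 1::nat} (\<lambda>x. h (x 1) (x 0)) \<omega> \<partial>P) = 0"
    by (subst fm(2)) (simp_all add: zero insert_commute)
  then have "AE \<omega> in P. tuple_sum {0, 1::nat} (\<lambda>x. h (x 1) (x 0)) \<omega> = 0"
    by (subst (asm) nn_integral_0_iff_AE[OF fm(1)]) simp_all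
  then show ?thesis
    using AE_space
  proof eventually_elim
    case (elim \<omega>)
    have "tuple_sum {0, 1::nat} (\<lambda>x. h (x 1) (x 0)) \<omega> = (\<Sum>z\<in>marked \<omega>. \<Sum>z'\<in>marked \<omega> - {z}. h z z')"
      unfolding tuple_sum_def by (rule sum_inj_tuples_2[OF finite_marked_P[OF elim(2)]])
    with elim(1) have "(\<Sum>z\<in>marked \<omega>. \<Sum>z'\<in>marked \<omega> - {z}. h z z') = 0" by simp
    then have z: "h z z' = 0" if "z \<in> marked \<omega>" "z' \<in> marked \<omega> - {z}" for z z'
      using that finite_marked_P[OF elim(2)] by (simp add: sum_nonneg_eq_0_iff)
    show ?case
    proof (rule ccontr)
      assume "fst \<omega> \<inter> snd \<omega> \<noteq> {}"
      then obtain x where x: "x \<in> fst \<omega>" "x \<in> snd \<omega>" by blast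
      then have "h (x, True) (x, False) = 0" by (intro z) (auto simp: marked_def)
      then show False by (simp add: h_def)
    qed
  qed
qed

end

text \<open>
  The uniform bound on the second moment of the kernel makes the kernel and its products integrable,
  as the mean measure is finite.
\<close>

locale two_sample_kernel = two_sample n f g P
  for n :: real and f g :: "'a::euclidean_space \<Rightarrow> real" and P +
  fixes \<phi> :: "'a \<times> bool \<Rightarrow> 'a \<times> bool \<Rightarrow> real" and c :: real
  assumes \<phi>_meas [measurable]: "(\<lambda>(z, z'). \<phi> z z') \<in> borel_measurable (mark_space \<Otimes>\<^sub>M mark_space)"
    and \<phi>_sym: "\<And>z z'. \<phi> z z' = \<phi> z' z"
    and \<phi>_sq: "\<And>z. (\<integral>\<^sup>+z'. ennreal ((\<phi> z z')\<^sup>2) \<partial>\<nu>) \<le> ennreal c"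
    and c: "0 \<le> c"
begin

text \<open>
  The projection of the kernel to one variable, which determines the mean of \<open>U\<close> and the leading term of its
  variance.
\<close>

definition \<Phi> :: "'a \<times> bool \<Rightarrow> real" where
  "\<Phi> z = (\<integral>z'. \<phi> z z' \<partial>\<nu>)"

definition U :: "'a set \<times> 'a set \<Rightarrow> real" where
  "U \<omega> = (\<Sum>z\<in>marked \<omega>. \<Sum>z'\<in>marked \<omega> - {z}. \<phi> z z')"

definition S :: "'a set \<times> 'a set \<Rightarrow> real" where
  "S \<omega> = (\<Sum>z\<in>marked \<omega>. \<Sum>z'\<in>marked \<omega> - {z}. (\<phi> z z')\<^sup>2)"

lemma \<phi>_comp [measurable (raw)]:
  assumes "u \<in> M \<rightarrow>\<^sub>M mark_space" "v \<in> M \<rightarrow>\<^sub>M mark_space"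
  shows "(\<lambda>x. \<phi> (u x) (v x)) \<in> borel_measurable M"
  using measurable_compose[OF measurable_Pair[OF assms] \<phi>_meas] by simp

lemma \<Phi>_meas [measurable]: "\<Phi> \<in> borel_measurable mark_space"
proof -
  have "(\<lambda>(z, z'). \<phi> z z') \<in> borel_measurable (mark_space \<Otimes>\<^sub>M \<nu>)" by measurable
  then show ?thesis
    unfolding \<Phi>_def by (rule mark.borel_measurable_lebesgue_integral)
qed

lemma integrable_\<phi>: "integrable \<nu> (\<phi> z)"
proof -
  have "\<phi> z \<in> borel_measurable mark_space"
    by (rule \<phi>_comp[of "\<lambda>_. z" mark_space "\<lambda>x. x"]) (simp_all add: space_pair_measure)
  then have m[measurable]: "\<phi> z \<in> borel_measurable \<nu>" by (rule measurable_mark_measure)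
  have "(\<integral>\<^sup>+z'. ennreal ((\<phi> z z')\<^sup>2) \<partial>\<nu>) < \<infinity>"
    by (rule le_less_trans[OF \<phi>_sq]) simp
  then have "integrable \<nu> (\<lambda>z'. (\<phi> z z')\<^sup>2)"
    by (intro integrableI_bounded) auto
  then show ?thesis
    by (rule mark.square_integrable_imp_integrable[OF m])
qed

lemma integral_sq_le: "(\<integral>\<^sup>+z. \<integral>\<^sup>+z'. ennreal ((\<phi> z z')\<^sup>2) \<partial>\<nu> \<partial>\<nu>) \<le> ennreal (c * measure \<nu> UNIV)"
proof -
  have "(\<integral>\<^sup>+z. \<integral>\<^sup>+z'. ennreal ((\<phi> z z')\<^sup>2) \<partial>\<nu> \<partial>\<nu>) \<le> (\<integral>\<^sup>+z. ennreal c \<partial>\<nu>)"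
    by (intro nn_integral_mono \<phi>_sq)
  also have "\<dots> = ennreal (c * measure \<nu> UNIV)"
    using c by (simp add: mark.emeasure_eq_measure ennreal_mult)
  finally show ?thesis .
qed

lemma integrable_\<phi>_sq:
  assumes I: "finite I" "i \<in> I" "j \<in> I" "i \<noteq> j"
  shows "integrable (PiM I (\<lambda>_. \<nu>)) (\<lambda>x. (\<phi> (x i) (x j))\<^sup>2)"
proof (rule integrableI_bounded)
  note [measurable] = component_measurable[OF I(2)] component_measurable[OF I(3)]
  show "(\<lambda>x. (\<phi> (x i) (x j))\<^sup>2) \<in> borel_measurable (PiM I (\<lambda>_. \<nu>))" by measurable
  have Ieq: "I = (I - {i, j}) \<union> {i, j}" using I by auto
  have "(\<integral>\<^sup>+x. ennreal (norm ((\<phi> (x i) (x j))\<^sup>2)) \<partial>PiM I (\<lambda>_. \<nu>))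
      = emeasure \<nu> UNIV ^ card (I - {i, j}) * (\<integral>\<^sup>+z. \<integral>\<^sup>+z'. ennreal ((\<phi> z z')\<^sup>2) \<partial>\<nu> \<partial>\<nu>)"
    using I by (subst Ieq, subst nn_integral_two_coordinates[symmetric]) auto
  also have "\<dots> \<le> emeasure \<nu> UNIV ^ card (I - {i, j}) * ennreal (c * measure \<nu> UNIV)"
    by (intro mult_left_mono integral_sq_le) simp
  also have "\<dots> < \<infinity>"
    by (simp add: mark.emeasure_eq_measure ennreal_power ennreal_mult[symmetric] c ennreal_mult_less_top)
  finally show "(\<integral>\<^sup>+x. ennreal (norm ((\<phi> (x i) (x j))\<^sup>2)) \<partial>PiM I (\<lambda>_. \<nu>)) < \<infinity>" .
qed

lemma integrable_\<phi>_mult: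
  assumes I: "finite I" "i \<in> I" "j \<in> I" "i \<noteq> j" "k \<in> I" "l \<in> I" "k \<noteq> l"
  shows "integrable (PiM I (\<lambda>_. \<nu>)) (\<lambda>x. \<phi> (x i) (x j) * \<phi> (x k) (x l))"
proof (rule Bochner_Integration.integrable_bound)
  note [measurable] = I(2,3,5,6)[THEN component_measurable]
  show "integrable (PiM I (\<lambda>_. \<nu>)) (\<lambda>x. (\<phi> (x i) (x j))\<^sup>2 + (\<phi> (x k) (x l))\<^sup>2)"
    by (intro Bochner_Integration.integrable_add integrable_\<phi>_sq I)
  show "(\<lambda>x. \<phi> (x i) (x j) * \<phi> (x k) (x l)) \<in> borel_measurable (PiM I (\<lambda>_. \<nu>))" by measurable
  have "\<bar>a * b\<bar> \<le> a\<^sup>2 + b\<^sup>2" for a b :: real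
  proof -
    have "2 * (\<bar>a\<bar> * \<bar>b\<bar>) \<le> a\<^sup>2 + b\<^sup>2" using sum_squares_bound[of "\<bar>a\<bar>" "\<bar>b\<bar>"] by simp
    moreover have "0 \<le> \<bar>a\<bar> * \<bar>b\<bar>" by simp
    ultimately show ?thesis unfolding abs_mult by linarith
  qed
  then show "AE x in PiM I (\<lambda>_. \<nu>). norm (\<phi> (x i) (x j) * \<phi> (x k) (x l)) \<le> norm ((\<phi> (x i) (x j))\<^sup>2 + (\<phi> (x k) (x l))\<^sup>2)"
    by (intro AE_I2) simp
qed

lemma integrable_\<phi>_pair:
  assumes I: "finite I" "i \<in> I" "j \<in> I" "i \<noteq> j"
  shows "integrable (PiM I (\<lambda>_. \<nu>)) (\<lambda>x. \<phi> (x i) (x j))"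
proof -
  interpret finite_product_sigma_finite "\<lambda>_. \<nu>" I
    by (intro finite_product_sigma_finite.intro product_sigma_finite_mark finite_product_sigma_finite_axioms.intro I)
  interpret F: finite_measure "PiM I (\<lambda>_. \<nu>)"
  proof
    have "emeasure (PiM I (\<lambda>_. \<nu>)) (PiE I (\<lambda>_. UNIV)) = (\<Prod>i\<in>I. emeasure \<nu> UNIV)"
      using sets.top[of \<nu>] by (intro measure_times) simp
    then show "emeasure (PiM I (\<lambda>_. \<nu>)) (space (PiM I (\<lambda>_. \<nu>))) \<noteq> \<infinity>"
      by (simp add: space_PiM mark.emeasure_eq_measure ennreal_power)
  qed
  note [measurable] = I(2,3)[THEN component_measurable]
  show ?thesis
    by (rule F.square_integrable_imp_integrable[OF _ integrable_\<phi>_sq[OF I]]) measurable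
qed

lemma integral_\<phi>_pair:
  fixes i j :: 'i
  assumes ij: "i \<noteq> j"
  shows "(\<integral>x. \<phi> (x i) (x j) \<partial>PiM {i, j} (\<lambda>_. \<nu>)) = (\<integral>z. \<Phi> z \<partial>\<nu>)"
proof -
  interpret product_sigma_finite "\<lambda>_::'i. \<nu>" by (rule product_sigma_finite_mark)
  have "integrable (PiM (insert j {i}) (\<lambda>_. \<nu>)) (\<lambda>x. \<phi> (x i) (x j))"
    using ij by (intro integrable_\<phi>_pair) auto
  from product_integral_insert[OF _ _ this] ij
  have "(\<integral>x. \<phi> (x i) (x j) \<partial>PiM (insert j {i}) (\<lambda>_. \<nu>)) = (\<integral>x. \<Phi> (x i) \<partial>PiM {i} (\<lambda>_. \<nu>))"
    by (simp add: \<Phi>_def)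
  also have "\<dots> = (\<integral>z. \<Phi> z \<partial>\<nu>)"
    by (rule product_integral_singleton) measurable
  finally show ?thesis by (simp add: insert_commute)
qed

lemma integral_\<phi>_disjoint:
  "(\<integral>x. \<phi> (x 3) (x 2) * \<phi> (x 1) (x 0) \<partial>PiM {0, 1, 2, 3::nat} (\<lambda>_. \<nu>)) = (\<integral>z. \<Phi> z \<partial>\<nu>)\<^sup>2"
proof -
  interpret product_sigma_finite "\<lambda>_::nat. \<nu>" by (rule product_sigma_finite_mark)
  have eq: "{0, 1, 2, 3::nat} = {3, 2} \<union> {1, 0}" by auto
  have "integrable (PiM ({3, 2} \<union> {1, 0::nat}) (\<lambda>_. \<nu>)) (\<lambda>x. \<phi> (x 3) (x 2) * \<phi> (x 1) (x 0))"
    by (intro integrable_\<phi>_mult) auto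
  from product_integral_fold[OF _ _ _ this]
  have "(\<integral>x. \<phi> (x 3) (x 2) * \<phi> (x 1) (x 0) \<partial>PiM ({3, 2} \<union> {1, 0::nat}) (\<lambda>_. \<nu>))
      = (\<integral>x. \<integral>y. \<phi> (x 3) (x 2) * \<phi> (y 1) (y 0) \<partial>PiM {1, 0::nat} (\<lambda>_. \<nu>) \<partial>PiM {3, 2::nat} (\<lambda>_. \<nu>))"
    by (simp add: merge_def)
  also have "\<dots> = (\<integral>z. \<Phi> z \<partial>\<nu>)\<^sup>2"
    by (simp add: integral_\<phi>_pair power2_eq_square)
  finally show ?thesis unfolding eq .
qed

lemma integral_\<phi>_common:
  "(\<integral>x. \<phi> (x 2) (x 1) * \<phi> (x 2) (x 0) \<partial>PiM {0, 1, 2::nat} (\<lambda>_. \<nu>)) = (\<integral>z. (\<Phi> z)\<^sup>2 \<partial>\<nu>)"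
proof -
  interpret product_sigma_finite "\<lambda>_::nat. \<nu>" by (rule product_sigma_finite_mark)
  have eq: "{0, 1, 2::nat} = {2} \<union> {1, 0}" by auto
  have "integrable (PiM ({2} \<union> {1, 0::nat}) (\<lambda>_. \<nu>)) (\<lambda>x. \<phi> (x 2) (x 1) * \<phi> (x 2) (x 0))"
    by (intro integrable_\<phi>_mult) auto
  from product_integral_fold[OF _ _ _ this]
  have "(\<integral>x. \<phi> (x 2) (x 1) * \<phi> (x 2) (x 0) \<partial>PiM ({2} \<union> {1, 0::nat}) (\<lambda>_. \<nu>))
      = (\<integral>x. \<integral>y. \<phi> (x 2) (y 1) * \<phi> (x 2) (y 0) \<partial>PiM {1, 0::nat} (\<lambda>_. \<nu>) \<partial>PiM {2::nat} (\<lambda>_. \<nu>))"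
    by (simp add: merge_def)
  also have "\<dots> = (\<integral>x. (\<Phi> (x 2))\<^sup>2 \<partial>PiM {2::nat} (\<lambda>_. \<nu>))"
  proof (intro Bochner_Integration.integral_cong refl)
    fix x :: "nat \<Rightarrow> 'a \<times> bool"
    have "(\<integral>y. (\<Prod>i\<in>{1, 0::nat}. \<phi> (x 2) (y i)) \<partial>PiM {1, 0::nat} (\<lambda>_. \<nu>)) = (\<Prod>i\<in>{1, 0::nat}. \<integral>z. \<phi> (x 2) z \<partial>\<nu>)"
      by (intro product_integral_prod integrable_\<phi>) auto
    then show "(\<integral>y. \<phi> (x 2) (y 1) * \<phi> (x 2) (y 0) \<partial>PiM {1, 0::nat} (\<lambda>_. \<nu>)) = (\<Phi> (x 2))\<^sup>2"
      by (simp add: \<Phi>_def power2_eq_square)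
  qed
  also have "\<dots> = (\<integral>z. (\<Phi> z)\<^sup>2 \<partial>\<nu>)"
    by (rule product_integral_singleton) measurable
  finally show ?thesis unfolding eq .
qed

lemma U_eq: "\<omega> \<in> space P \<Longrightarrow> U \<omega> = tuple_sum {0, 1::nat} (\<lambda>x. \<phi> (x 1) (x 0)) \<omega>"
  unfolding U_def tuple_sum_def by (simp only: sum_inj_tuples_2[OF finite_marked_P])

lemma S_eq: "\<omega> \<in> space P \<Longrightarrow> S \<omega> = tuple_sum {0, 1::nat} (\<lambda>x. (\<phi> (x 1) (x 0))\<^sup>2) \<omega>"
  unfolding S_def tuple_sum_def by (simp only: sum_inj_tuples_2[OF finite_marked_P, where h = "\<lambda>a b. (\<phi> a b)\<^sup>2"])

lemma U_sq_eq: "\<omega> \<in> space P \<Longrightarrow> (U \<omega>)\<^sup>2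
    = tuple_sum {0, 1, 2, 3::nat} (\<lambda>x. \<phi> (x 3) (x 2) * \<phi> (x 1) (x 0)) \<omega>
    + 4 * tuple_sum {0, 1, 2::nat} (\<lambda>x. \<phi> (x 2) (x 1) * \<phi> (x 2) (x 0)) \<omega> + 2 * S \<omega>"
  unfolding U_def S_def tuple_sum_def
  by (simp only: offdiag_sum_square[OF finite_marked_P \<phi>_sym]
      sum_inj_tuples_4[OF finite_marked_P, where h = "\<lambda>a b c d. \<phi> a b * \<phi> c d"]
      sum_inj_tuples_3[OF finite_marked_P, where h = "\<lambda>a b c. \<phi> a b * \<phi> a c"])

lemma S_nonneg: "0 \<le> S \<omega>"
  unfolding S_def by (intro sum_nonneg) auto

lemma expectation_U: "integrable P U" "expectation U = (\<integral>z. \<Phi> z \<partial>\<nu>)"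
proof -
  have i: "integrable (PiM {0, 1::nat} (\<lambda>_. \<nu>)) (\<lambda>x. \<phi> (x 1) (x 0))"
    by (intro integrable_\<phi>_pair) auto
  note fm = factorial_moment[OF _ i]
  show "integrable P U" using fm(1) by (subst Bochner_Integration.integrable_cong[OF refl U_eq]) auto
  have "expectation U = (\<integral>\<omega>. tuple_sum {0, 1::nat} (\<lambda>x. \<phi> (x 1) (x 0)) \<omega> \<partial>P)"
    by (rule Bochner_Integration.integral_cong[OF refl U_eq])
  also have "\<dots> = (\<integral>z. \<Phi> z \<partial>\<nu>)"
    using fm(2) integral_\<phi>_pair[of "1::nat" 0] by (simp add: insert_commute)
  finally show "expectation U = (\<integral>z. \<Phi> z \<partial>\<nu>)" .
qed

lemma expectation_S: "integrable P S" "expectation S \<le> c * measure \<nu> UNIV"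
proof -
  have i: "integrable (PiM {0, 1::nat} (\<lambda>_. \<nu>)) (\<lambda>x. (\<phi> (x 1) (x 0))\<^sup>2)"
    by (intro integrable_\<phi>_sq) auto
  note fm = factorial_moment[OF _ i]
  show "integrable P S" using fm(1) by (subst Bochner_Integration.integrable_cong[OF refl S_eq]) auto
  have "expectation S = (\<integral>\<omega>. tuple_sum {0, 1::nat} (\<lambda>x. (\<phi> (x 1) (x 0))\<^sup>2) \<omega> \<partial>P)"
    by (rule Bochner_Integration.integral_cong[OF refl S_eq])
  also have "\<dots> = (\<integral>x. (\<phi> (x 1) (x 0))\<^sup>2 \<partial>PiM {0, 1::nat} (\<lambda>_. \<nu>))"
    using fm(2) by simp
  finally have eq: "expectation S = (\<integral>x. (\<phi> (x 1) (x 0))\<^sup>2 \<partial>PiM {0, 1::nat} (\<lambda>_. \<nu>))" .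
  have "ennreal (expectation S) = (\<integral>\<^sup>+x. ennreal ((\<phi> (x 1) (x 0))\<^sup>2) \<partial>PiM {0, 1::nat} (\<lambda>_. \<nu>))"
    unfolding eq using i by (intro nn_integral_eq_integral[symmetric]) auto
  also have "\<dots> = (\<integral>\<^sup>+z. \<integral>\<^sup>+z'. ennreal ((\<phi> z z')\<^sup>2) \<partial>\<nu> \<partial>\<nu>)"
    using nn_integral_two_coordinates[of "{}" "1::nat" 0 "\<lambda>z z'. ennreal ((\<phi> z z')\<^sup>2)"]
    by (simp add: insert_commute)
  also have "\<dots> \<le> ennreal (c * measure \<nu> UNIV)" by (rule integral_sq_le)
  finally show "expectation S \<le> c * measure \<nu> UNIV"
    using c by (subst (asm) ennreal_le_iff) auto
qed

text \<open>
  Pairs without a common point contribute the square of the mean, so the variance consists of the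
  contributions of overlapping pairs.
\<close>

lemma variance_U: "integrable P (\<lambda>\<omega>. (U \<omega>)\<^sup>2)" 
  "variance U \<le> 4 * (\<integral>z. (\<Phi> z)\<^sup>2 \<partial>\<nu>) + 2 * c * measure \<nu> UNIV"
proof -
  have i4: "integrable (PiM {0, 1, 2, 3::nat} (\<lambda>_. \<nu>)) (\<lambda>x. \<phi> (x 3) (x 2) * \<phi> (x 1) (x 0))"
    by (intro integrable_\<phi>_mult) auto
  have i3: "integrable (PiM {0, 1, 2::nat} (\<lambda>_. \<nu>)) (\<lambda>x. \<phi> (x 2) (x 1) * \<phi> (x 2) (x 0))"
    by (intro integrable_\<phi>_mult) auto
  note fm4 = factorial_moment[OF _ i4] and fm3 = factorial_moment[OF _ i3]
  show isq: "integrable P (\<lambda>\<omega>. (U \<omega>)\<^sup>2)"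
    using fm4(1) fm3(1) expectation_S(1) by (subst Bochner_Integration.integrable_cong[OF refl U_sq_eq]) auto
  have "expectation (\<lambda>\<omega>. (U \<omega>)\<^sup>2) = (\<integral>\<omega>. tuple_sum {0, 1, 2, 3::nat} (\<lambda>x. \<phi> (x 3) (x 2) * \<phi> (x 1) (x 0)) \<omega>
    + 4 * tuple_sum {0, 1, 2::nat} (\<lambda>x. \<phi> (x 2) (x 1) * \<phi> (x 2) (x 0)) \<omega> + 2 * S \<omega> \<partial>P)"
    by (rule Bochner_Integration.integral_cong[OF refl U_sq_eq])
  also have "\<dots> = (\<integral>z. \<Phi> z \<partial>\<nu>)\<^sup>2 + 4 * (\<integral>z. (\<Phi> z)\<^sup>2 \<partial>\<nu>) + 2 * expectation S"
    using fm4 fm3 expectation_S(1) by (simp add: integral_\<phi>_disjoint integral_\<phi>_common del: One_nat_def)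
  finally show "variance U \<le> 4 * (\<integral>z. (\<Phi> z)\<^sup>2 \<partial>\<nu>) + 2 * c * measure \<nu> UNIV"
    using expectation_S(2) by (subst variance_eq[OF expectation_U(1) isq]) (simp add: expectation_U(2))
qed

text \<open>
  Markov's inequality keeps \<open>S\<close> below \<open>2 * b / \<beta>\<close>, and Chebyshev's inequality keeps \<open>U\<close> close to its mean;
  each of them fails with probability at most \<open>\<beta> / 2\<close>.
\<close>

lemma self_normalized_lower_tail:
  assumes b: "c * measure \<nu> UNIV \<le> b" "0 < b" and a: "(\<integral>z. (\<Phi> z)\<^sup>2 \<partial>\<nu>) \<le> a" "0 \<le> a"
    and \<beta>: "0 < \<beta>" and t: "0 \<le> t"
    and sep: "(\<integral>z. \<Phi> z \<partial>\<nu>) \<ge> t * sqrt (4 * b / \<beta>) + sqrt (2 * (4 * a + 2 * b) / \<beta>)"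
  obtains E where "E \<in> sets P" "prob E \<le> \<beta>"
    and "{\<omega> \<in> space P. U \<omega> \<le> t * sqrt (2 * S \<omega>)} \<subseteq> E"
proof -
  define v where "v = 4 * a + 2 * b"
  have v: "0 < v" "variance U \<le> v" using a b variance_U(2) by (auto simp: v_def)
  define E1 where "E1 = {\<omega> \<in> space P. S \<omega> \<ge> 2 * b / \<beta>}"
  define E2 where "E2 = {\<omega> \<in> space P. \<bar>U \<omega> - expectation U\<bar> \<ge> sqrt (2 * v / \<beta>)}"
  have [measurable]: "S \<in> borel_measurable P" "U \<in> borel_measurable P"
    using expectation_S(1) expectation_U(1) by auto
  have E: "E1 \<in> events" "E2 \<in> events" unfolding E1_def E2_def by measurable
  have "prob E1 \<le> expectation S / (2 * b / \<beta>)"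
    unfolding E1_def using expectation_S(1) b \<beta>
    by (intro integral_Markov_inequality_measure[where A = "space P"]) (auto simp: S_nonneg)
  also have "\<dots> \<le> b / (2 * b / \<beta>)"
    using b \<beta> expectation_S(2) by (intro divide_right_mono) auto
  also have "\<dots> = \<beta> / 2" using b by simp
  finally have p1: "prob E1 \<le> \<beta> / 2" .
  have "prob E2 \<le> variance U / (sqrt (2 * v / \<beta>))\<^sup>2"
    unfolding E2_def using v \<beta> by (intro Chebyshev_inequality variance_U(1)) auto
  also have "\<dots> \<le> v / (2 * v / \<beta>)"
  proof -
    have "(sqrt (2 * v / \<beta>))\<^sup>2 = 2 * v / \<beta>" using v \<beta> by simp
    then show ?thesis using v \<beta> by (simp only:) (intro divide_right_mono, auto)
  qed
  also have "\<dots> = \<beta> / 2" using v by simp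
  finally have p2: "prob E2 \<le> \<beta> / 2" .
  show thesis
  proof (rule that[of "E1 \<union> E2"])
    show "prob (E1 \<union> E2) \<le> \<beta>"
      using measure_Un_le[OF E] p1 p2 by linarith
    show "{\<omega> \<in> space P. U \<omega> \<le> t * sqrt (2 * S \<omega>)} \<subseteq> E1 \<union> E2"
    proof
      fix \<omega> assume \<omega>: "\<omega> \<in> {\<omega> \<in> space P. U \<omega> \<le> t * sqrt (2 * S \<omega>)}"
      show "\<omega> \<in> E1 \<union> E2"
      proof (cases "S \<omega> \<ge> 2 * b / \<beta>")
        case False
        then have "t * sqrt (2 * S \<omega>) \<le> t * sqrt (4 * b / \<beta>)"
          using t by (intro mult_left_mono real_sqrt_le_mono) auto
        then have "U \<omega> \<le> expectation U - sqrt (2 * v / \<beta>)"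
          using \<omega> sep by (simp add: expectation_U(2) v_def)
        then have "\<bar>U \<omega> - expectation U\<bar> \<ge> sqrt (2 * v / \<beta>)" by linarith
        with \<omega> show ?thesis by (simp add: E2_def)
      qed (use \<omega> in \<open>simp add: E1_def\<close>)
    qed
  qed (use E in auto)
qed

end

section \<open>Smoothing along a line\<close>

text \<open>
  The triangle inequality in \<open>L\<^sup>2\<close>, in terms of upper bounds for the norms.
\<close>

lemma nn_integral_sq_add_le:
  fixes a b :: "'a \<Rightarrow> real"
  assumes [measurable]: "a \<in> borel_measurable M" "b \<in> borel_measurable M"
    and A: "(\<integral>\<^sup>+x. ennreal ((a x)\<^sup>2) \<partial>M) \<le> ennreal (A\<^sup>2)" "0 < A"
    and B: "(\<integral>\<^sup>+x. ennreal ((b x)\<^sup>2) \<partial>M) \<le> ennreal (B\<^sup>2)" "0 < B"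
  shows "(\<integral>\<^sup>+x. ennreal ((a x + b x)\<^sup>2) \<partial>M) \<le> ennreal ((A + B)\<^sup>2)"
proof -
  have pt: "(p + q)\<^sup>2 \<le> (1 + B / A) * p\<^sup>2 + (1 + A / B) * q\<^sup>2" for p q :: real
  proof -
    have "0 \<le> (B * p - A * q)\<^sup>2 / (A * B)" using A B by simp
    also have "\<dots> = (1 + B / A) * p\<^sup>2 + (1 + A / B) * q\<^sup>2 - (p + q)\<^sup>2"
      using A B by (simp add: field_simps power2_eq_square)
    finally show ?thesis by simp
  qed
  have "(\<integral>\<^sup>+x. ennreal ((a x + b x)\<^sup>2) \<partial>M)
      \<le> (\<integral>\<^sup>+x. ennreal (1 + B / A) * ennreal ((a x)\<^sup>2) + ennreal (1 + A / B) * ennreal ((b x)\<^sup>2) \<partial>M)"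
    using pt A B by (intro nn_integral_mono) (simp add: ennreal_mult[symmetric] ennreal_plus[symmetric] del: ennreal_plus)
  also have "\<dots> = ennreal (1 + B / A) * (\<integral>\<^sup>+x. ennreal ((a x)\<^sup>2) \<partial>M) + ennreal (1 + A / B) * (\<integral>\<^sup>+x. ennreal ((b x)\<^sup>2) \<partial>M)"
    by (simp add: nn_integral_add nn_integral_cmult)
  also have "\<dots> \<le> ennreal (1 + B / A) * ennreal (A\<^sup>2) + ennreal (1 + A / B) * ennreal (B\<^sup>2)"
    using A B by (intro add_mono mult_left_mono) auto
  also have "\<dots> = ennreal ((1 + B / A) * A\<^sup>2 + (1 + A / B) * B\<^sup>2)"
    using A B by (simp add: ennreal_mult[symmetric] ennreal_plus[symmetric] del: ennreal_plus)
  also have "(1 + B / A) * A\<^sup>2 + (1 + A / B) * B\<^sup>2 = (A + B)\<^sup>2"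
    using A B by (simp add: field_simps power2_eq_square)
  finally show ?thesis .
qed

text \<open>
  Minkowski's integral inequality, by the Cauchy-Schwarz inequality for the measure with density
  \<open>\<bar>\<kappa>\<bar> * w\<close>. With this weight only the integral of \<open>\<bar>\<kappa>\<bar> * w\<close> has to be finite, and not that of
  \<open>\<bar>\<kappa>\<bar> * w\<^sup>2\<close>; the kernels below have no more moments than that.
\<close>

lemma minkowski_weighted:
  fixes \<kappa> w :: "'b \<Rightarrow> real" and F :: "'a \<Rightarrow> 'b \<Rightarrow> ennreal"
  assumes sf: "sigma_finite_measure M" "sigma_finite_measure L"
    and [measurable]: "\<kappa> \<in> borel_measurable L" "w \<in> borel_measurable L"
    and F[measurable]: "(\<lambda>(x, v). F x v) \<in> borel_measurable (M \<Otimes>\<^sub>M L)"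
    and w: "AE v in L. 0 < w v" and Fw: "AE v in L. (\<integral>\<^sup>+x. (F x v)\<^sup>2 \<partial>M) \<le> ennreal ((w v)\<^sup>2)"
  shows "(\<integral>\<^sup>+x. (\<integral>\<^sup>+v. ennreal \<bar>\<kappa> v\<bar> * F x v \<partial>L)\<^sup>2 \<partial>M) \<le> (\<integral>\<^sup>+v. ennreal (\<bar>\<kappa> v\<bar> * w v) \<partial>L)\<^sup>2"
proof -
  interpret M: sigma_finite_measure M by fact
  interpret L: sigma_finite_measure L by fact
  interpret pair_sigma_finite M L ..
  let ?W = "\<integral>\<^sup>+v. ennreal (\<bar>\<kappa> v\<bar> * w v) \<partial>L"
  have "(\<integral>\<^sup>+v. ennreal \<bar>\<kappa> v\<bar> * F x v \<partial>L)\<^sup>2 \<le> ?W * (\<integral>\<^sup>+v. ennreal (\<bar>\<kappa> v\<bar> / w v) * (F x v)\<^sup>2 \<partial>L)"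
    if x[measurable]: "x \<in> space M" for x
  proof -
    have [measurable]: "F x \<in> borel_measurable L"
      using measurable_compose[OF measurable_Pair1'[OF x] F] by simp
    have "(\<integral>\<^sup>+v. ennreal \<bar>\<kappa> v\<bar> * F x v \<partial>L)
        = (\<integral>\<^sup>+v. ennreal (sqrt (\<bar>\<kappa> v\<bar> * w v)) * (ennreal (sqrt (\<bar>\<kappa> v\<bar> / w v)) * F x v) \<partial>L)"
    proof (rule nn_integral_cong_AE)
      show "AE v in L. ennreal \<bar>\<kappa> v\<bar> * F x v = ennreal (sqrt (\<bar>\<kappa> v\<bar> * w v)) * (ennreal (sqrt (\<bar>\<kappa> v\<bar> / w v)) * F x v)"
        using w
      proof eventually_elim
        case (elim v)
        have "sqrt (\<bar>\<kappa> v\<bar> * w v) * sqrt (\<bar>\<kappa> v\<bar> / w v) = \<bar>\<kappa> v\<bar>"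
          using elim by (simp add: real_sqrt_mult[symmetric])
        then show ?case
          using elim by (simp add: mult.assoc[symmetric] ennreal_mult[symmetric])
      qed
    qed
    also have "\<dots>\<^sup>2 \<le> (\<integral>\<^sup>+v. (ennreal (sqrt (\<bar>\<kappa> v\<bar> * w v)))\<^sup>2 \<partial>L) * (\<integral>\<^sup>+v. (ennreal (sqrt (\<bar>\<kappa> v\<bar> / w v)) * F x v)\<^sup>2 \<partial>L)"
      by (rule Cauchy_Schwarz_nn_integral) measurable
    also have "(\<integral>\<^sup>+v. (ennreal (sqrt (\<bar>\<kappa> v\<bar> * w v)))\<^sup>2 \<partial>L) = ?W"
    proof (rule nn_integral_cong_AE)
      show "AE v in L. (ennreal (sqrt (\<bar>\<kappa> v\<bar> * w v)))\<^sup>2 = ennreal (\<bar>\<kappa> v\<bar> * w v)"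
        using w by eventually_elim (simp add: ennreal_power)
    qed
    also have "(\<integral>\<^sup>+v. (ennreal (sqrt (\<bar>\<kappa> v\<bar> / w v)) * F x v)\<^sup>2 \<partial>L) = (\<integral>\<^sup>+v. ennreal (\<bar>\<kappa> v\<bar> / w v) * (F x v)\<^sup>2 \<partial>L)"
    proof (rule nn_integral_cong_AE)
      show "AE v in L. (ennreal (sqrt (\<bar>\<kappa> v\<bar> / w v)) * F x v)\<^sup>2 = ennreal (\<bar>\<kappa> v\<bar> / w v) * (F x v)\<^sup>2"
        using w by eventually_elim (simp add: ennreal_power power_mult_distrib)
    qed
    finally show ?thesis .
  qed
  then have "(\<integral>\<^sup>+x. (\<integral>\<^sup>+v. ennreal \<bar>\<kappa> v\<bar> * F x v \<partial>L)\<^sup>2 \<partial>M)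
      \<le> (\<integral>\<^sup>+x. ?W * (\<integral>\<^sup>+v. ennreal (\<bar>\<kappa> v\<bar> / w v) * (F x v)\<^sup>2 \<partial>L) \<partial>M)"
    by (rule nn_integral_mono)
  also have "\<dots> = ?W * (\<integral>\<^sup>+x. \<integral>\<^sup>+v. ennreal (\<bar>\<kappa> v\<bar> / w v) * (F x v)\<^sup>2 \<partial>L \<partial>M)"
    by (rule nn_integral_cmult) measurable
  also have "(\<integral>\<^sup>+x. \<integral>\<^sup>+v. ennreal (\<bar>\<kappa> v\<bar> / w v) * (F x v)\<^sup>2 \<partial>L \<partial>M)
      = (\<integral>\<^sup>+v. \<integral>\<^sup>+x. ennreal (\<bar>\<kappa> v\<bar> / w v) * (F x v)\<^sup>2 \<partial>M \<partial>L)"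
    by (rule Fubini'[symmetric]) measurable
  also have "\<dots> \<le> ?W"
  proof (rule nn_integral_mono_AE)
    show "AE v in L. (\<integral>\<^sup>+x. ennreal (\<bar>\<kappa> v\<bar> / w v) * (F x v)\<^sup>2 \<partial>M) \<le> ennreal (\<bar>\<kappa> v\<bar> * w v)"
      using w Fw AE_space
    proof eventually_elim
      case (elim v)
      have [measurable]: "(\<lambda>x. F x v) \<in> borel_measurable M"
        using measurable_compose[OF measurable_Pair2'[OF elim(3)] F] by simp
      have "(\<integral>\<^sup>+x. ennreal (\<bar>\<kappa> v\<bar> / w v) * (F x v)\<^sup>2 \<partial>M) = ennreal (\<bar>\<kappa> v\<bar> / w v) * (\<integral>\<^sup>+x. (F x v)\<^sup>2 \<partial>M)"
        by (rule nn_integral_cmult) measurable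
      also have "\<dots> \<le> ennreal (\<bar>\<kappa> v\<bar> / w v) * ennreal ((w v)\<^sup>2)"
        using elim by (intro mult_left_mono) auto
      also have "\<dots> = ennreal (\<bar>\<kappa> v\<bar> * w v)"
        using elim by (simp add: ennreal_mult[symmetric] power2_eq_square)
      finally show ?case .
    qed
  qed
  finally show ?thesis by (simp add: power2_eq_square mult_left_mono)
qed

lemma nn_integral_translate:
  fixes u :: "'a::euclidean_space \<Rightarrow> ennreal"
  assumes [measurable]: "u \<in> borel_measurable borel"
  shows "(\<integral>\<^sup>+x. u (x + a) \<partial>lborel) = (\<integral>\<^sup>+x. u x \<partial>lborel)"
proof -
  have "(\<integral>\<^sup>+x. u x \<partial>lborel) = (\<integral>\<^sup>+x. u x \<partial>distr lborel borel ((+) a))" by (simp add: lborel_distr_plus)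
  also have "\<dots> = (\<integral>\<^sup>+x. u (x + a) \<partial>lborel)" by (subst nn_integral_distr) (simp_all add: add.commute)
  finally show ?thesis ..
qed

text \<open>
  For an even \<open>\<kappa>\<close>, the convolution along the direction \<open>e\<close> with \<open>\<kappa>\<close> scaled to the bandwidth \<open>h\<close>.
\<close>

definition line_smoothing :: "(real \<Rightarrow> real) \<Rightarrow> real \<Rightarrow> 'a::euclidean_space \<Rightarrow> ('a \<Rightarrow> real) \<Rightarrow> 'a \<Rightarrow> real" where
  "line_smoothing \<kappa> h e s x = (\<integral>v. \<kappa> v * s (x + (h * v) *\<^sub>R e) \<partial>lborel)"

definition bdd_borel :: "('a::euclidean_space \<Rightarrow> real) \<Rightarrow> bool" where
  "bdd_borel s \<longleftrightarrow> s \<in> borel_measurable borel \<and> (\<exists>B. \<forall>x. \<bar>s x\<bar> \<le> B)"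

lemma integrable_mult_bdd_borel:
  fixes s :: "'a::euclidean_space \<Rightarrow> real"
  assumes \<kappa>: "integrable M \<kappa>" and s: "bdd_borel s" and T: "T \<in> borel_measurable M"
  shows "integrable M (\<lambda>v. \<kappa> v * s (T v) :: real)"
proof -
  obtain B where B: "\<And>x. \<bar>s x\<bar> \<le> B" and [measurable]: "s \<in> borel_measurable borel"
    using s by (auto simp: bdd_borel_def)
  note T[measurable]
  have [measurable]: "\<kappa> \<in> borel_measurable M" using \<kappa> by simp
  show ?thesis
  proof (rule Bochner_Integration.integrable_bound)
    show "integrable M (\<lambda>v. B * \<kappa> v)" using \<kappa> by simp
    have "\<bar>\<kappa> v\<bar> * \<bar>s (T v)\<bar> \<le> \<bar>\<kappa> v\<bar> * \<bar>B\<bar>" for v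
      using B[of "T v"] by (intro mult_left_mono) auto
    then show "AE v in M. norm (\<kappa> v * s (T v)) \<le> norm (B * \<kappa> v)"
      by (intro AE_I2) (simp add: abs_mult mult.commute)
  qed measurable
qed

lemma bdd_borel_line_smoothing:
  assumes \<kappa>: "integrable lborel \<kappa>" and s: "bdd_borel s"
  shows "bdd_borel (line_smoothing \<kappa> h e s)"
proof -
  obtain B where B: "\<And>x. \<bar>s x\<bar> \<le> B" and [measurable]: "s \<in> borel_measurable borel"
    using s by (auto simp: bdd_borel_def)
  have [measurable]: "\<kappa> \<in> borel_measurable borel" using \<kappa> by simp
  have "line_smoothing \<kappa> h e s \<in> borel_measurable lborel"
    unfolding line_smoothing_def by (rule lborel.borel_measurable_lebesgue_integral) measurable
  moreover have "\<bar>line_smoothing \<kappa> h e s x\<bar> \<le> (\<integral>v. \<bar>\<kappa> v\<bar> * B \<partial>lborel)" for x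
  proof -
    have "\<bar>line_smoothing \<kappa> h e s x\<bar> \<le> (\<integral>v. \<bar>\<kappa> v * s (x + (h * v) *\<^sub>R e)\<bar> \<partial>lborel)"
      unfolding line_smoothing_def using integral_norm_bound[of lborel "\<lambda>v. \<kappa> v * s (x + (h * v) *\<^sub>R e)"] by simp
    also have "\<dots> \<le> (\<integral>v. \<bar>\<kappa> v\<bar> * B \<partial>lborel)"
      using \<kappa> B by (intro integral_mono integrable_abs integrable_mult_bdd_borel[OF \<kappa> s])
        (auto simp: abs_mult intro!: mult_left_mono)
    finally show ?thesis .
  qed
  ultimately show ?thesis unfolding bdd_borel_def by auto
qed

lemma line_smoothing_L2:
  fixes g :: "'a::euclidean_space \<Rightarrow> real"
  assumes \<kappa>: "integrable lborel \<kappa>" and g: "bdd_borel g"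
    and G: "(\<integral>\<^sup>+x. ennreal ((g x)\<^sup>2) \<partial>lborel) \<le> ennreal (G\<^sup>2)" "0 < G"
  shows "(\<integral>\<^sup>+x. ennreal ((line_smoothing \<kappa> h e g x)\<^sup>2) \<partial>lborel) \<le> ennreal (((\<integral>v. \<bar>\<kappa> v\<bar> \<partial>lborel) * G)\<^sup>2)"
proof -
  have gm[measurable]: "g \<in> borel_measurable borel" using g by (simp add: bdd_borel_def)
  have [measurable]: "\<kappa> \<in> borel_measurable borel" using \<kappa> by simp
  have "(\<integral>\<^sup>+x. ennreal ((line_smoothing \<kappa> h e g x)\<^sup>2) \<partial>lborel)
      \<le> (\<integral>\<^sup>+x. (\<integral>\<^sup>+v. ennreal \<bar>\<kappa> v\<bar> * ennreal \<bar>g (x + (h * v) *\<^sub>R e)\<bar> \<partial>lborel)\<^sup>2 \<partial>lborel)"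
  proof (rule nn_integral_mono)
    fix x :: 'a
    have "ennreal \<bar>line_smoothing \<kappa> h e g x\<bar> \<le> (\<integral>\<^sup>+v. ennreal \<bar>\<kappa> v\<bar> * ennreal \<bar>g (x + (h * v) *\<^sub>R e)\<bar> \<partial>lborel)"
      unfolding line_smoothing_def
      using integral_norm_bound_ennreal[OF integrable_mult_bdd_borel[OF \<kappa> g, of "\<lambda>v. x + (h * v) *\<^sub>R e"]]
      by (simp add: abs_mult ennreal_mult)
    from power_mono[OF this, of 2]
    show "ennreal ((line_smoothing \<kappa> h e g x)\<^sup>2) \<le> (\<integral>\<^sup>+v. ennreal \<bar>\<kappa> v\<bar> * ennreal \<bar>g (x + (h * v) *\<^sub>R e)\<bar> \<partial>lborel)\<^sup>2"
      by (simp add: ennreal_power)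
  qed
  also have "\<dots> \<le> (\<integral>\<^sup>+v. ennreal (\<bar>\<kappa> v\<bar> * G) \<partial>lborel)\<^sup>2"
  proof (rule minkowski_weighted)
    have "(\<integral>\<^sup>+x. ennreal ((g (x + (h * v) *\<^sub>R e))\<^sup>2) \<partial>lborel) = (\<integral>\<^sup>+x. ennreal ((g x)\<^sup>2) \<partial>lborel)" for v
      by (rule nn_integral_translate[of "\<lambda>x. ennreal ((g x)\<^sup>2)"]) measurable
    then show "AE v in lborel. (\<integral>\<^sup>+x. (ennreal \<bar>g (x + (h * v) *\<^sub>R e)\<bar>)\<^sup>2 \<partial>lborel) \<le> ennreal (G\<^sup>2)"
      using G by (simp add: ennreal_power)
  qed (use G in \<open>auto simp: lborel.sigma_finite_measure_axioms\<close>)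
  also have "(\<integral>\<^sup>+v. ennreal (\<bar>\<kappa> v\<bar> * G) \<partial>lborel) = ennreal ((\<integral>v. \<bar>\<kappa> v\<bar> \<partial>lborel) * G)"
    using \<kappa> G by (subst nn_integral_eq_integral) auto
  finally show ?thesis using G by (simp add: ennreal_power)
qed

text \<open>
  Taylor's formula with integral remainder, where \<open>D l x\<close> is subtracted under the integral in order to
  include the term of order \<open>l\<close> in the polynomial. In contrast to an intermediate point, the integral
  is measurable in \<open>x\<close> and \<open>a\<close> and can be bounded in \<open>L\<^sup>2\<close>.
\<close>

lemma taylor_line_remainder:
  fixes D :: "nat \<Rightarrow> 'a::euclidean_space \<Rightarrow> real" and e :: 'a
  assumes l: "0 < l"
    and deriv: "\<And>j u. j < l \<Longrightarrow> ((\<lambda>t. D j (u + t *\<^sub>R e)) has_real_derivative D (Suc j) u) (at 0)"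
    and cont: "continuous_on UNIV (D l)"
  shows "ennreal \<bar>D 0 (x + a *\<^sub>R e) - (\<Sum>j\<le>l. a ^ j / fact j * D j x)\<bar>
    \<le> ennreal (\<bar>a\<bar> ^ l) * (\<integral>\<^sup>+\<tau>. ennreal \<bar>indicator {0..1} \<tau>\<bar> * ennreal \<bar>D l (x + (\<tau> * a) *\<^sub>R e) - D l x\<bar> \<partial>lborel)"
proof -
  obtain p where p: "l = Suc p" using l by (cases l) auto
  define Df where "Df m \<tau> = a ^ m * D m (x + (\<tau> * a) *\<^sub>R e)" for m and \<tau> :: real
  define \<Delta> where "\<Delta> \<tau> = D l (x + (\<tau> * a) *\<^sub>R e) - D l x" for \<tau> :: real
  have der: "(Df m has_vector_derivative Df (Suc m) t) (at t within {0..1})" if m: "m < l" for m t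
  proof -
    let ?u = "x + (t * a) *\<^sub>R e"
    have "((\<lambda>\<tau>. D m (?u + ((\<tau> - t) * a) *\<^sub>R e)) has_real_derivative D (Suc m) ?u * a) (at t)"
    proof (rule DERIV_chain2[where f = "\<lambda>r. D m (?u + r *\<^sub>R e)"])
      show "((\<lambda>r. D m (?u + r *\<^sub>R e)) has_real_derivative D (Suc m) ?u) (at ((t - t) * a))"
        using deriv[OF m, of ?u] by simp
      show "((\<lambda>\<tau>. (\<tau> - t) * a) has_real_derivative a) (at t)"
        by (auto intro!: derivative_eq_intros)
    qed
    moreover have "(\<lambda>\<tau>. D m (?u + ((\<tau> - t) * a) *\<^sub>R e)) = (\<lambda>\<tau>. D m (x + (\<tau> * a) *\<^sub>R e))"
      by (simp add: scaleR_left.diff left_diff_distrib)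
    ultimately have "((\<lambda>\<tau>. D m (x + (\<tau> * a) *\<^sub>R e)) has_real_derivative D (Suc m) ?u * a) (at t)" by simp
    from DERIV_cmult[OF this, of "a ^ m"] have "(Df m has_real_derivative Df (Suc m) t) (at t)"
      unfolding Df_def by (simp add: mult_ac)
    then show ?thesis
      by (simp add: has_real_derivative_iff_has_vector_derivative has_vector_derivative_at_within)
  qed
  have t1: "((\<lambda>\<tau>. ((1 - \<tau>) ^ p / fact p) *\<^sub>R Df l \<tau>) has_integral Df 0 1 - (\<Sum>j<l. ((1 - 0) ^ j / fact j) *\<^sub>R Df j 0)) {0..1}"
    using Taylor_has_integral[where p = l and Df = Df and f = "Df 0" and a = 0 and b = 1, OF l refl der] by (simp add: p)
  have t2: "((\<lambda>\<tau>. (1 - \<tau>) ^ p / fact p * (a ^ l * D l x)) has_integral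
      - ((1 - 1) ^ Suc p / fact (Suc p)) * (a ^ l * D l x) - (- ((1 - 0) ^ Suc p / fact (Suc p)) * (a ^ l * D l x))) {0..1}"
  proof (rule fundamental_theorem_of_calculus)
    fix t :: real assume "t \<in> {0..1}"
    have "((\<lambda>\<tau>. - ((1 - \<tau>) ^ Suc p / fact (Suc p)) * (a ^ l * D l x)) has_real_derivative
        (of_nat (Suc p) * (1 - t) ^ p / fact (Suc p)) * (a ^ l * D l x)) (at t within {0..1})"
      by (auto intro!: derivative_eq_intros simp del: power_Suc fact_Suc) 
    also have "of_nat (Suc p) * (1 - t) ^ p / fact (Suc p) = (1 - t) ^ p / fact p"
      by (simp add: field_simps del: of_nat_Suc)
    finally show "((\<lambda>\<tau>. - ((1 - \<tau>) ^ Suc p / fact (Suc p)) * (a ^ l * D l x)) has_vector_derivative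
        (1 - t) ^ p / fact p * (a ^ l * D l x)) (at t within {0..1})"
      by (simp add: has_real_derivative_iff_has_vector_derivative)
  qed simp
  have t3: "((\<lambda>\<tau>. (1 - \<tau>) ^ p / fact p * (a ^ l * \<Delta> \<tau>)) has_integral
      D 0 (x + a *\<^sub>R e) - (\<Sum>j\<le>l. a ^ j / fact j * D j x)) {0..1}"
  proof -
    have "(\<lambda>\<tau>. (1 - \<tau>) ^ p / fact p * (a ^ l * \<Delta> \<tau>))
        = (\<lambda>\<tau>. ((1 - \<tau>) ^ p / fact p) *\<^sub>R Df l \<tau> - (1 - \<tau>) ^ p / fact p * (a ^ l * D l x))"
      by (simp add: Df_def \<Delta>_def algebra_simps)
    moreover have "D 0 (x + a *\<^sub>R e) - (\<Sum>j\<le>l. a ^ j / fact j * D j x)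
        = (Df 0 1 - (\<Sum>j<l. ((1 - 0) ^ j / fact j) *\<^sub>R Df j 0))
        - (- ((1 - 1) ^ Suc p / fact (Suc p)) * (a ^ l * D l x) - (- ((1 - 0) ^ Suc p / fact (Suc p)) * (a ^ l * D l x)))"
      by (simp add: Df_def lessThan_Suc_atMost[symmetric] p del: fact_Suc)
    ultimately show ?thesis using has_integral_diff[OF t1 t2] by simp
  qed
  have \<Delta>c: "continuous_on {0..1} \<Delta>"
    unfolding \<Delta>_def by (intro continuous_intros continuous_on_compose2[OF cont]) auto
  have gi: "(\<lambda>\<tau>. \<bar>a\<bar> ^ l * \<bar>\<Delta> \<tau>\<bar>) integrable_on {0..1}"
    by (intro integrable_continuous_interval continuous_intros \<Delta>c)
  have "\<bar>D 0 (x + a *\<^sub>R e) - (\<Sum>j\<le>l. a ^ j / fact j * D j x)\<bar> \<le> integral {0..1} (\<lambda>\<tau>. \<bar>a\<bar> ^ l * \<bar>\<Delta> \<tau>\<bar>)"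
  proof -
    have "norm (integral {0..1} (\<lambda>\<tau>. (1 - \<tau>) ^ p / fact p * (a ^ l * \<Delta> \<tau>))) \<le> integral {0..1} (\<lambda>\<tau>. \<bar>a\<bar> ^ l * \<bar>\<Delta> \<tau>\<bar>)"
    proof (rule integral_norm_bound_integral[OF has_integral_integrable[OF t3] gi])
      fix \<tau> :: real assume \<tau>: "\<tau> \<in> {0..1}"
      have "(1 - \<tau>) ^ p / fact p \<le> 1 / 1"
        using \<tau> by (intro frac_le) (auto simp: power_le_one)
      then have "(1 - \<tau>) ^ p / fact p * (\<bar>a\<bar> ^ l * \<bar>\<Delta> \<tau>\<bar>) \<le> 1 * (\<bar>a\<bar> ^ l * \<bar>\<Delta> \<tau>\<bar>)"
        by (intro mult_right_mono) auto
      then show "norm ((1 - \<tau>) ^ p / fact p * (a ^ l * \<Delta> \<tau>)) \<le> \<bar>a\<bar> ^ l * \<bar>\<Delta> \<tau>\<bar>"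
        using \<tau> by (simp add: abs_mult power_abs)
    qed
    then show ?thesis unfolding integral_unique[OF t3] real_norm_def .
  qed
  then have "ennreal \<bar>D 0 (x + a *\<^sub>R e) - (\<Sum>j\<le>l. a ^ j / fact j * D j x)\<bar>
      \<le> ennreal (integral {0..1} (\<lambda>\<tau>. \<bar>a\<bar> ^ l * \<bar>\<Delta> \<tau>\<bar>))"
    by (rule ennreal_leI)
  also have "\<dots> = (\<integral>\<^sup>+\<tau>. ennreal (indicator {0..1} \<tau> * (\<bar>a\<bar> ^ l * \<bar>\<Delta> \<tau>\<bar>)) \<partial>lborel)"
  proof (rule nn_integral_has_integral_lborel[symmetric])
    have "D l \<in> borel_measurable borel" using cont by (rule borel_measurable_continuous_onI)
    then show "(\<lambda>\<tau>. indicator {0..1} \<tau> * (\<bar>a\<bar> ^ l * \<bar>\<Delta> \<tau>\<bar>)) \<in> borel_measurable borel"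
      unfolding \<Delta>_def by measurable
    have "((\<lambda>\<tau>. if \<tau> \<in> {0..1} then \<bar>a\<bar> ^ l * \<bar>\<Delta> \<tau>\<bar> else 0) has_integral integral {0..1} (\<lambda>\<tau>. \<bar>a\<bar> ^ l * \<bar>\<Delta> \<tau>\<bar>)) UNIV"
      using gi by (simp only: has_integral_restrict_UNIV) (rule integrable_integral)
    then show "((\<lambda>\<tau>. indicator {0..1} \<tau> * (\<bar>a\<bar> ^ l * \<bar>\<Delta> \<tau>\<bar>)) has_integral integral {0..1} (\<lambda>\<tau>. \<bar>a\<bar> ^ l * \<bar>\<Delta> \<tau>\<bar>)) UNIV"
      by (rule has_integral_eq[rotated]) (auto simp: indicator_def)
  qed simp
  also have "\<dots> = (\<integral>\<^sup>+\<tau>. ennreal (\<bar>a\<bar> ^ l) * (ennreal \<bar>indicator {0..1} \<tau>\<bar> * ennreal \<bar>\<Delta> \<tau>\<bar>) \<partial>lborel)"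
    by (intro nn_integral_cong) (auto simp: indicator_def ennreal_mult)
  also have "\<dots> = ennreal (\<bar>a\<bar> ^ l) * (\<integral>\<^sup>+\<tau>. ennreal \<bar>indicator {0..1} \<tau>\<bar> * ennreal \<bar>\<Delta> \<tau>\<bar> \<partial>lborel)"
  proof (rule nn_integral_cmult)
    have "D l \<in> borel_measurable borel" using cont by (rule borel_measurable_continuous_onI)
    then show "(\<lambda>\<tau>. ennreal \<bar>indicator {0..1} \<tau>\<bar> * ennreal \<bar>\<Delta> \<tau>\<bar>) \<in> borel_measurable lborel"
      unfolding \<Delta>_def by measurable
  qed
  finally show ?thesis unfolding \<Delta>_def .
qed

lemma power_le_one_plus_power:
  fixes t :: real
  assumes "0 \<le> t" "j \<le> m"
  shows "t ^ j \<le> 1 + t ^ m"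
proof (cases "t \<le> 1")
  case True
  then have "t ^ j \<le> 1" using assms by (simp add: power_le_one)
  moreover have "0 \<le> t ^ m" using assms by simp
  ultimately show ?thesis by simp
next
  case False
  then have "t ^ j \<le> t ^ m" using assms by (intro power_increasing) auto
  then show ?thesis by simp
qed

lemma powr_le_one_plus_power:
  fixes t :: real
  assumes "0 < t" "0 < \<delta>" "\<delta> \<le> real m"
  shows "t powr \<delta> \<le> 1 + t ^ m"
proof (cases "t \<le> 1")
  case True
  then have "t powr \<delta> \<le> 1 powr \<delta>" using assms by (intro powr_mono2) auto
  moreover have "0 \<le> t ^ m" using assms by simp
  ultimately show ?thesis by simp
next
  case False
  then have "t powr \<delta> \<le> t powr real m" using assms by (intro powr_mono) auto
  then show ?thesis using assms by (simp add: powr_realpow)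
qed

text \<open>
  The moment conditions annihilate the Taylor polynomial up to its constant term, so that the bias is
  the smoothed remainder, which is bounded by Minkowski's inequality.
\<close>

lemma smoothing_bias_from_remainder:
  fixes D :: "nat \<Rightarrow> 'a::euclidean_space \<Rightarrow> real" and e :: 'a and \<kappa> :: "real \<Rightarrow> real"
  assumes \<kappa>: "integrable lborel \<kappa>" "integrable lborel (\<lambda>v. \<bar>\<kappa> v\<bar> * \<bar>v\<bar> ^ m)" "(\<integral>v. \<kappa> v \<partial>lborel) = 1"
    and moments: "\<And>j. j \<in> {1..m} \<Longrightarrow> (\<integral>v. \<kappa> v * v ^ j \<partial>lborel) = 0"
    and s: "bdd_borel (D 0)" and l: "l \<le> m" and \<delta>: "0 < \<delta>" "\<delta> \<le> real m" and h: "0 < h" and R: "0 < R"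
    and F: "(\<lambda>(x, v). F x v) \<in> borel_measurable (lborel \<Otimes>\<^sub>M lborel)"
    and rem: "\<And>x v. ennreal \<bar>D 0 (x + (h * v) *\<^sub>R e) - (\<Sum>j\<le>l. (h * v) ^ j / fact j * D j x)\<bar> \<le> F x v"
    and FL2: "\<And>v. v \<noteq> 0 \<Longrightarrow> (\<integral>\<^sup>+x. (F x v)\<^sup>2 \<partial>lborel) \<le> ennreal ((R * \<bar>h * v\<bar> powr \<delta>)\<^sup>2)"
  shows "(\<integral>\<^sup>+x. ennreal ((line_smoothing \<kappa> h e (D 0) x - D 0 x)\<^sup>2) \<partial>lborel)
    \<le> ennreal ((R * h powr \<delta> * (\<integral>v. \<bar>\<kappa> v\<bar> * (1 + \<bar>v\<bar> ^ m) \<partial>lborel))\<^sup>2)"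
proof -
  have [measurable]: "\<kappa> \<in> borel_measurable borel" using \<kappa> by simp
  have int_m: "integrable lborel (\<lambda>v. \<bar>\<kappa> v\<bar> * (1 + \<bar>v\<bar> ^ m))"
    using \<kappa> by (simp add: distrib_left)
  have int_j: "integrable lborel (\<lambda>v. \<kappa> v * v ^ j)" if "j \<le> m" for j
  proof (rule Bochner_Integration.integrable_bound[OF int_m])
    have "\<bar>\<kappa> v\<bar> * \<bar>v\<bar> ^ j \<le> \<bar>\<kappa> v\<bar> * (1 + \<bar>v\<bar> ^ m)" for v
      using that by (intro mult_left_mono power_le_one_plus_power) auto
    then show "AE v in lborel. norm (\<kappa> v * v ^ j) \<le> norm (\<bar>\<kappa> v\<bar> * (1 + \<bar>v\<bar> ^ m))"
      by (intro AE_I2) (simp add: abs_mult power_abs)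
  qed measurable
  have pt: "ennreal ((line_smoothing \<kappa> h e (D 0) x - D 0 x)\<^sup>2) \<le> (\<integral>\<^sup>+v. ennreal \<bar>\<kappa> v\<bar> * F x v \<partial>lborel)\<^sup>2" for x
  proof -
    let ?T = "\<lambda>v. \<Sum>j\<le>l. (h * v) ^ j / fact j * D j x"
    have Teq: "\<kappa> v * ?T v = (\<Sum>j\<le>l. (h ^ j / fact j * D j x) * (\<kappa> v * v ^ j))" for v
      by (simp add: sum_distrib_left power_mult_distrib mult_ac)
    have Tint: "integrable lborel (\<lambda>v. \<kappa> v * ?T v)"
      unfolding Teq using int_j l by (intro Bochner_Integration.integrable_sum integrable_mult_right) auto
    have "(\<integral>v. \<kappa> v * ?T v \<partial>lborel) = (\<Sum>j\<le>l. (h ^ j / fact j * D j x) * (\<integral>v. \<kappa> v * v ^ j \<partial>lborel))"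
      unfolding Teq using int_j l by (subst Bochner_Integration.integral_sum) auto
    also have "\<dots> = (\<Sum>j\<in>{0}. (h ^ j / fact j * D j x) * (\<integral>v. \<kappa> v * v ^ j \<partial>lborel))"
      using moments l by (intro sum.mono_neutral_right) auto
    also have "\<dots> = D 0 x" using \<kappa> by simp
    finally have Tval: "(\<integral>v. \<kappa> v * ?T v \<partial>lborel) = D 0 x" .
    have sint: "integrable lborel (\<lambda>v. \<kappa> v * D 0 (x + (h * v) *\<^sub>R e))"
      by (rule integrable_mult_bdd_borel[OF \<kappa>(1) s]) measurable
    have diff: "line_smoothing \<kappa> h e (D 0) x - D 0 x = (\<integral>v. \<kappa> v * (D 0 (x + (h * v) *\<^sub>R e) - ?T v) \<partial>lborel)"
      unfolding line_smoothing_def right_diff_distrib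
      by (subst Bochner_Integration.integral_diff[OF sint Tint]) (simp only: Tval)
    have dint: "integrable lborel (\<lambda>v. \<kappa> v * (D 0 (x + (h * v) *\<^sub>R e) - ?T v))"
      unfolding right_diff_distrib by (rule Bochner_Integration.integrable_diff[OF sint Tint])
    have "ennreal \<bar>line_smoothing \<kappa> h e (D 0) x - D 0 x\<bar>
        \<le> (\<integral>\<^sup>+v. ennreal \<bar>\<kappa> v\<bar> * ennreal \<bar>D 0 (x + (h * v) *\<^sub>R e) - ?T v\<bar> \<partial>lborel)"
      unfolding diff using integral_norm_bound_ennreal[OF dint] by (simp add: abs_mult ennreal_mult)
    also have "\<dots> \<le> (\<integral>\<^sup>+v. ennreal \<bar>\<kappa> v\<bar> * F x v \<partial>lborel)"
      by (intro nn_integral_mono mult_left_mono rem) simp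
    finally have "ennreal \<bar>line_smoothing \<kappa> h e (D 0) x - D 0 x\<bar> \<le> (\<integral>\<^sup>+v. ennreal \<bar>\<kappa> v\<bar> * F x v \<partial>lborel)" .
    from power_mono[OF this, of 2] show ?thesis by (simp add: ennreal_power)
  qed
  have nz: "AE v in lborel. v \<noteq> (0::real)" by (rule AE_lborel_singleton)
  have "(\<integral>\<^sup>+x. ennreal ((line_smoothing \<kappa> h e (D 0) x - D 0 x)\<^sup>2) \<partial>lborel)
      \<le> (\<integral>\<^sup>+x. (\<integral>\<^sup>+v. ennreal \<bar>\<kappa> v\<bar> * F x v \<partial>lborel)\<^sup>2 \<partial>lborel)"
    by (intro nn_integral_mono pt)
  also have "\<dots> \<le> (\<integral>\<^sup>+v. ennreal (\<bar>\<kappa> v\<bar> * (R * \<bar>h * v\<bar> powr \<delta>)) \<partial>lborel)\<^sup>2"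
  proof (rule minkowski_weighted[OF _ _ _ _ F])
    show "AE v in lborel. 0 < R * \<bar>h * v\<bar> powr \<delta>" using nz by eventually_elim (use R h in simp)
    show "AE v in lborel. (\<integral>\<^sup>+x. (F x v)\<^sup>2 \<partial>lborel) \<le> ennreal ((R * \<bar>h * v\<bar> powr \<delta>)\<^sup>2)"
      using nz by eventually_elim (rule FL2)
  qed (auto simp: lborel.sigma_finite_measure_axioms)
  also have "\<dots> \<le> (ennreal (R * h powr \<delta> * (\<integral>v. \<bar>\<kappa> v\<bar> * (1 + \<bar>v\<bar> ^ m) \<partial>lborel)))\<^sup>2"
  proof (intro power_mono)
    have "(\<integral>\<^sup>+v. ennreal (\<bar>\<kappa> v\<bar> * (R * \<bar>h * v\<bar> powr \<delta>)) \<partial>lborel)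
        \<le> (\<integral>\<^sup>+v. ennreal (R * h powr \<delta> * (\<bar>\<kappa> v\<bar> * (1 + \<bar>v\<bar> ^ m))) \<partial>lborel)"
    proof (rule nn_integral_mono_AE)
      show "AE v in lborel. ennreal (\<bar>\<kappa> v\<bar> * (R * \<bar>h * v\<bar> powr \<delta>)) \<le> ennreal (R * h powr \<delta> * (\<bar>\<kappa> v\<bar> * (1 + \<bar>v\<bar> ^ m)))"
        using nz
      proof eventually_elim
        case (elim v)
        have "\<bar>h * v\<bar> powr \<delta> = h powr \<delta> * \<bar>v\<bar> powr \<delta>"
          using h by (simp add: abs_mult powr_mult)
        also have "\<dots> \<le> h powr \<delta> * (1 + \<bar>v\<bar> ^ m)"
          using elim \<delta> by (intro mult_left_mono powr_le_one_plus_power) auto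
        finally have "R * \<bar>\<kappa> v\<bar> * \<bar>h * v\<bar> powr \<delta> \<le> R * \<bar>\<kappa> v\<bar> * (h powr \<delta> * (1 + \<bar>v\<bar> ^ m))"
          using R by (intro mult_left_mono) auto
        then show ?case by (intro ennreal_leI) (simp add: mult_ac)
      qed
    qed
    also have "\<dots> = ennreal (R * h powr \<delta> * (\<integral>v. \<bar>\<kappa> v\<bar> * (1 + \<bar>v\<bar> ^ m) \<partial>lborel))"
      using int_m R h by (subst nn_integral_eq_integral) auto
    finally show "(\<integral>\<^sup>+v. ennreal (\<bar>\<kappa> v\<bar> * (R * \<bar>h * v\<bar> powr \<delta>)) \<partial>lborel)
        \<le> ennreal (R * h powr \<delta> * (\<integral>v. \<bar>\<kappa> v\<bar> * (1 + \<bar>v\<bar> ^ m) \<partial>lborel))" .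
  qed simp
  finally show ?thesis
    using R by (simp add: ennreal_power)
qed

text \<open>
  The remainder of the Taylor polynomial at distance \<open>a\<close> has \<open>L\<^sup>2\<close> norm at most \<open>R * \<bar>a\<bar> powr \<delta>\<close>: the factor
  \<open>\<bar>a\<bar> ^ l\<close> comes from Taylor's formula, the rest from the increments of the derivative of order \<open>l\<close>.
\<close>

lemma smoothing_bias:
  fixes D :: "nat \<Rightarrow> 'a::euclidean_space \<Rightarrow> real" and e :: 'a and \<kappa> :: "real \<Rightarrow> real"
  assumes \<kappa>: "integrable lborel \<kappa>" "integrable lborel (\<lambda>v. \<bar>\<kappa> v\<bar> * \<bar>v\<bar> ^ m)" "(\<integral>v. \<kappa> v \<partial>lborel) = 1"
    and moments: "\<And>j. j \<in> {1..m} \<Longrightarrow> (\<integral>v. \<kappa> v * v ^ j \<partial>lborel) = 0"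
    and s: "bdd_borel (D 0)" and \<delta>: "0 < \<delta>" "real l \<le> \<delta>" "\<delta> \<le> real m" and h: "0 < h" and R: "0 < R"
    and deriv: "\<And>j u. j < l \<Longrightarrow> ((\<lambda>t. D j (u + t *\<^sub>R e)) has_real_derivative D (Suc j) u) (at 0)"
    and cont: "continuous_on UNIV (D l)"
    and incr: "\<And>v. v \<noteq> 0 \<Longrightarrow> (\<integral>\<^sup>+x. ennreal ((D l (x + v *\<^sub>R e) - D l x)\<^sup>2) \<partial>lborel)
      \<le> ennreal ((R * \<bar>v\<bar> powr (\<delta> - real l))\<^sup>2)"
  shows "(\<integral>\<^sup>+x. ennreal ((line_smoothing \<kappa> h e (D 0) x - D 0 x)\<^sup>2) \<partial>lborel)
    \<le> ennreal ((R * h powr \<delta> * (\<integral>v. \<bar>\<kappa> v\<bar> * (1 + \<bar>v\<bar> ^ m) \<partial>lborel))\<^sup>2)"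
proof -
  have [measurable]: "D l \<in> borel_measurable borel" "D 0 \<in> borel_measurable borel"
    using cont s by (auto simp: bdd_borel_def intro: borel_measurable_continuous_onI)
  have lm: "l \<le> m" using \<delta> by linarith
  show ?thesis
  proof (cases "l = 0")
    case True
    show ?thesis
    proof (rule smoothing_bias_from_remainder[where D = D and l = l, OF \<kappa> moments s lm \<delta>(1,3) h R])
      show "(\<lambda>(x, v). ennreal \<bar>D 0 (x + (h * v) *\<^sub>R e) - D 0 x\<bar>) \<in> borel_measurable (lborel \<Otimes>\<^sub>M lborel)"
        by measurable
      show "(\<integral>\<^sup>+x. (ennreal \<bar>D 0 (x + (h * v) *\<^sub>R e) - D 0 x\<bar>)\<^sup>2 \<partial>lborel) \<le> ennreal ((R * \<bar>h * v\<bar> powr \<delta>)\<^sup>2)"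
        if "v \<noteq> 0" for v
        using incr[of "h * v"] that h True by (simp add: ennreal_power)
    qed (simp_all add: True)
  next
    case False
    define F where "F x v = ennreal (\<bar>h * v\<bar> ^ l) *
      (\<integral>\<^sup>+\<tau>. ennreal \<bar>indicator {0..1} \<tau>\<bar> * ennreal \<bar>D l (x + (\<tau> * (h * v)) *\<^sub>R e) - D l x\<bar> \<partial>lborel)" for x v
    show ?thesis
    proof (rule smoothing_bias_from_remainder[where D = D and l = l, OF \<kappa> moments s lm \<delta>(1,3) h R])
      show "(\<lambda>(x, v). F x v) \<in> borel_measurable (lborel \<Otimes>\<^sub>M lborel)"
        unfolding F_def by measurable
      show "ennreal \<bar>D 0 (x + (h * v) *\<^sub>R e) - (\<Sum>j\<le>l. (h * v) ^ j / fact j * D j x)\<bar> \<le> F x v" for x v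
        unfolding F_def using False by (intro taylor_line_remainder deriv cont) auto
      fix v :: real assume v: "v \<noteq> 0"
      define a where "a = h * v"
      have a: "a \<noteq> 0" using v h by (simp add: a_def)
      let ?w = "R * \<bar>a\<bar> powr (\<delta> - real l)"
      have "(\<integral>\<^sup>+x. (F x v)\<^sup>2 \<partial>lborel) = (ennreal (\<bar>a\<bar> ^ l))\<^sup>2 *
          (\<integral>\<^sup>+x. (\<integral>\<^sup>+\<tau>. ennreal \<bar>indicator {0..1} \<tau>\<bar> * ennreal \<bar>D l (x + (\<tau> * a) *\<^sub>R e) - D l x\<bar> \<partial>lborel)\<^sup>2 \<partial>lborel)"
        unfolding F_def a_def[symmetric] power_mult_distrib by (rule nn_integral_cmult) measurable
      also have "\<dots> \<le> (ennreal (\<bar>a\<bar> ^ l))\<^sup>2 * (\<integral>\<^sup>+\<tau>. ennreal (\<bar>indicator {0..1} (\<tau>::real)\<bar> * ?w) \<partial>lborel)\<^sup>2"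
      proof (intro mult_left_mono)
        have ne: "AE \<tau> in lborel. \<tau> \<noteq> (0::real)" by (rule AE_lborel_singleton)
        have bnd: "(\<integral>\<^sup>+x. (ennreal \<bar>indicator {0..1} \<tau>\<bar> * ennreal \<bar>D l (x + (\<tau> * a) *\<^sub>R e) - D l x\<bar>)\<^sup>2 \<partial>lborel) \<le> ennreal (?w\<^sup>2)"
          if "\<tau> \<noteq> 0" for \<tau>
        proof (cases "\<tau> \<in> {0..1}")
          case True
          have "(\<integral>\<^sup>+x. (ennreal \<bar>indicator {0..1} \<tau>\<bar> * ennreal \<bar>D l (x + (\<tau> * a) *\<^sub>R e) - D l x\<bar>)\<^sup>2 \<partial>lborel)
              = (\<integral>\<^sup>+x. ennreal ((D l (x + (\<tau> * a) *\<^sub>R e) - D l x)\<^sup>2) \<partial>lborel)"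
            using True by (simp add: ennreal_power)
          also have "\<dots> \<le> ennreal ((R * \<bar>\<tau> * a\<bar> powr (\<delta> - real l))\<^sup>2)"
            using that a by (intro incr) auto
          also have "\<dots> \<le> ennreal (?w\<^sup>2)"
          proof (intro ennreal_leI power_mono mult_left_mono powr_mono2)
            show "\<bar>\<tau> * a\<bar> \<le> \<bar>a\<bar>" using True by (simp add: abs_mult mult_left_le_one_le)
          qed (use R \<delta> in auto)
          finally show ?thesis .
        qed simp
        have "(\<integral>\<^sup>+x. (\<integral>\<^sup>+\<tau>. ennreal \<bar>indicator {0..1} \<tau>\<bar> * (ennreal \<bar>indicator {0..1} \<tau>\<bar> * ennreal \<bar>D l (x + (\<tau> * a) *\<^sub>R e) - D l x\<bar>) \<partial>lborel)\<^sup>2 \<partial>lborel)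
            \<le> (\<integral>\<^sup>+\<tau>. ennreal (\<bar>indicator {0..1} (\<tau>::real)\<bar> * ?w) \<partial>lborel)\<^sup>2"
        proof (rule minkowski_weighted[where \<kappa> = "indicator {0..1}" and w = "\<lambda>_. ?w"
              and F = "\<lambda>x \<tau>. ennreal \<bar>indicator {0..1} \<tau>\<bar> * ennreal \<bar>D l (x + (\<tau> * a) *\<^sub>R e) - D l x\<bar>"])
          show "AE \<tau> in lborel. (\<integral>\<^sup>+x. (ennreal \<bar>indicator {0..1} \<tau>\<bar> * ennreal \<bar>D l (x + (\<tau> * a) *\<^sub>R e) - D l x\<bar>)\<^sup>2 \<partial>lborel) \<le> ennreal (?w\<^sup>2)"
            using ne by eventually_elim (rule bnd)
        qed (use R a in \<open>auto simp: lborel.sigma_finite_measure_axioms\<close>)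
        moreover have "ennreal \<bar>indicator {0..1} \<tau>\<bar> * (ennreal \<bar>indicator {0..1} \<tau>\<bar> * y) = ennreal \<bar>indicator {0..1} \<tau>\<bar> * y" for \<tau> :: real and y
          by (simp add: indicator_def)
        ultimately show "(\<integral>\<^sup>+x. (\<integral>\<^sup>+\<tau>. ennreal \<bar>indicator {0..1} \<tau>\<bar> * ennreal \<bar>D l (x + (\<tau> * a) *\<^sub>R e) - D l x\<bar> \<partial>lborel)\<^sup>2 \<partial>lborel)
            \<le> (\<integral>\<^sup>+\<tau>. ennreal (\<bar>indicator {0..1} (\<tau>::real)\<bar> * ?w) \<partial>lborel)\<^sup>2" by simp
      qed simp
      also have "(\<integral>\<^sup>+\<tau>. ennreal (\<bar>indicator {0..1} (\<tau>::real)\<bar> * ?w) \<partial>lborel) = (\<integral>\<^sup>+\<tau>. ennreal ?w * indicator {0..1::real} \<tau> \<partial>lborel)"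
        by (intro nn_integral_cong) (auto simp: indicator_def)
      also have "\<dots> = ennreal ?w" by (simp add: nn_integral_cmult_indicator)
      also have "(ennreal (\<bar>a\<bar> ^ l))\<^sup>2 * (ennreal ?w)\<^sup>2 = ennreal ((R * \<bar>a\<bar> powr \<delta>)\<^sup>2)"
      proof -
        have "\<bar>a\<bar> ^ l * ?w = R * (\<bar>a\<bar> powr real l * \<bar>a\<bar> powr (\<delta> - real l))"
          using a by (simp add: powr_realpow)
        also have "\<dots> = R * \<bar>a\<bar> powr \<delta>" by (simp add: powr_add[symmetric])
        finally show ?thesis
          using R by (simp add: power_mult_distrib[symmetric] ennreal_mult[symmetric] ennreal_power)
      qed
      finally show "(\<integral>\<^sup>+x. (F x v)\<^sup>2 \<partial>lborel) \<le> ennreal ((R * \<bar>h * v\<bar> powr \<delta>)\<^sup>2)" unfolding a_def .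
    qed
  qed
qed

section \<open>Product kernels\<close>

text \<open>
  Smoothing along the coordinates in \<open>S\<close> only; this allows for induction on \<open>S\<close>.
\<close>

definition smoothing :: "('a \<Rightarrow> real \<Rightarrow> real) \<Rightarrow> ('a \<Rightarrow> real) \<Rightarrow> 'a::euclidean_space set \<Rightarrow> ('a \<Rightarrow> real) \<Rightarrow> 'a \<Rightarrow> real" where
  "smoothing \<kappa> h S s x =
     (\<integral>u. (\<Prod>b\<in>S. \<kappa> b (u b)) * s (x + (\<Sum>b\<in>S. (h b * u b) *\<^sub>R b)) \<partial>PiM S (\<lambda>_. lborel))"

text \<open>
  The counterpart of \<open>product_kernel\<close> on any Euclidean space, with kernels and bandwidths indexed by
  the basis vectors.
\<close>

definition prod_kernel :: "('a \<Rightarrow> real \<Rightarrow> real) \<Rightarrow> ('a \<Rightarrow> real) \<Rightarrow> 'a::euclidean_space \<Rightarrow> 'a \<Rightarrow> real" where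
  "prod_kernel \<kappa> h x y = (\<Prod>b\<in>Basis. 1 / h b * \<kappa> b ((x \<bullet> b - y \<bullet> b) / h b))"

interpretation lborel_prod: product_sigma_finite "\<lambda>_::'a::euclidean_space. lborel :: real measure"
  by standard

lemma integrable_prod_kernel_coords:
  fixes S :: "'a::euclidean_space set" and \<kappa> :: "'a \<Rightarrow> real \<Rightarrow> real"
  assumes "finite S" "\<And>b. b \<in> S \<Longrightarrow> integrable lborel (\<kappa> b)"
  shows "integrable (PiM S (\<lambda>_. lborel)) (\<lambda>u. \<Prod>b\<in>S. \<kappa> b (u b))"
  using assms by (rule lborel_prod.product_integrable_prod)

lemma coords_shift_measurable:
  fixes S :: "'a::euclidean_space set"
  shows "(\<lambda>u. x + (\<Sum>b\<in>S. (h b * u b) *\<^sub>R b)) \<in> borel_measurable (PiM S (\<lambda>_. lborel))"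
proof -
  have "(\<lambda>u. \<Sum>b\<in>S. (h b * u b) *\<^sub>R b) \<in> borel_measurable (PiM S (\<lambda>_. lborel))"
  proof (rule borel_measurable_sum)
    fix b assume b: "b \<in> S"
    have [measurable]: "(\<lambda>u. u b) \<in> borel_measurable (PiM S (\<lambda>_. lborel))"
      using measurable_component_singleton[OF b, of "\<lambda>_. lborel"] by simp
    show "(\<lambda>u. (h b * u b) *\<^sub>R b) \<in> borel_measurable (PiM S (\<lambda>_. lborel))" by measurable
  qed
  then show ?thesis by measurable
qed

lemma integrable_smoothing:
  assumes "finite S" "\<And>b. b \<in> S \<Longrightarrow> integrable lborel (\<kappa> b)" "bdd_borel s"
  shows "integrable (PiM S (\<lambda>_. lborel)) (\<lambda>u. (\<Prod>b\<in>S. \<kappa> b (u b)) * s (x + (\<Sum>b\<in>S. (h b * u b) *\<^sub>R b)))"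
  using assms by (intro integrable_mult_bdd_borel integrable_prod_kernel_coords coords_shift_measurable)

lemma smoothing_empty [simp]: "smoothing \<kappa> h {} s x = s x"
proof -
  have "finite_measure (PiM {} (\<lambda>_::'a. lborel :: real measure))" by (rule finite_measureI) (simp add: space_PiM)
  then show ?thesis by (simp add: smoothing_def PiM_empty lebesgue_integral_count_space_finite)
qed

lemma smoothing_insert:
  assumes S: "finite S" "b \<notin> S" and \<kappa>: "\<And>c. c \<in> insert b S \<Longrightarrow> integrable lborel (\<kappa> c)" and s: "bdd_borel s"
  shows "smoothing \<kappa> h (insert b S) s x = smoothing \<kappa> h S (line_smoothing (\<kappa> b) (h b) b s) x"
proof -
  have "smoothing \<kappa> h (insert b S) s x = (\<integral>u. (\<integral>v. (\<Prod>c\<in>insert b S. \<kappa> c ((u(b := v)) c)) *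
      s (x + (\<Sum>c\<in>insert b S. (h c * (u(b := v)) c) *\<^sub>R c)) \<partial>lborel) \<partial>PiM S (\<lambda>_. lborel))"
    unfolding smoothing_def
  proof (rule lborel_prod.product_integral_insert[OF S])
    show "integrable (PiM (insert b S) (\<lambda>_. lborel)) (\<lambda>u. (\<Prod>c\<in>insert b S. \<kappa> c (u c)) * s (x + (\<Sum>c\<in>insert b S. (h c * u c) *\<^sub>R c)))"
      using S \<kappa> s by (intro integrable_smoothing) auto
  qed
  also have "\<dots> = smoothing \<kappa> h S (line_smoothing (\<kappa> b) (h b) b s) x"
    unfolding smoothing_def
  proof (intro Bochner_Integration.integral_cong refl)
    fix u
    have p: "(\<Prod>c\<in>insert b S. \<kappa> c ((u(b := v)) c)) = (\<Prod>c\<in>S. \<kappa> c (u c)) * \<kappa> b v" for v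
      using S by (auto simp: mult.commute intro!: prod.cong arg_cong2[where f = "(*)"])
    have q: "x + (\<Sum>c\<in>insert b S. (h c * (u(b := v)) c) *\<^sub>R c) = x + (\<Sum>c\<in>S. (h c * u c) *\<^sub>R c) + (h b * v) *\<^sub>R b" for v
    proof -
      have "(\<Sum>c\<in>S. (h c * (u(b := v)) c) *\<^sub>R c) = (\<Sum>c\<in>S. (h c * u c) *\<^sub>R c)"
        using S by (intro sum.cong) auto
      then show ?thesis using S by (simp add: algebra_simps del: fun_upd_apply) simp
    qed
    show "(\<integral>v. (\<Prod>c\<in>insert b S. \<kappa> c ((u(b := v)) c)) * s (x + (\<Sum>c\<in>insert b S. (h c * (u(b := v)) c) *\<^sub>R c)) \<partial>lborel)
        = (\<Prod>c\<in>S. \<kappa> c (u c)) * line_smoothing (\<kappa> b) (h b) b s (x + (\<Sum>c\<in>S. (h c * u c) *\<^sub>R c))"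
      unfolding p q line_smoothing_def by (simp add: mult.assoc)
  qed
  finally show ?thesis .
qed

lemma smoothing_diff:
  assumes "finite S" "\<And>b. b \<in> S \<Longrightarrow> integrable lborel (\<kappa> b)" "bdd_borel s" "bdd_borel t"
  shows "smoothing \<kappa> h S (\<lambda>y. s y - t y) x = smoothing \<kappa> h S s x - smoothing \<kappa> h S t x"
  unfolding smoothing_def right_diff_distrib
  using Bochner_Integration.integral_diff[OF integrable_smoothing[OF assms(1,2,3)] integrable_smoothing[OF assms(1,2,4)]]
  by simp

lemma bdd_borel_diff:
  assumes "bdd_borel s" "bdd_borel t"
  shows "bdd_borel (\<lambda>x. s x - t x)"
proof -
  obtain A B where A: "\<And>x. \<bar>s x\<bar> \<le> A" and B: "\<And>x. \<bar>t x\<bar> \<le> B"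
    and [measurable]: "s \<in> borel_measurable borel" "t \<in> borel_measurable borel"
    using assms by (auto simp: bdd_borel_def)
  have "\<bar>s x - t x\<bar> \<le> A + B" for x using A[of x] B[of x] by linarith
  moreover have "(\<lambda>x. s x - t x) \<in> borel_measurable borel" by measurable
  ultimately show ?thesis unfolding bdd_borel_def by blast
qed

lemma smoothing_L2:
  fixes S :: "'a::euclidean_space set"
  assumes S: "finite S" and \<kappa>: "\<And>b. b \<in> S \<Longrightarrow> integrable lborel (\<kappa> b)"
    and L: "\<And>b. b \<in> S \<Longrightarrow> 0 < (\<integral>v. \<bar>\<kappa> b v\<bar> \<partial>lborel)"
    and g: "bdd_borel g" and G: "(\<integral>\<^sup>+x. ennreal ((g x)\<^sup>2) \<partial>lborel) \<le> ennreal (G\<^sup>2)" "0 < G"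
  shows "bdd_borel (smoothing \<kappa> h S g)"
    and "(\<integral>\<^sup>+x. ennreal ((smoothing \<kappa> h S g x)\<^sup>2) \<partial>lborel) \<le> ennreal (((\<Prod>b\<in>S. \<integral>v. \<bar>\<kappa> b v\<bar> \<partial>lborel) * G)\<^sup>2)"
proof -
  have "bdd_borel (smoothing \<kappa> h S g) \<and>
    (\<integral>\<^sup>+x. ennreal ((smoothing \<kappa> h S g x)\<^sup>2) \<partial>lborel) \<le> ennreal (((\<Prod>b\<in>S. \<integral>v. \<bar>\<kappa> b v\<bar> \<partial>lborel) * G)\<^sup>2)"
    using S \<kappa> L g G
  proof (induction S arbitrary: g G)
    case empty
    have "smoothing \<kappa> h {} g = g" by (rule ext) simp
    then show ?case using empty by simp
  next
    case (insert b S)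
    let ?g = "line_smoothing (\<kappa> b) (h b) b g" and ?G = "(\<integral>v. \<bar>\<kappa> b v\<bar> \<partial>lborel) * G"
    have eq: "smoothing \<kappa> h (insert b S) g = smoothing \<kappa> h S ?g"
      using insert by (intro ext smoothing_insert) auto
    have "bdd_borel (smoothing \<kappa> h S ?g) \<and>
      (\<integral>\<^sup>+x. ennreal ((smoothing \<kappa> h S ?g x)\<^sup>2) \<partial>lborel) \<le> ennreal (((\<Prod>b\<in>S. \<integral>v. \<bar>\<kappa> b v\<bar> \<partial>lborel) * ?G)\<^sup>2)"
    proof (rule insert.IH)
      show "(\<integral>\<^sup>+x. ennreal ((?g x)\<^sup>2) \<partial>lborel) \<le> ennreal (?G\<^sup>2)"
        using insert.prems by (intro line_smoothing_L2) auto
      show "0 < ?G" using insert.prems by (intro mult_pos_pos) auto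
    qed (use insert.prems in \<open>auto intro: bdd_borel_line_smoothing\<close>)
    then show ?case unfolding eq using insert.hyps by (simp add: mult_ac)
  qed
  then show "bdd_borel (smoothing \<kappa> h S g)"
    and "(\<integral>\<^sup>+x. ennreal ((smoothing \<kappa> h S g x)\<^sup>2) \<partial>lborel) \<le> ennreal (((\<Prod>b\<in>S. \<integral>v. \<bar>\<kappa> b v\<bar> \<partial>lborel) * G)\<^sup>2)" by auto
qed

text \<open>
  One more coordinate adds to the bias its own bias, smoothed along the other coordinates. This
  smoothing multiplies the \<open>L\<^sup>2\<close> norm at most by the \<open>L\<^sup>1\<close> norms of the kernels.
\<close>

lemma product_smoothing_bias:
  fixes S :: "'a::euclidean_space set"
  assumes S: "finite S" "S \<noteq> {}" and \<kappa>: "\<And>b. b \<in> S \<Longrightarrow> integrable lborel (\<kappa> b)"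
    and L: "\<And>b. b \<in> S \<Longrightarrow> 1 \<le> (\<integral>v. \<bar>\<kappa> b v\<bar> \<partial>lborel)"
    and s: "bdd_borel s"
    and B: "\<And>b. b \<in> S \<Longrightarrow> (\<integral>\<^sup>+x. ennreal ((line_smoothing (\<kappa> b) (h b) b s x - s x)\<^sup>2) \<partial>lborel) \<le> ennreal ((B b)\<^sup>2)"
    and Bpos: "\<And>b. b \<in> S \<Longrightarrow> 0 < B b"
    and sL2: "(\<integral>\<^sup>+x. ennreal ((s x)\<^sup>2) \<partial>lborel) \<le> ennreal (G\<^sup>2)" "0 < G"
  shows "(\<integral>\<^sup>+x. ennreal ((smoothing \<kappa> h S s x - s x)\<^sup>2) \<partial>lborel)
    \<le> ennreal (((\<Prod>b\<in>S. \<integral>v. \<bar>\<kappa> b v\<bar> \<partial>lborel) * (\<Sum>b\<in>S. B b))\<^sup>2)"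
  using S \<kappa> L B Bpos
proof (induction S rule: finite_ne_induct)
  case (singleton b)
  have "smoothing \<kappa> h {b} s x = line_smoothing (\<kappa> b) (h b) b s x" for x
    using smoothing_insert[of "{}" b \<kappa> s h x] singleton s by simp
  then have "(\<integral>\<^sup>+x. ennreal ((smoothing \<kappa> h {b} s x - s x)\<^sup>2) \<partial>lborel) \<le> ennreal ((B b)\<^sup>2)"
    using singleton by simp
  also have "\<dots> \<le> ennreal (((\<integral>v. \<bar>\<kappa> b v\<bar> \<partial>lborel) * B b)\<^sup>2)"
    using singleton by (intro ennreal_leI power_mono) auto
  finally show ?case by simp
next
  case (insert b S)
  let ?L = "\<lambda>b. \<integral>v. \<bar>\<kappa> b v\<bar> \<partial>lborel"
  let ?P = "line_smoothing (\<kappa> b) (h b) b s"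
  have L0: "0 < ?L c" if "c \<in> insert b S" for c using insert.prems(2)[OF that] by linarith
  have LS: "0 < (\<Prod>c\<in>S. ?L c)" using L0 by (intro prod_pos) auto
  have BS: "0 < (\<Sum>c\<in>S. B c)" using insert by (intro sum_pos) auto
  have Pb: "bdd_borel ?P" using insert.prems s by (intro bdd_borel_line_smoothing) auto
  have "smoothing \<kappa> h (insert b S) s x - s x = smoothing \<kappa> h S (\<lambda>y. ?P y - s y) x + (smoothing \<kappa> h S s x - s x)" for x
  proof -
    have "smoothing \<kappa> h (insert b S) s x = smoothing \<kappa> h S ?P x"
      using insert.hyps(1,3) insert.prems(1) s by (rule smoothing_insert)
    moreover have "smoothing \<kappa> h S (\<lambda>y. ?P y - s y) x = smoothing \<kappa> h S ?P x - smoothing \<kappa> h S s x"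
      by (rule smoothing_diff[OF insert.hyps(1) _ Pb s]) (rule insert.prems(1), simp)
    ultimately show ?thesis by simp
  qed
  then have "(\<integral>\<^sup>+x. ennreal ((smoothing \<kappa> h (insert b S) s x - s x)\<^sup>2) \<partial>lborel)
      = (\<integral>\<^sup>+x. ennreal ((smoothing \<kappa> h S (\<lambda>y. ?P y - s y) x + (smoothing \<kappa> h S s x - s x))\<^sup>2) \<partial>lborel)" by (simp only:)
  also have "\<dots> \<le> ennreal (((\<Prod>c\<in>S. ?L c) * B b + (\<Prod>c\<in>S. ?L c) * (\<Sum>c\<in>S. B c))\<^sup>2)"
  proof (rule nn_integral_sq_add_le)
    have \<kappa>S: "integrable lborel (\<kappa> c)" and L0S: "0 < ?L c" if "c \<in> S" for c
      using that insert.prems(1) L0 by simp_all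
    have Bb: "(\<integral>\<^sup>+x. ennreal ((?P x - s x)\<^sup>2) \<partial>lborel) \<le> ennreal ((B b)\<^sup>2)" "0 < B b"
      using insert.prems(3)[of b] insert.prems(4)[of b] by simp_all
    have d: "bdd_borel (\<lambda>y. ?P y - s y)" by (rule bdd_borel_diff[OF Pb s])
    have sm1: "bdd_borel (smoothing \<kappa> h S (\<lambda>y. ?P y - s y))"
      by (rule smoothing_L2(1)[OF insert.hyps(1) \<kappa>S L0S d Bb(1) Bb(2)])
    have sm2: "bdd_borel (smoothing \<kappa> h S s)"
      by (rule smoothing_L2(1)[OF insert.hyps(1) \<kappa>S L0S s sL2])
    show "smoothing \<kappa> h S (\<lambda>y. ?P y - s y) \<in> borel_measurable lborel"
      using sm1 by (simp add: bdd_borel_def)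
    show "(\<lambda>x. smoothing \<kappa> h S s x - s x) \<in> borel_measurable lborel"
      using bdd_borel_diff[OF sm2 s] by (simp add: bdd_borel_def)
    show "(\<integral>\<^sup>+x. ennreal ((smoothing \<kappa> h S (\<lambda>y. ?P y - s y) x)\<^sup>2) \<partial>lborel) \<le> ennreal (((\<Prod>c\<in>S. ?L c) * B b)\<^sup>2)"
      by (rule smoothing_L2(2)[OF insert.hyps(1) \<kappa>S L0S d Bb(1) Bb(2)])
    show "(\<integral>\<^sup>+x. ennreal ((smoothing \<kappa> h S s x - s x)\<^sup>2) \<partial>lborel) \<le> ennreal (((\<Prod>c\<in>S. ?L c) * (\<Sum>c\<in>S. B c))\<^sup>2)"
      by (rule insert.IH; rule insert.prems; simp)
    show "0 < (\<Prod>c\<in>S. ?L c) * B b" using LS insert.prems by simp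
    show "0 < (\<Prod>c\<in>S. ?L c) * (\<Sum>c\<in>S. B c)" using LS BS by simp
  qed
  also have "\<dots> \<le> ennreal (((\<Prod>c\<in>insert b S. ?L c) * (\<Sum>c\<in>insert b S. B c))\<^sup>2)"
  proof (intro ennreal_leI power_mono)
    have "(\<Prod>c\<in>S. ?L c) * B b + (\<Prod>c\<in>S. ?L c) * (\<Sum>c\<in>S. B c) = 1 * ((\<Prod>c\<in>S. ?L c) * (B b + (\<Sum>c\<in>S. B c)))"
      by (simp add: distrib_left)
    also have "\<dots> \<le> ?L b * ((\<Prod>c\<in>S. ?L c) * (B b + (\<Sum>c\<in>S. B c)))"
      using insert.prems(2)[of b] insert.prems(4)[of b] LS BS by (intro mult_right_mono mult_nonneg_nonneg) auto
    finally show "(\<Prod>c\<in>S. ?L c) * B b + (\<Prod>c\<in>S. ?L c) * (\<Sum>c\<in>S. B c) \<le> (\<Prod>c\<in>insert b S. ?L c) * (\<Sum>c\<in>insert b S. B c)"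
      using insert.hyps by (simp add: mult_ac)
    show "0 \<le> (\<Prod>c\<in>S. ?L c) * B b + (\<Prod>c\<in>S. ?L c) * (\<Sum>c\<in>S. B c)"
      using LS BS insert.prems(4)[of b] by simp
  qed
  finally show ?case .
qed

lemma affine_coord:
  fixes x z :: "'a::euclidean_space"
  assumes "b \<in> Basis" "h b \<noteq> 0"
  shows "(x \<bullet> b - (x + (\<Sum>c\<in>Basis. (h c * (z \<bullet> c)) *\<^sub>R c)) \<bullet> b) / h b = - (z \<bullet> b)"
  using assms by (simp add: inner_add_left inner_sum_left_Basis)

text \<open>
  The substitution \<open>y = x + h * v\<close> in each coordinate turns the integral into a product.
\<close>

lemma nn_integral_prod_affine:
  fixes x :: "'a::euclidean_space" and F :: "'a \<Rightarrow> real \<Rightarrow> ennreal"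
  assumes h: "\<And>b. b \<in> Basis \<Longrightarrow> 0 < h b" and [measurable]: "\<And>b. b \<in> Basis \<Longrightarrow> F b \<in> borel_measurable borel"
    and even: "\<And>b v. b \<in> Basis \<Longrightarrow> F b (- v) = F b v"
  shows "(\<integral>\<^sup>+y. (\<Prod>b\<in>Basis. F b ((x \<bullet> b - y \<bullet> b) / h b)) \<partial>lborel) = (\<Prod>b\<in>Basis. ennreal (h b) * (\<integral>\<^sup>+v. F b v \<partial>lborel))"
proof -
  let ?T = "\<lambda>z. x + (\<Sum>c\<in>Basis. (h c * (z \<bullet> c)) *\<^sub>R c)"
  have h0: "h b \<noteq> 0" if "b \<in> Basis" for b using h[OF that] by simp
  have "(\<integral>\<^sup>+y. (\<Prod>b\<in>Basis. F b ((x \<bullet> b - y \<bullet> b) / h b)) \<partial>lborel)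
      = (\<integral>\<^sup>+y. (\<Prod>b\<in>Basis. F b ((x \<bullet> b - y \<bullet> b) / h b)) \<partial>density (distr lborel borel ?T) (\<lambda>_. ennreal (\<Prod>j\<in>Basis. \<bar>h j\<bar>)))"
    using lborel_affine_euclidean[of h x] h0 by simp
  also have "\<dots> = ennreal (\<Prod>j\<in>Basis. \<bar>h j\<bar>) * (\<integral>\<^sup>+z. (\<Prod>b\<in>Basis. F b ((x \<bullet> b - ?T z \<bullet> b) / h b)) \<partial>lborel)"
    by (subst nn_integral_density, simp, simp, subst nn_integral_cmult, simp, subst nn_integral_distr) simp_all
  also have "(\<integral>\<^sup>+z. (\<Prod>b\<in>Basis. F b ((x \<bullet> b - ?T z \<bullet> b) / h b)) \<partial>lborel) = (\<integral>\<^sup>+z. (\<Prod>b\<in>Basis. F b (z \<bullet> b)) \<partial>lborel)"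
  proof (intro nn_integral_cong prod.cong refl)
    fix z b :: 'a assume b: "b \<in> Basis"
    show "F b ((x \<bullet> b - ?T z \<bullet> b) / h b) = F b (z \<bullet> b)"
      unfolding affine_coord[where h = h, OF b h0[OF b]] by (rule even[OF b])
  qed
  also have "\<dots> = (\<Prod>b\<in>Basis. \<integral>\<^sup>+v. F b v \<partial>lborel)"
    by (rule nn_integral_lborel_prod) auto
  also have "ennreal (\<Prod>j\<in>Basis. \<bar>h j\<bar>) = (\<Prod>j\<in>Basis. ennreal (h j))"
    using h by (subst prod_ennreal[symmetric]) (auto intro!: prod.cong simp: less_imp_le abs_of_nonneg)
  finally show ?thesis by (simp add: prod.distrib)
qed

lemma prod_kernel_measurable:
  assumes [measurable]: "\<And>b. b \<in> Basis \<Longrightarrow> \<kappa> b \<in> borel_measurable borel"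
  shows "(\<lambda>(x, y). prod_kernel \<kappa> h x y) \<in> borel_measurable (borel \<Otimes>\<^sub>M borel)"
    and "prod_kernel \<kappa> h x \<in> borel_measurable borel"
  unfolding prod_kernel_def by measurable

lemma nn_integral_prod_kernel_sq:
  fixes x :: "'a::euclidean_space"
  assumes h: "\<And>b. b \<in> Basis \<Longrightarrow> 0 < h b" and sq: "\<And>b. b \<in> Basis \<Longrightarrow> integrable lborel (\<lambda>v. (\<kappa> b v)\<^sup>2)"
    and [measurable]: "\<And>b. b \<in> Basis \<Longrightarrow> \<kappa> b \<in> borel_measurable borel"
    and even: "\<And>b v. b \<in> Basis \<Longrightarrow> \<kappa> b (- v) = \<kappa> b v"
  shows "(\<integral>\<^sup>+y. ennreal ((prod_kernel \<kappa> h x y)\<^sup>2) \<partial>lborel) = ennreal (\<Prod>b\<in>Basis. (\<integral>v. (\<kappa> b v)\<^sup>2 \<partial>lborel) / h b)"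
proof -
  have "(\<integral>\<^sup>+y. ennreal ((prod_kernel \<kappa> h x y)\<^sup>2) \<partial>lborel)
      = (\<integral>\<^sup>+y. (\<Prod>b\<in>Basis. ennreal ((1 / h b * \<kappa> b ((x \<bullet> b - y \<bullet> b) / h b))\<^sup>2)) \<partial>lborel)"
    unfolding prod_kernel_def prod_power_distrib by (subst prod_ennreal) auto
  also have "\<dots> = (\<Prod>b\<in>Basis. ennreal (h b) * (\<integral>\<^sup>+v. ennreal ((1 / h b * \<kappa> b v)\<^sup>2) \<partial>lborel))"
    using h even by (intro nn_integral_prod_affine[where F = "\<lambda>b v. ennreal ((1 / h b * \<kappa> b v)\<^sup>2)"]) auto
  also have "\<dots> = (\<Prod>b\<in>Basis. ennreal ((\<integral>v. (\<kappa> b v)\<^sup>2 \<partial>lborel) / h b))"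
  proof (rule prod.cong[OF refl])
    fix b :: 'a assume b: "b \<in> Basis"
    have "(\<integral>\<^sup>+v. ennreal ((1 / h b * \<kappa> b v)\<^sup>2) \<partial>lborel) = ennreal (\<integral>v. (1 / h b)\<^sup>2 * (\<kappa> b v)\<^sup>2 \<partial>lborel)"
      using sq[OF b] by (subst nn_integral_eq_integral[symmetric]) (auto simp: power_mult_distrib power_divide)
    then show "ennreal (h b) * (\<integral>\<^sup>+v. ennreal ((1 / h b * \<kappa> b v)\<^sup>2) \<partial>lborel) = ennreal ((\<integral>v. (\<kappa> b v)\<^sup>2 \<partial>lborel) / h b)"
      using h[OF b] by (simp add: ennreal_mult[symmetric] power2_eq_square)
  qed
  also have "\<dots> = ennreal (\<Prod>b\<in>Basis. (\<integral>v. (\<kappa> b v)\<^sup>2 \<partial>lborel) / h b)"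
    using h by (intro prod_ennreal) (auto intro!: divide_nonneg_pos)
  finally show ?thesis .
qed

text \<open>
  The same substitution, followed by the description of Lebesgue measure as a product measure.
\<close>

lemma integral_prod_kernel:
  fixes x :: "'a::euclidean_space"
  assumes h: "\<And>b. b \<in> Basis \<Longrightarrow> 0 < h b" and \<kappa>: "\<And>b. b \<in> Basis \<Longrightarrow> integrable lborel (\<kappa> b)"
    and even: "\<And>b v. b \<in> Basis \<Longrightarrow> \<kappa> b (- v) = \<kappa> b v" and s: "bdd_borel s"
  shows "(\<integral>y. prod_kernel \<kappa> h x y * s y \<partial>lborel) = smoothing \<kappa> h Basis s x"
proof -
  have [measurable]: "\<kappa> b \<in> borel_measurable borel" if "b \<in> Basis" for b using \<kappa>[OF that] by simp
  have [measurable]: "s \<in> borel_measurable borel" using s by (simp add: bdd_borel_def)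
  note [measurable] = prod_kernel_measurable(2)[of \<kappa> h x]
  let ?T = "\<lambda>z. x + (\<Sum>c\<in>Basis. (h c * (z \<bullet> c)) *\<^sub>R c)"
  let ?c = "\<Prod>j\<in>Basis. \<bar>h j\<bar>"
  let ?S = "\<lambda>f. \<Sum>b\<in>Basis. f b *\<^sub>R b :: 'a"
  have h0: "h b \<noteq> 0" if "b \<in> Basis" for b using h[OF that] by simp
  have "(\<integral>y. prod_kernel \<kappa> h x y * s y \<partial>lborel)
      = (\<integral>y. prod_kernel \<kappa> h x y * s y \<partial>density (distr lborel borel ?T) (\<lambda>_. ennreal ?c))"
    using lborel_affine_euclidean[of h x] h0 by simp
  also have "\<dots> = (\<integral>z. ?c * (prod_kernel \<kappa> h x (?T z) * s (?T z)) \<partial>lborel)"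
    by (subst integral_density, simp, simp, simp add: prod_nonneg, subst integral_distr) simp_all
  also have "\<dots> = (\<integral>z. (\<Prod>b\<in>Basis. \<kappa> b (z \<bullet> b)) * s (?T z) \<partial>lborel)"
  proof (intro Bochner_Integration.integral_cong refl)
    fix z :: 'a
    have "?c * prod_kernel \<kappa> h x (?T z) = (\<Prod>b\<in>Basis. \<bar>h b\<bar> * (1 / h b * \<kappa> b ((x \<bullet> b - ?T z \<bullet> b) / h b)))"
      unfolding prod_kernel_def by (rule prod.distrib[symmetric])
    also have "\<dots> = (\<Prod>b\<in>Basis. \<kappa> b (z \<bullet> b))"
    proof (rule prod.cong[OF refl])
      fix b :: 'a assume b: "b \<in> Basis"
      show "\<bar>h b\<bar> * (1 / h b * \<kappa> b ((x \<bullet> b - ?T z \<bullet> b) / h b)) = \<kappa> b (z \<bullet> b)"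
        unfolding affine_coord[where h = h, OF b h0[OF b]] using h[OF b] even[OF b, of "z \<bullet> b"] by simp
    qed
    finally show "?c * (prod_kernel \<kappa> h x (?T z) * s (?T z)) = (\<Prod>b\<in>Basis. \<kappa> b (z \<bullet> b)) * s (?T z)"
      by (simp only: mult.assoc[symmetric])
  qed
  also have "\<dots> = (\<integral>z. (\<Prod>b\<in>Basis. \<kappa> b (z \<bullet> b)) * s (?T z) \<partial>distr (\<Pi>\<^sub>M b\<in>Basis. lborel) borel ?S)"
    by (subst lborel_eq) (rule refl)
  also have "\<dots> = (\<integral>u. (\<Prod>b\<in>Basis. \<kappa> b (?S u \<bullet> b)) * s (?T (?S u)) \<partial>(\<Pi>\<^sub>M b\<in>Basis. lborel))"
    by (rule integral_distr) measurable
  also have "\<dots> = smoothing \<kappa> h Basis s x"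
    unfolding smoothing_def by (intro Bochner_Integration.integral_cong refl) (simp cong: prod.cong sum.cong)
  finally show ?thesis .
qed

section \<open>The error of the second kind for one kernel\<close>

context two_sample
begin

lemma fg_measurable [measurable]: "f \<in> borel_measurable borel" "g \<in> borel_measurable borel"
  using f g unfolding intensity_def by (auto dest!: borel_measurable_integrable)

lemma fg_nonneg: "0 \<le> f x" "0 \<le> g x"
  using f g by (auto simp: intensity_def)

lemma integral_mark_measure:
  assumes h: "integrable \<nu> h"
  shows "integrable lborel (\<lambda>x. n * f x * h (x, True))" (is "integrable _ ?T")
    and "integrable lborel (\<lambda>x. n * g x * h (x, False))" (is "integrable _ ?F")
    and "(\<integral>z. h z \<partial>\<nu>) = (\<integral>x. n * f x * h (x, True) \<partial>lborel) + (\<integral>x. n * g x * h (x, False) \<partial>lborel)"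
proof -
  have hm[measurable]: "h \<in> borel_measurable mark_space"
    using borel_measurable_integrable[OF h] unfolding measurable_cong_sets[OF sets_mark_measure refl] .
  have nn: "(\<integral>\<^sup>+z. ennreal (u z) \<partial>\<nu>)
      = (\<integral>\<^sup>+x. ennreal (n * f x * u (x, True)) \<partial>lborel) + (\<integral>\<^sup>+x. ennreal (n * g x * u (x, False)) \<partial>lborel)"
    if [measurable]: "u \<in> borel_measurable mark_space" for u :: "'a \<times> bool \<Rightarrow> real"
    using n fg_nonneg by (subst nn_integral_mark_measure) (simp_all add: ennreal_mult')
  have fin: "(\<integral>\<^sup>+z. ennreal \<bar>h z\<bar> \<partial>\<nu>) < \<infinity>"
    using h unfolding integrable_iff_bounded by simp
  have "(\<integral>\<^sup>+x. ennreal \<bar>?T x\<bar> \<partial>lborel) + (\<integral>\<^sup>+x. ennreal \<bar>?F x\<bar> \<partial>lborel) < \<infinity>"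
    using fin nn[of "\<lambda>z. \<bar>h z\<bar>"] n fg_nonneg by (simp add: abs_mult abs_of_nonneg)
  then have fT: "(\<integral>\<^sup>+x. ennreal \<bar>?T x\<bar> \<partial>lborel) < \<infinity>" and fF: "(\<integral>\<^sup>+x. ennreal \<bar>?F x\<bar> \<partial>lborel) < \<infinity>"
    by auto
  show iT: "integrable lborel ?T" using fT by (intro integrableI_bounded) simp_all
  show iF: "integrable lborel ?F" using fF by (intro integrableI_bounded) simp_all
  have top: "(\<integral>\<^sup>+x. ennreal (u x) \<partial>lborel) < top" "(\<integral>\<^sup>+x. ennreal (- u x) \<partial>lborel) < top"
    if "integrable lborel u" for u :: "'a \<Rightarrow> real"
    using integrableD(2,3)[OF that] by (simp_all add: less_top)
  have "(\<integral>z. h z \<partial>\<nu>) = enn2real (\<integral>\<^sup>+z. ennreal (h z) \<partial>\<nu>) - enn2real (\<integral>\<^sup>+z. ennreal (- h z) \<partial>\<nu>)"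
    by (rule real_lebesgue_integral_def[OF h])
  also have "\<dots> = (\<integral>x. ?T x \<partial>lborel) + (\<integral>x. ?F x \<partial>lborel)"
    unfolding real_lebesgue_integral_def[OF iT] real_lebesgue_integral_def[OF iF]
    using nn[of h] nn[of "\<lambda>z. - h z"] top[OF iT] top[OF iF] by (simp add: enn2real_plus)
  finally show "(\<integral>z. h z \<partial>\<nu>) = (\<integral>x. ?T x \<partial>lborel) + (\<integral>x. ?F x \<partial>lborel)" .
qed

end

definition mark_sign :: "'a \<times> bool \<Rightarrow> real" where
  "mark_sign z = (if snd z then 1 else -1)"

text \<open>
  If the samples are disjoint, a point determines its mark.
\<close>

lemma T_stat_marked:
  fixes K :: "'a \<Rightarrow> 'a \<Rightarrow> real"
  assumes fin: "finite N1" "finite N2" and disj: "N1 \<inter> N2 = {}"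
  shows "T_stat K (N1 \<union> N2) (\<lambda>x. if x \<in> N1 then 1 else -1)
      = (\<Sum>z\<in>marked (N1, N2). \<Sum>z'\<in>marked (N1, N2) - {z}. K (fst z) (fst z') * mark_sign z * mark_sign z')"
    and "offdiag_sq_sum K (N1 \<union> N2)
      = (\<Sum>z\<in>marked (N1, N2). \<Sum>z'\<in>marked (N1, N2) - {z}. (K (fst z) (fst z') * mark_sign z * mark_sign z')\<^sup>2)"
proof -
  let ?j = "\<lambda>x. (x, x \<in> N1)" and ?N = "N1 \<union> N2"
  have inj: "inj_on ?j A" for A by (auto simp: inj_on_def)
  have img: "marked (N1, N2) = ?j ` ?N"
    unfolding marked_def using disj by auto
  have sum: "(\<Sum>z\<in>marked (N1, N2). \<Sum>z'\<in>marked (N1, N2) - {z}. F z z') = (\<Sum>x\<in>?N. \<Sum>x'\<in>?N - {x}. F (?j x) (?j x'))"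
    for F :: "'a \<times> bool \<Rightarrow> 'a \<times> bool \<Rightarrow> real"
  proof -
    have "(\<Sum>z\<in>marked (N1, N2). \<Sum>z'\<in>marked (N1, N2) - {z}. F z z') = (\<Sum>x\<in>?N. \<Sum>z'\<in>?j ` ?N - {?j x}. F (?j x) z')"
      unfolding img by (subst sum.reindex[OF inj]) simp
    also have "\<dots> = (\<Sum>x\<in>?N. \<Sum>z'\<in>?j ` (?N - {x}). F (?j x) z')"
      by (intro sum.cong refl) auto
    also have "\<dots> = (\<Sum>x\<in>?N. \<Sum>x'\<in>?N - {x}. F (?j x) (?j x'))"
      by (intro sum.cong refl, subst sum.reindex[OF inj]) simp
    finally show ?thesis .
  qed
  show "T_stat K (N1 \<union> N2) (\<lambda>x. if x \<in> N1 then 1 else -1)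
      = (\<Sum>z\<in>marked (N1, N2). \<Sum>z'\<in>marked (N1, N2) - {z}. K (fst z) (fst z') * mark_sign z * mark_sign z')"
    unfolding sum T_stat_def by (simp add: mark_sign_def)
  show "offdiag_sq_sum K (N1 \<union> N2)
      = (\<Sum>z\<in>marked (N1, N2). \<Sum>z'\<in>marked (N1, N2) - {z}. (K (fst z) (fst z') * mark_sign z * mark_sign z')\<^sup>2)"
    unfolding sum offdiag_sq_sum_def by (intro sum.cong refl) (auto simp: mark_sign_def)
qed

lemma inner_product_polarization:
  fixes u s :: "'a::euclidean_space \<Rightarrow> real"
  assumes u: "integrable lborel (\<lambda>x. (u x)\<^sup>2)" and s: "integrable lborel (\<lambda>x. (s x)\<^sup>2)" and us: "integrable lborel (\<lambda>x. u x * s x)"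
  shows "(\<integral>x. u x * s x \<partial>lborel) = ((\<integral>x. (s x)\<^sup>2 \<partial>lborel) + (\<integral>x. (u x)\<^sup>2 \<partial>lborel) - (\<integral>x. (u x - s x)\<^sup>2 \<partial>lborel)) / 2"
proof -
  have "(\<integral>x. (u x - s x)\<^sup>2 \<partial>lborel) = (\<integral>x. ((u x)\<^sup>2 + (s x)\<^sup>2) - 2 * (u x * s x) \<partial>lborel)"
    by (intro Bochner_Integration.integral_cong refl) (simp add: power2_diff)
  also have "\<dots> = (\<integral>x. (u x)\<^sup>2 \<partial>lborel) + (\<integral>x. (s x)\<^sup>2 \<partial>lborel) - 2 * (\<integral>x. u x * s x \<partial>lborel)"
    using u s us by simp
  finally show ?thesis by simp
qed

text \<open>
  The projection \<open>\<Phi>\<close> of the signed kernel is \<open>n * u\<close> up to the sign. Polarisation makes half of \<open>n\<^sup>2\<close> times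
  the integral of \<open>u\<^sup>2\<close> appear in the mean, and this pays for the standard deviation of the leading
  term. The remaining conditions on the mean are those in the hypothesis \<open>sep\<close>.
\<close>

lemma (in two_sample) kernel_type_two:
  fixes K :: "'a \<Rightarrow> 'a \<Rightarrow> real" and u :: "'a \<Rightarrow> real"
  assumes Km[measurable]: "(\<lambda>(x, y). K x y) \<in> borel_measurable (borel \<Otimes>\<^sub>M borel)"
    and Ksym: "\<And>x y. K x y = K y x"
    and Ksq: "\<And>x. (\<integral>\<^sup>+y. ennreal ((K x y)\<^sup>2) \<partial>lborel) \<le> ennreal \<kappa>" and \<kappa>: "0 < \<kappa>"
    and u: "\<And>x. u x = (\<integral>y. K x y * (f y - g y) \<partial>lborel)" and ubdd: "bdd_borel u"
    and usq: "integrable lborel (\<lambda>x. (u x)\<^sup>2)"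
    and R': "(\<integral>x. f x \<partial>lborel) \<le> R'" "(\<integral>x. g x \<partial>lborel) \<le> R'" "0 < R'"
    and R'': "\<And>x. f x \<le> R''" "\<And>x. g x \<le> R''" "0 < R''"
    and \<beta>: "0 < \<beta>" and t: "0 \<le> t"
    and sep: "(\<integral>x. (f x - g x)\<^sup>2 \<partial>lborel) \<ge> (\<integral>x. (u x - (f x - g x))\<^sup>2 \<partial>lborel)
      + 16 * R'' / (\<beta> * n) + 2 * (t + 1) * sqrt (16 * R' * R'' * \<kappa> / \<beta>) / n"
  obtains E where "E \<in> sets P" "prob E \<le> \<beta>"
    and "AE \<omega> in P. T_stat K (fst \<omega> \<union> snd \<omega>) (\<lambda>x. if x \<in> fst \<omega> then 1 else -1)
        \<le> t * sqrt (2 * offdiag_sq_sum K (fst \<omega> \<union> snd \<omega>)) \<longrightarrow> \<omega> \<in> E"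
proof -
  define \<phi> where "\<phi> z z' = K (fst z) (fst z') * mark_sign z * mark_sign z'" for z z' :: "'a \<times> bool"
  define c where "c = 2 * n * R'' * \<kappa>"
  have c: "0 \<le> c" using n R'' \<kappa> by (simp add: c_def)
  have Kx[measurable]: "K x \<in> borel_measurable borel" for x
    using measurable_compose[OF measurable_Pair1' Km, of x] by simp
  have sgm[measurable]: "mark_sign \<in> borel_measurable mark_space"
    unfolding mark_sign_def by measurable
  have sg2: "(mark_sign z)\<^sup>2 = 1" for z :: "'a \<times> bool" by (simp add: mark_sign_def)
  have \<phi>m: "(\<lambda>(z, z'). \<phi> z z') \<in> borel_measurable (mark_space \<Otimes>\<^sub>M mark_space)"
  proof -
    have [measurable]: "(\<lambda>p. K (fst (fst p)) (fst (snd p))) \<in> borel_measurable (mark_space \<Otimes>\<^sub>M mark_space)"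
      using measurable_compose[OF _ Km, of "\<lambda>p. (fst (fst p), fst (snd p))" "mark_space \<Otimes>\<^sub>M mark_space"] by simp
    show ?thesis unfolding \<phi>_def case_prod_unfold by measurable
  qed
  have \<phi>sq: "(\<integral>\<^sup>+z'. ennreal ((\<phi> z z')\<^sup>2) \<partial>\<nu>) \<le> ennreal c" for z
  proof -
    have bd: "(\<integral>\<^sup>+x. ennreal (n * v x) * ennreal ((K (fst z) x)\<^sup>2) \<partial>lborel) \<le> ennreal (n * R'' * \<kappa>)"
      if v: "\<And>x. v x \<le> R''" for v
    proof -
      have "(\<integral>\<^sup>+x. ennreal (n * v x) * ennreal ((K (fst z) x)\<^sup>2) \<partial>lborel)
          \<le> (\<integral>\<^sup>+x. ennreal (n * R'') * ennreal ((K (fst z) x)\<^sup>2) \<partial>lborel)"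
        using v n by (intro nn_integral_mono mult_right_mono ennreal_leI) auto
      also have "\<dots> = ennreal (n * R'') * (\<integral>\<^sup>+x. ennreal ((K (fst z) x)\<^sup>2) \<partial>lborel)"
        by (rule nn_integral_cmult) measurable
      also have "\<dots> \<le> ennreal (n * R'') * ennreal \<kappa>" by (intro mult_left_mono Ksq) simp
      also have "\<dots> = ennreal (n * R'' * \<kappa>)" using n R'' \<kappa> by (simp add: ennreal_mult)
      finally show ?thesis .
    qed
    have sq: "(\<phi> z z')\<^sup>2 = (K (fst z) (fst z'))\<^sup>2" for z' by (simp add: \<phi>_def power_mult_distrib sg2)
    have "(\<integral>\<^sup>+z'. ennreal ((\<phi> z z')\<^sup>2) \<partial>\<nu>)
        = (\<integral>\<^sup>+x. ennreal (n * f x) * ennreal ((K (fst z) x)\<^sup>2) \<partial>lborel) + (\<integral>\<^sup>+x. ennreal (n * g x) * ennreal ((K (fst z) x)\<^sup>2) \<partial>lborel)"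
      unfolding sq by (subst nn_integral_mark_measure) simp_all
    also have "\<dots> \<le> ennreal (n * R'' * \<kappa>) + ennreal (n * R'' * \<kappa>)"
      by (intro add_mono bd R'')
    also have "\<dots> = ennreal c" using n R'' \<kappa> by (simp add: c_def ennreal_plus[symmetric] del: ennreal_plus)
    finally show ?thesis .
  qed
  interpret two_sample_kernel n f g P \<phi> c
    by unfold_locales (use \<phi>m \<phi>sq c Ksym in \<open>auto simp: \<phi>_def mult_ac\<close>)
  have \<Phi>: "\<Phi> z = mark_sign z * n * u (fst z)" for z
  proof -
    note im = integral_mark_measure[OF integrable_\<phi>[of z]]
    have "\<Phi> z = (\<integral>x. n * f x * \<phi> z (x, True) \<partial>lborel) + (\<integral>x. n * g x * \<phi> z (x, False) \<partial>lborel)"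
      unfolding \<Phi>_def by (rule im(3))
    also have "\<dots> = (\<integral>x. n * f x * \<phi> z (x, True) + n * g x * \<phi> z (x, False) \<partial>lborel)"
      by (rule Bochner_Integration.integral_add[symmetric, OF im(1,2)])
    also have "\<dots> = (\<integral>x. mark_sign z * n * (K (fst z) x * (f x - g x)) \<partial>lborel)"
      by (intro Bochner_Integration.integral_cong refl) (simp add: \<phi>_def mark_sign_def algebra_simps)
    also have "\<dots> = mark_sign z * n * u (fst z)" by (simp add: u)
    finally show ?thesis .
  qed
  obtain B where B: "\<And>x. \<bar>u x\<bar> \<le> B" and um[measurable]: "u \<in> borel_measurable borel"
    using ubdd by (auto simp: bdd_borel_def)
  have \<Phi>2: "(\<Phi> z)\<^sup>2 = n\<^sup>2 * (u (fst z))\<^sup>2" for z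
    by (simp only: \<Phi> power_mult_distrib sg2 mult_1_left)
  have \<Phi>b: "\<bar>\<Phi> z\<bar> \<le> n * B" for z
  proof -
    have "\<bar>\<Phi> z\<bar> = n * \<bar>u (fst z)\<bar>" using n by (simp add: \<Phi> abs_mult mark_sign_def)
    then show ?thesis using n B[of "fst z"] by simp
  qed
  have int\<Phi>: "integrable \<nu> \<Phi>"
  proof (rule mark.integrable_const_bound[where B = "n * B"])
    show "AE z in \<nu>. norm (\<Phi> z) \<le> n * B" using \<Phi>b by (intro AE_I2) simp
  qed (rule measurable_mark_measure[OF \<Phi>_meas])
  have int\<Phi>2: "integrable \<nu> (\<lambda>z. (\<Phi> z)\<^sup>2)"
  proof (rule mark.integrable_const_bound[where B = "(n * B)\<^sup>2"])
    have "\<bar>\<Phi> z\<bar>\<^sup>2 \<le> (n * B)\<^sup>2" for z by (intro power_mono \<Phi>b) simp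
    then show "AE z in \<nu>. norm ((\<Phi> z)\<^sup>2) \<le> (n * B)\<^sup>2" by (intro AE_I2) simp
    show "(\<lambda>z. (\<Phi> z)\<^sup>2) \<in> borel_measurable \<nu>"
      by (rule measurable_mark_measure) (rule borel_measurable_power[OF \<Phi>_meas])
  qed
  let ?Q = "\<integral>x. (u x)\<^sup>2 \<partial>lborel" and ?S2 = "\<integral>x. (f x - g x)\<^sup>2 \<partial>lborel" and ?E2 = "\<integral>x. (u x - (f x - g x))\<^sup>2 \<partial>lborel"
  have ssq: "integrable lborel (\<lambda>x. (f x - g x)\<^sup>2)"
  proof (rule Bochner_Integration.integrable_bound)
    show "integrable lborel (\<lambda>x. R'' * (f x + g x))" using f g by (simp add: intensity_def)
    have "(f x - g x)\<^sup>2 \<le> R'' * (f x + g x)" for x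
    proof -
      have "\<bar>f x - g x\<bar> \<le> R''" "\<bar>f x - g x\<bar> \<le> f x + g x" using fg_nonneg[of x] R''(1)[of x] R''(2)[of x] by auto
      then have "\<bar>f x - g x\<bar> * \<bar>f x - g x\<bar> \<le> R'' * (f x + g x)" by (intro mult_mono) (use R''(3) in auto)
      then show ?thesis by (simp add: power2_eq_square)
    qed
    then show "AE x in lborel. norm ((f x - g x)\<^sup>2) \<le> norm (R'' * (f x + g x))"
      using R''(3) fg_nonneg by (intro AE_I2) simp
  qed measurable
  have us: "integrable lborel (\<lambda>x. u x * (f x - g x))"
  proof -
    have "integrable lborel (\<lambda>x. (f x - g x) * u x)"
      using f g by (intro integrable_mult_bdd_borel ubdd) (auto simp: intensity_def)
    then show ?thesis by (simp add: mult.commute)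
  qed
  have mean: "(\<integral>z. \<Phi> z \<partial>\<nu>) = n\<^sup>2 * ((?S2 + ?Q - ?E2) / 2)"
  proof -
    note im = integral_mark_measure[OF int\<Phi>]
    have "(\<integral>z. \<Phi> z \<partial>\<nu>) = (\<integral>x. n * f x * \<Phi> (x, True) + n * g x * \<Phi> (x, False) \<partial>lborel)"
      unfolding im(3) by (rule Bochner_Integration.integral_add[symmetric, OF im(1,2)])
    also have "\<dots> = (\<integral>x. n\<^sup>2 * (u x * (f x - g x)) \<partial>lborel)"
      by (intro Bochner_Integration.integral_cong refl) (simp add: \<Phi> mark_sign_def power2_eq_square algebra_simps)
    also have "\<dots> = n\<^sup>2 * ((?S2 + ?Q - ?E2) / 2)"
      unfolding inner_product_polarization[OF usq ssq us, symmetric] by simp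
    finally show ?thesis .
  qed
  have var: "(\<integral>z. (\<Phi> z)\<^sup>2 \<partial>\<nu>) \<le> 2 * R'' * n ^ 3 * ?Q"
  proof -
    note im = integral_mark_measure[OF int\<Phi>2]
    have "(\<integral>z. (\<Phi> z)\<^sup>2 \<partial>\<nu>) = (\<integral>x. n * f x * (\<Phi> (x, True))\<^sup>2 + n * g x * (\<Phi> (x, False))\<^sup>2 \<partial>lborel)"
      unfolding im(3) by (rule Bochner_Integration.integral_add[symmetric, OF im(1,2)])
    also have "\<dots> \<le> (\<integral>x. 2 * R'' * n ^ 3 * (u x)\<^sup>2 \<partial>lborel)"
    proof (rule integral_mono)
      show "integrable lborel (\<lambda>x. n * f x * (\<Phi> (x, True))\<^sup>2 + n * g x * (\<Phi> (x, False))\<^sup>2)"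
        using im(1,2) by simp
      show "integrable lborel (\<lambda>x. 2 * R'' * n ^ 3 * (u x)\<^sup>2)" using usq by simp
      fix x
      have "n * f x * (\<Phi> (x, True))\<^sup>2 + n * g x * (\<Phi> (x, False))\<^sup>2 = n ^ 3 * (u x)\<^sup>2 * (f x + g x)"
        by (simp only: \<Phi>2 fst_conv) (simp add: power3_eq_cube power2_eq_square algebra_simps)
      also have "\<dots> \<le> n ^ 3 * (u x)\<^sup>2 * (2 * R'')"
        using R''(1)[of x] R''(2)[of x] n by (intro mult_left_mono) auto
      finally show "n * f x * (\<Phi> (x, True))\<^sup>2 + n * g x * (\<Phi> (x, False))\<^sup>2 \<le> 2 * R'' * n ^ 3 * (u x)\<^sup>2"
        by (simp add: mult_ac)
    qed
    finally show ?thesis by simp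
  qed
  have mass: "measure \<nu> UNIV \<le> 2 * n * R'"
  proof -
    have "measure \<nu> UNIV = (\<integral>z. 1 \<partial>\<nu>)" by simp
    also have "\<dots> = (\<integral>x. n * f x \<partial>lborel) + (\<integral>x. n * g x \<partial>lborel)"
      using integral_mark_measure(3)[of "\<lambda>_. 1"] by simp
    also have "\<dots> = n * (\<integral>x. f x \<partial>lborel) + n * (\<integral>x. g x \<partial>lborel)" by simp
    also have "\<dots> \<le> n * R' + n * R'" using R' n by (intro add_mono mult_left_mono) auto
    finally show ?thesis by (simp add: mult_ac)
  qed
  define a where "a = 2 * R'' * n ^ 3 * ?Q"
  define b where "b = 4 * n\<^sup>2 * R' * R'' * \<kappa>"
  have Q: "0 \<le> ?Q" by (intro integral_nonneg_AE) auto
  have a0: "0 \<le> a" using Q R'' n by (simp add: a_def)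
  have b0: "0 < b" using R' R'' n \<kappa> by (simp add: b_def)
  have cb: "c * measure \<nu> UNIV \<le> b"
  proof -
    have "c * measure \<nu> UNIV \<le> c * (2 * n * R')" by (intro mult_left_mono mass c)
    also have "\<dots> = b" by (simp add: b_def c_def power2_eq_square)
    finally show ?thesis .
  qed
  have sb: "sqrt (4 * b / \<beta>) = n * sqrt (16 * R' * R'' * \<kappa> / \<beta>)"
  proof -
    have "4 * b / \<beta> = n\<^sup>2 * (16 * R' * R'' * \<kappa> / \<beta>)" by (simp add: b_def)
    then show ?thesis using n by (simp only: real_sqrt_mult real_sqrt_abs abs_of_pos)
  qed
  \<comment> \<open>The mean of \<open>n\<^sup>2 * ?Q\<close> and \<open>16 * R'' * n / \<beta>\<close> dominates the root of their product, which is the leading term.\<close>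
  have sa: "sqrt (2 * (4 * a + 2 * b) / \<beta>) \<le> (n\<^sup>2 * ?Q + 16 * R'' * n / \<beta>) / 2 + sqrt (4 * b / \<beta>)"
  proof -
    have "sqrt (2 * (4 * a + 2 * b) / \<beta>) = sqrt ((n\<^sup>2 * ?Q) * (16 * R'' * n / \<beta>) + 4 * b / \<beta>)"
    proof -
      have "2 * (4 * a + 2 * b) / \<beta> = (n\<^sup>2 * ?Q) * (16 * R'' * n / \<beta>) + 4 * b / \<beta>"
        using \<beta> by (simp add: a_def power3_eq_cube power2_eq_square field_simps)
      then show ?thesis by (simp only:)
    qed
    also have "\<dots> \<le> sqrt ((n\<^sup>2 * ?Q) * (16 * R'' * n / \<beta>)) + sqrt (4 * b / \<beta>)"
      using Q R'' n \<beta> b0 by (intro sqrt_add_le_add_sqrt mult_nonneg_nonneg divide_nonneg_pos) auto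
    also have "sqrt ((n\<^sup>2 * ?Q) * (16 * R'' * n / \<beta>)) \<le> (n\<^sup>2 * ?Q + 16 * R'' * n / \<beta>) / 2"
      using Q R'' n \<beta> by (intro arith_geo_mean_sqrt mult_nonneg_nonneg divide_nonneg_pos) auto
    finally show ?thesis by simp
  qed
  let ?w = "sqrt (16 * R' * R'' * \<kappa> / \<beta>)"
  have "t * sqrt (4 * b / \<beta>) + sqrt (2 * (4 * a + 2 * b) / \<beta>) \<le> (\<integral>z. \<Phi> z \<partial>\<nu>)"
  proof -
    have "n\<^sup>2 * (?E2 + 16 * R'' / (\<beta> * n) + 2 * (t + 1) * ?w / n) \<le> n\<^sup>2 * ?S2"
      using sep by (intro mult_left_mono) auto
    moreover have "n\<^sup>2 * (?E2 + 16 * R'' / (\<beta> * n) + 2 * (t + 1) * ?w / n)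
        = n\<^sup>2 * ?E2 + 16 * R'' * n / \<beta> + 2 * (t + 1) * (n * ?w)"
      using n by (simp add: power2_eq_square distrib_left)
    ultimately have "n\<^sup>2 * ?E2 + 16 * R'' * n / \<beta> + 2 * ((t + 1) * (n * ?w)) \<le> n\<^sup>2 * ?S2"
      by (simp only: mult.assoc)
    moreover have "(t + 1) * (n * ?w) = t * (n * ?w) + n * ?w"
      by (simp add: distrib_right)
    moreover have "n\<^sup>2 * ((?S2 + ?Q - ?E2) / 2) = (n\<^sup>2 * ?S2 + n\<^sup>2 * ?Q - n\<^sup>2 * ?E2) / 2"
      by (simp add: algebra_simps)
    moreover have "T + v \<le> M" if "Y + z + 2 * W \<le> X" "W = T + w" "M = (X + q - Y) / 2" "v \<le> (q + z) / 2 + w"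
      for T v M Y z W X w q :: real
      using that by (simp add: field_simps)
    ultimately show ?thesis
      using sa unfolding mean sb by blast
  qed
  from self_normalized_lower_tail[OF cb b0 var[folded a_def] a0 \<beta> t this]
  obtain E where E: "E \<in> events" "prob E \<le> \<beta>" "{\<omega> \<in> space P. U \<omega> \<le> t * sqrt (2 * S \<omega>)} \<subseteq> E" by blast
  show thesis
  proof (rule that[OF E(1,2)])
    show "AE \<omega> in P. T_stat K (fst \<omega> \<union> snd \<omega>) (\<lambda>x. if x \<in> fst \<omega> then 1 else -1)
        \<le> t * sqrt (2 * offdiag_sq_sum K (fst \<omega> \<union> snd \<omega>)) \<longrightarrow> \<omega> \<in> E"
      using AE_disjoint AE_space
    proof eventually_elim
      case (elim \<omega>)
      have fin: "finite (fst \<omega>)" "finite (snd \<omega>)" using elim(2) by (auto simp: space_P)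
      have "T_stat K (fst \<omega> \<union> snd \<omega>) (\<lambda>x. if x \<in> fst \<omega> then 1 else -1) = U \<omega>"
        using T_stat_marked(1)[OF fin elim(1), of K] by (simp add: U_def \<phi>_def)
      moreover have "offdiag_sq_sum K (fst \<omega> \<union> snd \<omega>) = S \<omega>"
        using T_stat_marked(2)[OF fin elim(1), of K] by (simp add: S_def \<phi>_def)
      ultimately show ?case using E(3) elim(2) by auto
    qed
  qed
qed

section \<open>Bias over Nikol'skii-Besov balls\<close>

lemma Basis_real_vec: "(Basis :: (real ^ 'd) set) = range (\<lambda>i. axis i 1)"
  by (auto simp: Basis_vec_def)

definition axis_index :: "real ^ 'd::finite \<Rightarrow> 'd" where
  "axis_index b = (SOME i. b = axis i 1)"

lemma axis_index_axis [simp]: "axis_index (axis i 1 :: real ^ 'd::finite) = i"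
  unfolding axis_index_def by (rule some_equality) (auto simp: axis_eq_axis)

lemma inj_axis: "inj (\<lambda>i. axis i (1::real) :: real ^ 'd::finite)"
  by (auto simp: inj_on_def axis_eq_axis)

lemma prod_Basis_vec: "(\<Prod>b\<in>(Basis :: (real ^ 'd::finite) set). F b) = (\<Prod>i\<in>UNIV. F (axis i 1))"
  unfolding Basis_real_vec by (subst prod.reindex[OF inj_axis]) simp

lemma sum_Basis_vec: "(\<Sum>b\<in>(Basis :: (real ^ 'd::finite) set). F b) = (\<Sum>i\<in>UNIV. F (axis i 1))"
  unfolding Basis_real_vec by (subst sum.reindex[OF inj_axis]) simp

lemma bandwidth_pos [simp]: "0 < bandwidth m i"
  by (simp add: bandwidth_def)

lemma product_kernel_eq:
  "product_kernel k m x y = prod_kernel (\<lambda>b. k (axis_index b)) (\<lambda>b. bandwidth m (axis_index b)) x y"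
  unfolding product_kernel_def prod_kernel_def prod_Basis_vec by (simp add: inner_axis)

lemma product_kernel_sym:
  assumes "\<And>i v. k i (- v) = k i v"
  shows "product_kernel k m x y = product_kernel k m y x"
proof -
  have "k i ((x $ i - y $ i) / bandwidth m i) = k i ((y $ i - x $ i) / bandwidth m i)" for i
    using assms[of i "(x $ i - y $ i) / bandwidth m i"] by (simp add: minus_divide_left)
  then show ?thesis unfolding product_kernel_def by simp
qed

locale kernel_setting =
  fixes k :: "'d::finite \<Rightarrow> real \<Rightarrow> real" and \<Delta> :: "'d \<Rightarrow> nat" and \<delta> :: "'d \<Rightarrow> real"
  assumes kernel: "product_kernel_assms k"
    and \<Delta>_int: "\<And>i. integrable lborel (\<lambda>x. \<bar>k i x\<bar> * \<bar>x\<bar> ^ \<Delta> i)"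
    and moments: "\<And>i j. j \<in> {1..\<Delta> i} \<Longrightarrow> (\<integral>x. k i x * x ^ j \<partial>lborel) = 0"
    and \<delta>: "\<And>i. 0 < \<delta> i" "\<And>i. \<delta> i \<le> real (\<Delta> i)"
begin

lemma k_int: "integrable lborel (k i)" and k_sq: "integrable lborel (\<lambda>x. (k i x)\<^sup>2)"
  and k_even: "k i (- v) = k i v" and k_one: "(\<integral>x. k i x \<partial>lborel) = 1"
  using kernel unfolding product_kernel_assms_def by metis+

lemma k_measurable [measurable]: "k i \<in> borel_measurable borel"
  using k_int[of i] by simp

definition kernel_L1 :: "'d \<Rightarrow> real" where "kernel_L1 i = (\<integral>v. \<bar>k i v\<bar> \<partial>lborel)"
definition kernel_moment :: "'d \<Rightarrow> real" where "kernel_moment i = (\<integral>v. \<bar>k i v\<bar> * (1 + \<bar>v\<bar> ^ \<Delta> i) \<partial>lborel)"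

lemma kernel_L1_ge_1: "1 \<le> kernel_L1 i"
  unfolding kernel_L1_def using integral_norm_bound[of lborel "k i"] k_one[of i] by simp

lemma kernel_moment_ge_1: "1 \<le> kernel_moment i"
proof -
  have "kernel_L1 i \<le> kernel_moment i"
    unfolding kernel_L1_def kernel_moment_def using k_int[of i] \<Delta>_int[of i]
    by (intro integral_mono) (simp_all add: distrib_left)
  with kernel_L1_ge_1[of i] show ?thesis by simp
qed

text \<open>
  The ball provides the hypotheses of \<open>smoothing_bias\<close> along the axis \<open>i\<close>, with the integer part of \<open>\<delta> i\<close>
  as the order of the derivative.
\<close>

lemma besov_direction_bias:
  assumes s: "bdd_borel s" and besov: "s \<in> nikolskii_besov_ball \<delta> R" and R: "0 < R" and h: "0 < h"
  shows "(\<integral>\<^sup>+x. ennreal ((line_smoothing (k i) h (axis i 1) s x - s x)\<^sup>2) \<partial>lborel)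
    \<le> ennreal ((R * h powr \<delta> i * kernel_moment i)\<^sup>2)"
proof -
  define l where "l = nat \<lfloor>\<delta> i\<rfloor>"
  define D where "D j = (partial_deriv i ^^ j) s" for j
  have l: "of_int \<lfloor>\<delta> i\<rfloor> = real l" using \<delta>(1)[of i] by (simp add: l_def)
  have ball: "\<forall>j<l. \<forall>u. (\<lambda>t. D j (u + t *\<^sub>R axis i 1)) field_differentiable (at 0)"
    "continuous_on UNIV (D l)"
    "\<And>v::real. integrable lborel (\<lambda>u. (D l (u + v *\<^sub>R axis i 1) - D l u)\<^sup>2)"
    "\<And>v::real. L2_norm (\<lambda>u. D l (u + v *\<^sub>R axis i 1) - D l u) \<le> R * \<bar>v\<bar> powr (\<delta> i - real l)"
    using spec[OF besov[unfolded nikolskii_besov_ball_def Let_def mem_Collect_eq], of i, folded l_def, unfolded l]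
    unfolding D_def by blast+
  have "(\<integral>\<^sup>+x. ennreal ((line_smoothing (k i) h (axis i 1) (D 0) x - D 0 x)\<^sup>2) \<partial>lborel)
    \<le> ennreal ((R * h powr \<delta> i * (\<integral>v. \<bar>k i v\<bar> * (1 + \<bar>v\<bar> ^ \<Delta> i) \<partial>lborel))\<^sup>2)"
  proof (rule smoothing_bias[where D = D and l = l])
    show "bdd_borel (D 0)" using s by (simp add: D_def)
    show "real l \<le> \<delta> i" using \<delta>(1)[of i] by (simp add: l_def)
    show "((\<lambda>t. D j (u + t *\<^sub>R axis i 1)) has_real_derivative D (Suc j) u) (at 0)" if "j < l" for j u
    proof -
      have "D (Suc j) u = deriv (\<lambda>t. D j (u + t *\<^sub>R axis i 1)) 0"
        by (simp add: D_def partial_deriv_def)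
      then show ?thesis using ball(1) that by (simp add: DERIV_deriv_iff_field_differentiable)
    qed
    show "(\<integral>\<^sup>+x. ennreal ((D l (x + v *\<^sub>R axis i 1) - D l x)\<^sup>2) \<partial>lborel) \<le> ennreal ((R * \<bar>v\<bar> powr (\<delta> i - real l))\<^sup>2)" for v :: real
    proof -
      let ?I = "\<integral>x. (D l (x + v *\<^sub>R axis i 1) - D l x)\<^sup>2 \<partial>lborel"
      have "(\<integral>\<^sup>+x. ennreal ((D l (x + v *\<^sub>R axis i 1) - D l x)\<^sup>2) \<partial>lborel) = ennreal ?I"
        using ball(3)[of v] by (rule nn_integral_eq_integral) simp
      also have "?I = (L2_norm (\<lambda>u. D l (u + v *\<^sub>R axis i 1) - D l u))\<^sup>2"
        unfolding L2_norm_def by (subst real_sqrt_pow2) (auto intro!: integral_nonneg_AE)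
      also have "ennreal \<dots> \<le> ennreal ((R * \<bar>v\<bar> powr (\<delta> i - real l))\<^sup>2)"
        using ball(4)[of v] by (intro ennreal_leI power_mono) (auto simp: L2_norm_def intro!: integral_nonneg_AE)
      finally show ?thesis .
    qed
  qed (use k_int \<Delta>_int k_one moments \<delta> h R ball(2) in auto)
  then show ?thesis by (simp add: D_def kernel_moment_def)
qed

lemma besov_kernel_bias:
  fixes m :: "nat ^ 'd"
  defines "u \<equiv> \<lambda>s x. \<integral>y. product_kernel k m x y * s y \<partial>lborel"
  assumes s: "bdd_borel s" and s2: "integrable lborel (\<lambda>x. (s x)\<^sup>2)"
    and besov: "s \<in> nikolskii_besov_ball \<delta> R" and R: "0 < R"
  shows "bdd_borel (u s)" and "integrable lborel (\<lambda>x. (u s x)\<^sup>2)"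
    and "(\<integral>x. (u s x - s x)\<^sup>2 \<partial>lborel) \<le> ((\<Prod>i\<in>UNIV. kernel_L1 i) * (\<Sum>i\<in>UNIV. R * bandwidth m i powr \<delta> i * kernel_moment i))\<^sup>2"
proof -
  let ?\<kappa> = "\<lambda>b. k (axis_index b)" and ?h = "\<lambda>b. bandwidth m (axis_index b)"
  let ?B = "Basis :: (real ^ 'd) set"
  have u: "u s = smoothing ?\<kappa> ?h ?B s"
    unfolding u_def product_kernel_eq
    by (intro ext integral_prod_kernel) (auto simp: k_int k_even s)
  define G where "G = sqrt (\<integral>x. (s x)\<^sup>2 \<partial>lborel) + 1"
  have i0: "0 \<le> (\<integral>x. (s x)\<^sup>2 \<partial>lborel)" by (intro integral_nonneg_AE) auto
  have G: "0 < G" using i0 by (simp add: G_def add_nonneg_pos)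
  have sG: "(\<integral>\<^sup>+x. ennreal ((s x)\<^sup>2) \<partial>lborel) \<le> ennreal (G\<^sup>2)"
  proof -
    have "(\<integral>\<^sup>+x. ennreal ((s x)\<^sup>2) \<partial>lborel) = ennreal (\<integral>x. (s x)\<^sup>2 \<partial>lborel)"
      using s2 by (rule nn_integral_eq_integral) simp
    also have "\<dots> = ennreal ((sqrt (\<integral>x. (s x)\<^sup>2 \<partial>lborel))\<^sup>2)" using i0 by simp
    also have "\<dots> \<le> ennreal (G\<^sup>2)" using i0 by (intro ennreal_leI power_mono) (auto simp: G_def)
    finally show ?thesis .
  qed
  have Lpos: "0 < (\<integral>v. \<bar>?\<kappa> b v\<bar> \<partial>lborel)" for b using kernel_L1_ge_1[of "axis_index b"] by (simp add: kernel_L1_def)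
  note sm = smoothing_L2[of ?B ?\<kappa> s G ?h, OF finite_Basis k_int Lpos s sG G]
  show ub: "bdd_borel (u s)" unfolding u by (rule sm(1))
  have um[measurable]: "u s \<in> borel_measurable borel" using ub by (simp add: bdd_borel_def)
  have sm'[measurable]: "s \<in> borel_measurable borel" using s by (simp add: bdd_borel_def)
  have "(\<integral>\<^sup>+x. ennreal ((u s x)\<^sup>2) \<partial>lborel) < \<infinity>"
    unfolding u by (rule le_less_trans[OF sm(2)]) simp
  then show "integrable lborel (\<lambda>x. (u s x)\<^sup>2)"
    by (intro integrableI_bounded) simp_all
  let ?C = "(\<Prod>i\<in>UNIV. kernel_L1 i) * (\<Sum>i\<in>UNIV. R * bandwidth m i powr \<delta> i * kernel_moment i)"
  have "(\<integral>\<^sup>+x. ennreal ((smoothing ?\<kappa> ?h ?B s x - s x)\<^sup>2) \<partial>lborel)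
      \<le> ennreal (((\<Prod>b\<in>?B. \<integral>v. \<bar>?\<kappa> b v\<bar> \<partial>lborel)
          * (\<Sum>b\<in>?B. R * ?h b powr \<delta> (axis_index b) * kernel_moment (axis_index b)))\<^sup>2)"
  proof (rule product_smoothing_bias[OF _ _ _ _ s _ _ sG G])
    show "(\<integral>\<^sup>+x. ennreal ((line_smoothing (?\<kappa> b) (?h b) b s x - s x)\<^sup>2) \<partial>lborel)
        \<le> ennreal ((R * ?h b powr \<delta> (axis_index b) * kernel_moment (axis_index b))\<^sup>2)" if "b \<in> ?B" for b
    proof -
      obtain i where b: "b = axis i 1" using \<open>b \<in> ?B\<close> unfolding Basis_real_vec by auto
      show ?thesis unfolding b axis_index_axis by (rule besov_direction_bias[OF s besov R]) simp
    qed
    show "0 < R * ?h b powr \<delta> (axis_index b) * kernel_moment (axis_index b)" for b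
      using R kernel_moment_ge_1[of "axis_index b"] bandwidth_pos[of m "axis_index b"] by (intro mult_pos_pos) (auto simp del: bandwidth_pos)
    show "1 \<le> (\<integral>v. \<bar>?\<kappa> b v\<bar> \<partial>lborel)" for b using kernel_L1_ge_1[of "axis_index b"] by (simp add: kernel_L1_def)
  qed (use k_int in auto)
  also have "(\<Prod>b\<in>?B. \<integral>v. \<bar>?\<kappa> b v\<bar> \<partial>lborel)
          * (\<Sum>b\<in>?B. R * ?h b powr \<delta> (axis_index b) * kernel_moment (axis_index b)) = ?C"
    unfolding prod_Basis_vec sum_Basis_vec by (simp add: kernel_L1_def)
  finally have le: "(\<integral>\<^sup>+x. ennreal ((u s x - s x)\<^sup>2) \<partial>lborel) \<le> ennreal (?C\<^sup>2)" unfolding u .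
  have "integrable lborel (\<lambda>x. (u s x - s x)\<^sup>2)"
    using le_less_trans[OF le, of \<infinity>] by (intro integrableI_bounded) simp_all
  from nn_integral_eq_integral[OF this] le have "ennreal (\<integral>x. (u s x - s x)\<^sup>2 \<partial>lborel) \<le> ennreal (?C\<^sup>2)" by simp
  then show "(\<integral>x. (u s x - s x)\<^sup>2 \<partial>lborel) \<le> ?C\<^sup>2"
    by (subst (asm) ennreal_le_iff) auto
qed

end

section \<open>Choice of the bandwidths and the rate\<close>

text \<open>
  The bandwidth of the axis \<open>i\<close> is the largest one on the dyadic grid that is at most \<open>r powr (ex / \<delta> i)\<close>, so
  that all axes have a bias of order \<open>r powr ex\<close>. The index is the rounded logarithm of a power of \<open>1 / r\<close> and
  so of order \<open>ln n\<close>; the weight is logarithmic in the index.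
\<close>

lemma bandwidth_choice:
  fixes \<delta> :: "'d::finite \<Rightarrow> real" and n :: real
  assumes \<delta>: "\<And>i. 0 < \<delta> i" and n: "1 < n" "1 \<le> ln (ln n)"
  defines "\<delta>' \<equiv> 1 / (\<Sum>i\<in>UNIV. 1 / \<delta> i)"
  defines "ex \<equiv> 2 * \<delta>' / (1 + 4 * \<delta>')"
  defines "W \<equiv> 2 * (\<Sum>i\<in>UNIV. ln (ex / \<delta> i / ln 2 + 2) + 1 + ln (pi / sqrt 6))"
  defines "r \<equiv> ln (ln n) / n"
  obtains m :: "nat ^ 'd" where "\<And>i. bandwidth m i powr \<delta> i \<le> r powr ex"
    and "(\<Prod>i\<in>UNIV. 1 / bandwidth m i) \<le> 2 ^ CARD('d) * r powr (- (2 / (1 + 4 * \<delta>')))"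
    and "product_weight m \<le> W * ln (ln n)"
proof -
  have S: "0 < (\<Sum>i\<in>UNIV. 1 / \<delta> i)" using \<delta> by (intro sum_pos) auto
  have \<delta>': "0 < \<delta>'" using S by (simp add: \<delta>'_def)
  have ex: "0 < ex" using \<delta>' by (simp add: ex_def)
  have lnn: "exp 1 \<le> ln n"
  proof -
    have "exp 1 \<le> exp (ln (ln n))" using n by (simp only: exp_le_cancel_iff)
    also have "\<dots> = ln n" using n by simp
    finally show ?thesis .
  qed
  then have lnn1: "1 \<le> ln n" using exp_ge_add_one_self[of 1] by linarith
  have r0: "0 < r" unfolding r_def using n by (intro divide_pos_pos) linarith+
  have r1: "r \<le> 1"
  proof -
    have "ln (ln n) < ln n" using lnn1 by (intro ln_less_self) auto
    also have "\<dots> < n" using n by (intro ln_less_self) auto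
    finally show ?thesis using n by (simp add: r_def)
  qed
  define a where "a i = ex / \<delta> i" for i
  have a: "0 < a i" for i using ex \<delta>[of i] by (simp add: a_def)
  define q where "q = log 2 (1 / r)"
  have q0: "0 \<le> q" using r0 r1 by (simp add: q_def zero_le_log_cancel_iff)
  have q_powr: "2 powr (- (a i * q)) = r powr a i" for i
  proof -
    have "- (a i * q) = log 2 r * a i" using r0 by (simp add: q_def log_divide)
    then show ?thesis using r0 by (simp add: powr_powr[symmetric])
  qed
  define m :: "nat ^ 'd" where "m = (\<chi> i. nat \<lceil>a i * q\<rceil>)"
  have mi: "a i * q \<le> real (m $ i)" "real (m $ i) \<le> a i * q + 1" for i
  proof -
    have "0 \<le> a i * q" using a[of i] q0 by simp
    then have "real (m $ i) = of_int \<lceil>a i * q\<rceil>" by (simp add: m_def)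
    then show "a i * q \<le> real (m $ i)" "real (m $ i) \<le> a i * q + 1" by linarith+
  qed
  have up: "bandwidth m i \<le> r powr a i" for i
    unfolding bandwidth_def q_powr[symmetric] using mi(1)[of i] by (intro powr_mono) auto
  have lo: "1 / bandwidth m i \<le> 2 * r powr (- a i)" for i
  proof -
    have "1 / bandwidth m i = 2 powr real (m $ i)" by (simp add: bandwidth_def powr_minus_divide)
    also have "\<dots> \<le> 2 powr (a i * q + 1)" using mi(2)[of i] by (intro powr_mono) auto
    also have "\<dots> = 2 * 2 powr (a i * q)" by (simp add: powr_add)
    also have "2 powr (a i * q) = r powr (- a i)"
    proof -
      have "r powr (- a i) = inverse (2 powr (- (a i * q)))" by (simp only: powr_minus[of r] q_powr)
      then show ?thesis by (simp add: powr_minus)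
    qed
    finally show ?thesis .
  qed
  show thesis
  proof (rule that[of m])
    fix i
    have "bandwidth m i powr \<delta> i \<le> (r powr a i) powr \<delta> i"
      using up[of i] \<delta>[of i] by (intro powr_mono2) (auto simp: bandwidth_def)
    also have "\<dots> = r powr ex" using \<delta>[of i] by (simp add: powr_powr a_def)
    finally show "bandwidth m i powr \<delta> i \<le> r powr ex" .
  next
    have "(\<Prod>i\<in>UNIV. 1 / bandwidth m i) \<le> (\<Prod>i\<in>UNIV. 2 * r powr (- a i))"
      using lo by (intro prod_mono) (auto simp: bandwidth_def)
    also have "\<dots> = 2 ^ CARD('d) * r powr (\<Sum>i\<in>UNIV. - a i)"
      using r0 by (simp add: prod.distrib powr_sum)
    also have "(\<Sum>i\<in>UNIV. - a i) = - (2 / (1 + 4 * \<delta>'))"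
    proof -
      have "(\<Sum>i\<in>UNIV. a i) = ex * (\<Sum>i\<in>UNIV. 1 / \<delta> i)" by (simp add: a_def sum_distrib_left)
      also have "\<dots> = ex / \<delta>'" using S by (simp add: \<delta>'_def)
      also have "\<dots> = 2 / (1 + 4 * \<delta>')" using \<delta>' by (simp add: ex_def)
      finally show ?thesis by (simp add: sum_negf)
    qed
    finally show "(\<Prod>i\<in>UNIV. 1 / bandwidth m i) \<le> 2 ^ CARD('d) * r powr (- (2 / (1 + 4 * \<delta>')))" .
  next
    have term_le: "ln (real (m $ i) + 1) + ln (pi / sqrt 6) \<le> (ln (a i / ln 2 + 2) + 1 + ln (pi / sqrt 6)) * ln (ln n)" for i
    proof -
      have "1 / r = n / ln (ln n)" by (simp add: r_def)
      also have "\<dots> \<le> n / 1" using n by (intro divide_left_mono mult_pos_pos) linarith+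
      finally have "1 / r \<le> n" by simp
      then have "q \<le> log 2 n" unfolding q_def using r0 by (intro log_mono) auto
      then have q: "q \<le> ln n / ln 2" by (simp add: log_def)
      have "real (m $ i) + 1 \<le> a i * (ln n / ln 2) + 2"
        using mi(2)[of i] mult_left_mono[OF q, of "a i"] a[of i] by simp
      also have "\<dots> \<le> (a i / ln 2 + 2) * ln n"
        using lnn1 by (simp add: distrib_right)
      finally have "ln (real (m $ i) + 1) \<le> ln ((a i / ln 2 + 2) * ln n)"
        by (subst ln_le_cancel_iff) (use a[of i] lnn1 in \<open>auto intro!: mult_pos_pos add_pos_pos\<close>)
      also have "\<dots> = ln (a i / ln 2 + 2) + ln (ln n)"
        using a[of i] lnn1 by (intro ln_mult_pos) (auto intro!: add_pos_pos)
      finally have 1: "ln (real (m $ i) + 1) \<le> ln (a i / ln 2 + 2) + ln (ln n)" .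
      have c: "0 \<le> ln (a i / ln 2 + 2) + ln (pi / sqrt 6)"
        using a[of i] ln_pi_sqrt6_pos by (intro add_nonneg_nonneg) auto
      have "(ln (a i / ln 2 + 2) + ln (pi / sqrt 6)) * 1 \<le> (ln (a i / ln 2 + 2) + ln (pi / sqrt 6)) * ln (ln n)"
        using c n by (intro mult_left_mono) auto
      with 1 show ?thesis by (simp add: distrib_right)
    qed
    have "product_weight m \<le> 2 * (\<Sum>i\<in>UNIV. (ln (a i / ln 2 + 2) + 1 + ln (pi / sqrt 6)) * ln (ln n))"
      unfolding product_weight_def using term_le by (intro mult_left_mono sum_mono) auto
    also have "\<dots> = W * ln (ln n)"
      unfolding W_def a_def by (simp add: sum_distrib_right)
    finally show "product_weight m \<le> W * ln (ln n)" .
  qed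
qed

context kernel_setting
begin

lemma Phi4_type_two:
  assumes law: "two_sample_law (scale_measure (ennreal n) lborel) f g P" and n: "0 < n"
    and fg: "(f, g) \<in> besov_class \<delta> R R' R''"
    and \<alpha>: "0 < \<alpha>" "\<alpha> < 1" and \<beta>: "0 < \<beta>" and pos: "0 < R" "0 < R'" "0 < R''"
    and t: "t = exp 1 * (ln (1 / \<alpha>) + product_weight m + 2)"
    and \<kappa>: "(\<Prod>i\<in>UNIV. (\<integral>v. (k i v)\<^sup>2 \<partial>lborel) / bandwidth m i) \<le> \<kappa>" "0 < \<kappa>"
    and sep: "(L2_norm (\<lambda>x. f x - g x))\<^sup>2
      \<ge> ((\<Prod>i\<in>UNIV. kernel_L1 i) * (\<Sum>i\<in>UNIV. R * bandwidth m i powr \<delta> i * kernel_moment i))\<^sup>2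
        + 16 * R'' / (\<beta> * n) + 2 * (t + 1) * sqrt (16 * R' * R'' * \<kappa> / \<beta>) / n"
  shows "emeasure P {\<omega> \<in> space P. Phi4 k \<alpha> \<omega> = 0} \<le> ennreal \<beta>"
proof -
  have f: "intensity f" and g: "intensity g" and besov: "(\<lambda>x. f x - g x) \<in> nikolskii_besov_ball \<delta> R"
    and R'1: "L1_norm f \<le> R'" "L1_norm g \<le> R'" and R''1: "sup_norm f \<le> R''" "sup_norm g \<le> R''"
    using fg by (auto simp: besov_class_def)
  interpret two_sample n f g P by unfold_locales (fact law f g n)+
  let ?K = "product_kernel k m" and ?s = "\<lambda>x. f x - g x"
  define u where "u x = (\<integral>y. ?K x y * (f y - g y) \<partial>lborel)" for x
  have bound: "v x \<le> R''" "\<bar>v x\<bar> \<le> R''" if "intensity v" "sup_norm v \<le> R''" for v :: "real ^ 'd \<Rightarrow> real" and x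
  proof -
    have "bounded (range v)" using that(1) by (simp add: intensity_def)
    then obtain c where "\<And>x. \<bar>v x\<bar> \<le> c" unfolding bounded_iff by auto
    then have "bdd_above (range (\<lambda>x. \<bar>v x\<bar>))" by (intro bdd_aboveI2)
    then have "\<bar>v x\<bar> \<le> sup_norm v" unfolding sup_norm_def by (rule cSUP_upper[OF UNIV_I])
    with that(2) show "v x \<le> R''" "\<bar>v x\<bar> \<le> R''" by linarith+
  qed
  have mass: "(\<integral>x. v x \<partial>lborel) \<le> R'" if "intensity v" "L1_norm v \<le> R'" for v :: "real ^ 'd \<Rightarrow> real"
    using that by (simp add: L1_norm_def intensity_def)
  have bb: "bdd_borel v" if "intensity v" "sup_norm v \<le> R''" for v :: "real ^ 'd \<Rightarrow> real"
    unfolding bdd_borel_def using bound(2)[OF that] that(1) by (auto simp: intensity_def dest!: borel_measurable_integrable)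
  have sb: "bdd_borel ?s" by (intro bdd_borel_diff bb f g R''1)
  have s2: "integrable lborel (\<lambda>x. (?s x)\<^sup>2)"
  proof -
    have "integrable lborel (\<lambda>x. ?s x * ?s x)"
      using f g by (intro integrable_mult_bdd_borel sb) (auto simp: intensity_def)
    then show ?thesis by (simp add: power2_eq_square)
  qed
  note bias = besov_kernel_bias[OF sb s2 besov pos(1), of m, folded u_def]
  have K_meas: "(\<lambda>(x, y). ?K x y) \<in> borel_measurable (borel \<Otimes>\<^sub>M borel)"
    unfolding product_kernel_eq by (rule prod_kernel_measurable(1)) simp
  have K_sq: "(\<integral>\<^sup>+y. ennreal ((?K x y)\<^sup>2) \<partial>lborel) \<le> ennreal \<kappa>" for x
  proof -
    have "(\<integral>\<^sup>+y. ennreal ((?K x y)\<^sup>2) \<partial>lborel)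
        = ennreal (\<Prod>b\<in>(Basis :: (real ^ 'd) set). (\<integral>v. (k (axis_index b) v)\<^sup>2 \<partial>lborel) / bandwidth m (axis_index b))"
      unfolding product_kernel_eq by (rule nn_integral_prod_kernel_sq) (auto simp: k_sq k_even)
    also have "\<dots> = ennreal (\<Prod>i\<in>UNIV. (\<integral>v. (k i v)\<^sup>2 \<partial>lborel) / bandwidth m i)"
      unfolding prod_Basis_vec by simp
    also have "\<dots> \<le> ennreal \<kappa>" using \<kappa>(1) by (rule ennreal_leI)
    finally show ?thesis .
  qed
  have t0: "0 \<le> t" using \<alpha> product_weight_pos[of m] by (simp add: t)
  obtain E where E: "E \<in> sets P" "prob E \<le> \<beta>"
    and ae: "AE \<omega> in P. T_stat ?K (fst \<omega> \<union> snd \<omega>) (\<lambda>x. if x \<in> fst \<omega> then 1 else -1)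
        \<le> t * sqrt (2 * offdiag_sq_sum ?K (fst \<omega> \<union> snd \<omega>)) \<longrightarrow> \<omega> \<in> E"
  proof (rule kernel_type_two[OF K_meas product_kernel_sym[where k = k, OF k_even] K_sq \<kappa>(2) u_def bias(1,2)
        mass[OF f R'1(1)] mass[OF g R'1(2)] pos(2) bound(1)[OF f R''1(1)] bound(1)[OF g R''1(2)] pos(3) \<beta> t0])
    have "(\<integral>x. (?s x)\<^sup>2 \<partial>lborel) = (L2_norm ?s)\<^sup>2"
      unfolding L2_norm_def by (subst real_sqrt_pow2) (auto intro!: integral_nonneg_AE)
    with sep bias(3) show "(\<integral>x. (u x - ?s x)\<^sup>2 \<partial>lborel) + 16 * R'' / (\<beta> * n)
        + 2 * (t + 1) * sqrt (16 * R' * R'' * \<kappa> / \<beta>) / n \<le> (\<integral>x. (?s x)\<^sup>2 \<partial>lborel)" by linarith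
  qed
  have "emeasure P {\<omega> \<in> space P. Phi4 k \<alpha> \<omega> = 0} \<le> emeasure P E"
  proof (rule emeasure_mono_AE[OF _ E(1)])
    show "AE \<omega> in P. \<omega> \<in> {\<omega> \<in> space P. Phi4 k \<alpha> \<omega> = 0} \<longrightarrow> \<omega> \<in> E"
      using ae
    proof eventually_elim
      case (elim \<omega>)
      show ?case
      proof
        assume \<omega>: "\<omega> \<in> {\<omega> \<in> space P. Phi4 k \<alpha> \<omega> = 0}"
        have acc: "aggregated_test (product_kernel k) product_weight \<alpha> (fst \<omega>, snd \<omega>) = 0"
          using \<omega> by (simp add: Phi4_def)
        have "T_stat ?K (fst \<omega> \<union> snd \<omega>) (\<lambda>x. if x \<in> fst \<omega> then 1 else -1)
            \<le> exp 1 * (ln (1 / \<alpha>) + product_weight m + 2) * sqrt (2 * offdiag_sq_sum ?K (fst \<omega> \<union> snd \<omega>))"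
        proof (rule aggregated_test_accept[OF acc])
          show "finite (fst \<omega>)" "finite (snd \<omega>)" using \<omega> by (auto simp: space_P)
          show "product_kernel k m y z = product_kernel k m z y" for y z
            by (rule product_kernel_sym[where k = k, OF k_even])
        qed (use \<alpha> product_weight_pos sum_exp_product_weight in auto)
        then show "\<omega> \<in> E" using elim by (simp add: t)
      qed
    qed
  qed
  also have "\<dots> \<le> ennreal \<beta>" using E(2) by (simp add: emeasure_eq_measure ennreal_leI)
  finally show ?thesis .
qed

end

text \<open>
  The three terms are at most of order \<open>r powr (2 * ex)\<close>: the first one by the choice of the bandwidths,
  the second one since \<open>1 / n \<le> r\<close>, \<open>r \<le> 1\<close> and \<open>2 * ex \<le> 1\<close>, and the third one since \<open>r\<close> times
  \<open>r powr (- (1 / (1 + 4 * \<delta>')))\<close> equals \<open>r powr (2 * ex)\<close>.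
\<close>

lemma rate_arithmetic:
  fixes \<delta>' n C1 C2 A B t1 V :: real
  defines "ex \<equiv> 2 * \<delta>' / (1 + 4 * \<delta>')" and "r \<equiv> ln (ln n) / n"
  assumes \<delta>': "0 < \<delta>'" and n: "1 < n" "1 \<le> ln (ln n)"
    and nn: "0 \<le> A" "0 \<le> B" "0 \<le> C2"
    and bias: "0 \<le> b" "b \<le> C1 * r powr ex" and t: "0 \<le> t" "t + 1 \<le> C2 * ln (ln n)"
    and V: "0 \<le> V" "V \<le> B * r powr (- (2 / (1 + 4 * \<delta>')))"
  shows "b\<^sup>2 + A / n + 2 * (t + 1) * sqrt V / n \<le> (C1\<^sup>2 + A + 2 * C2 * sqrt B) * (r powr ex)\<^sup>2"
proof -
  have r0: "0 < r" unfolding r_def using n by (intro divide_pos_pos) linarith+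
  have r1: "r \<le> 1"
  proof -
    have "0 < ln n" using n by simp
    then have "ln (ln n) < ln n" by (rule ln_less_self)
    also have "\<dots> < n" using n by (intro ln_less_self) auto
    finally show ?thesis using n by (simp add: r_def)
  qed
  have e2: "(r powr ex)\<^sup>2 = r powr (2 * ex)"
    by (simp only: power2_eq_square powr_add[symmetric] mult_2)
  have b: "b\<^sup>2 \<le> C1\<^sup>2 * (r powr ex)\<^sup>2"
    using power_mono[OF bias(2,1), of 2] by (simp add: power_mult_distrib)
  have ex1: "2 * ex \<le> 1" using \<delta>' by (simp add: ex_def divide_le_eq)
  have "1 / n \<le> r" unfolding r_def using n by (intro divide_right_mono) auto
  also have "r = r powr 1" using r0 by simp
  also have "r powr 1 \<le> r powr (2 * ex)" using r0 r1 ex1 by (intro powr_mono') auto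
  finally have "1 / n \<le> (r powr ex)\<^sup>2" unfolding e2 .
  from mult_left_mono[OF this nn(1)] have a: "A / n \<le> A * (r powr ex)\<^sup>2" by simp
  have sV: "sqrt V \<le> sqrt B * r powr (- (1 / (1 + 4 * \<delta>')))"
  proof -
    have "r powr (- (2 / (1 + 4 * \<delta>'))) = (r powr (- (1 / (1 + 4 * \<delta>'))))\<^sup>2"
    proof -
      have "- (2 / (1 + 4 * \<delta>')) = - (1 / (1 + 4 * \<delta>')) + - (1 / (1 + 4 * \<delta>'))" by simp
      then show ?thesis by (simp only: power2_eq_square powr_add)
    qed
    then have "sqrt (B * r powr (- (2 / (1 + 4 * \<delta>')))) = sqrt B * r powr (- (1 / (1 + 4 * \<delta>')))"
      by (simp add: real_sqrt_mult)
    then show ?thesis using real_sqrt_le_mono[OF V(2)] by simp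
  qed
  have "(t + 1) / n \<le> C2 * r"
    unfolding r_def using t n by (simp add: divide_right_mono)
  then have "(t + 1) / n * sqrt V \<le> (C2 * r) * (sqrt B * r powr (- (1 / (1 + 4 * \<delta>'))))"
    using sV nn V t n r0 by (intro mult_mono) auto
  also have "\<dots> = C2 * sqrt B * (r powr 1 * r powr (- (1 / (1 + 4 * \<delta>'))))"
    using r0 by simp
  also have "r powr 1 * r powr (- (1 / (1 + 4 * \<delta>'))) = (r powr ex)\<^sup>2"
  proof -
    have "1 + - (1 / (1 + 4 * \<delta>')) = 2 * ex" using \<delta>' by (simp add: ex_def field_simps)
    then show ?thesis unfolding e2 by (simp only: powr_add[symmetric])
  qed
  finally have le: "(t + 1) / n * sqrt V \<le> C2 * sqrt B * (r powr ex)\<^sup>2" .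
  have "2 * T * v / n = 2 * (T / n * v)" for T v :: real by simp
  then have "2 * (t + 1) * sqrt V / n = 2 * ((t + 1) / n * sqrt V)" .
  also have "\<dots> \<le> 2 * (C2 * sqrt B * (r powr ex)\<^sup>2)" using le by (rule mult_left_mono) simp
  also have "\<dots> = 2 * C2 * sqrt B * (r powr ex)\<^sup>2" by (simp only: mult.assoc)
  finally show ?thesis using add_mono[OF add_mono[OF b a]] by (simp only: distrib_right)
qed

theorem corollary3:
  fixes k :: "'d::finite \<Rightarrow> real \<Rightarrow> real"
    and \<Delta> :: "'d \<Rightarrow> nat" and \<delta> :: "'d \<Rightarrow> real"
    and \<alpha> \<beta> R R' R'' :: real
  assumes "0 < \<alpha>" "\<alpha> < 1" "0 < \<beta>" "\<beta> < 1"
    and "product_kernel_assms k"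
    and "\<And>i. 0 < \<Delta> i"
    and "\<And>i. integrable lborel (\<lambda>x. \<bar>k i x\<bar> * \<bar>x\<bar> ^ \<Delta> i)"
    and "\<And>i j. j \<in> {1..\<Delta> i} \<Longrightarrow> (LINT x|lborel. k i x * x ^ j) = 0"
    and "\<And>i. 0 < \<delta> i" "\<And>i. \<delta> i \<le> real (\<Delta> i)"
    and "0 < R" "0 < R'" "0 < R''"
  shows "\<exists>C>0. \<forall>(n::real) P.
    1 < n \<longrightarrow> ln (ln n) \<ge> 1 \<longrightarrow>
    (\<forall>f g. intensity f \<longrightarrow> intensity g \<longrightarrow>
       two_sample_law (scale_measure (ennreal n) lborel) f g (P f g)) \<longrightarrow>
    (let \<delta>bar = 1 / (\<Sum>i\<in>UNIV. 1 / \<delta> i) in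
       separation_rate P (Phi4 k \<alpha>) (besov_class \<delta> R R' R'') \<beta>
         \<le> ereal (C * (ln (ln n) / n) powr (2 * \<delta>bar / (1 + 4 * \<delta>bar))))"
proof -
  interpret kernel_setting k \<Delta> \<delta> by unfold_locales (use assms in auto)
  define \<delta>' where "\<delta>' = 1 / (\<Sum>i\<in>UNIV. 1 / \<delta> i)"
  have "0 < (\<Sum>i\<in>UNIV. 1 / \<delta> i)" using assms(9) by (intro sum_pos) auto
  then have \<delta>': "0 < \<delta>'" by (simp add: \<delta>'_def)
  define ex where "ex = 2 * \<delta>' / (1 + 4 * \<delta>')"
  have ex: "0 < ex" using \<delta>' by (simp add: ex_def)
  define W where "W = 2 * (\<Sum>i\<in>UNIV. ln (ex / \<delta> i / ln 2 + 2) + 1 + ln (pi / sqrt 6))"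
  \<comment> \<open>The summand 1 ensures positivity.\<close>
  define \<kappa>0 where "\<kappa>0 = (\<Prod>i\<in>UNIV. \<integral>v. (k i v)\<^sup>2 \<partial>lborel) + 1"
  define C1 where "C1 = (\<Prod>i\<in>UNIV. kernel_L1 i) * (\<Sum>i\<in>UNIV. R * kernel_moment i)"
  define C2 where "C2 = exp 1 * (ln (1 / \<alpha>) + W + 2) + 1"
  define A where "A = 16 * R'' / \<beta>"
  define B where "B = 16 * R' * R'' * (\<kappa>0 * 2 ^ CARD('d)) / \<beta>"
  define C where "C = sqrt (C1\<^sup>2 + A + 2 * C2 * sqrt B)"
  have "0 \<le> ln (ex / \<delta> i / ln 2 + 2)" for i
  proof -
    have "0 \<le> ex / \<delta> i / ln 2" using ex assms(9)[of i] by (intro divide_nonneg_pos) auto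
    then show ?thesis by (intro ln_ge_zero) linarith
  qed
  then have W0: "0 \<le> W"
    unfolding W_def using ln_pi_sqrt6_pos
    by (intro mult_nonneg_nonneg sum_nonneg add_nonneg_nonneg) (simp_all add: less_imp_le)
  have l\<alpha>: "0 < ln (1 / \<alpha>)" using assms(1,2) by simp
  have k0: "0 \<le> (\<Prod>i\<in>UNIV. \<integral>v. (k i v)\<^sup>2 \<partial>lborel)" by (intro prod_nonneg) auto
  then have \<kappa>0: "0 < \<kappa>0" by (simp add: \<kappa>0_def)
  have C2: "0 \<le> C2" unfolding C2_def using W0 l\<alpha> by (intro add_nonneg_nonneg mult_nonneg_nonneg) auto
  have A: "0 < A" using assms by (simp add: A_def)
  have B: "0 < B" using assms \<kappa>0 by (simp add: B_def)
  have Cpos: "0 < C1\<^sup>2 + A + 2 * C2 * sqrt B" using A C2 B by (intro add_pos_nonneg add_nonneg_pos mult_nonneg_nonneg) auto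
  then have C: "0 < C" by (simp add: C_def)
  show ?thesis
  proof (intro exI[of _ C] conjI C allI impI)
    fix n :: real and P :: "(real ^ 'd \<Rightarrow> real) \<Rightarrow> (real ^ 'd \<Rightarrow> real) \<Rightarrow> ((real ^ 'd) set \<times> (real ^ 'd) set) measure"
    assume n: "1 < n" "1 \<le> ln (ln n)"
      and law: "\<forall>f g. intensity f \<longrightarrow> intensity g \<longrightarrow> two_sample_law (scale_measure (ennreal n) lborel) f g (P f g)"
    define r where "r = ln (ln n) / n"
    have r0: "0 < r" unfolding r_def using n by (intro divide_pos_pos) linarith+
    obtain m :: "nat ^ 'd" where m1: "\<And>i. bandwidth m i powr \<delta> i \<le> r powr ex"
      and m2: "(\<Prod>i\<in>UNIV. 1 / bandwidth m i) \<le> 2 ^ CARD('d) * r powr (- (2 / (1 + 4 * \<delta>')))"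
      and m3: "product_weight m \<le> W * ln (ln n)"
      by (rule bandwidth_choice[where \<delta> = \<delta>, OF assms(9) n, folded \<delta>'_def, folded ex_def, folded W_def r_def]) (rule that)
    define t where "t = exp 1 * (ln (1 / \<alpha>) + product_weight m + 2)"
    define \<kappa> where "\<kappa> = \<kappa>0 * (\<Prod>i\<in>UNIV. 1 / bandwidth m i)"
    have H: "0 < (\<Prod>i\<in>UNIV. 1 / bandwidth m i)" by (intro prod_pos) auto
    have \<kappa>: "0 < \<kappa>" using \<kappa>0 H by (simp add: \<kappa>_def)
    have \<kappa>le: "(\<Prod>i\<in>UNIV. (\<integral>v. (k i v)\<^sup>2 \<partial>lborel) / bandwidth m i) \<le> \<kappa>"
    proof -
      have "(\<Prod>i\<in>UNIV. (\<integral>v. (k i v)\<^sup>2 \<partial>lborel) / bandwidth m i)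
          = (\<Prod>i\<in>UNIV. \<integral>v. (k i v)\<^sup>2 \<partial>lborel) * (\<Prod>i\<in>UNIV. 1 / bandwidth m i)"
        by (simp add: prod.distrib[symmetric])
      also have "\<dots> \<le> \<kappa>" unfolding \<kappa>_def \<kappa>0_def using H by (intro mult_right_mono) auto
      finally show ?thesis .
    qed
    let ?b = "(\<Prod>i\<in>UNIV. kernel_L1 i) * (\<Sum>i\<in>UNIV. R * bandwidth m i powr \<delta> i * kernel_moment i)"
    let ?\<rho> = "C * r powr ex"
    have L0: "0 \<le> (\<Prod>i\<in>UNIV. kernel_L1 i)" by (intro prod_nonneg) (use kernel_L1_ge_1 in \<open>auto intro: order_trans[of 0 1]\<close>)
    have M0: "0 \<le> kernel_moment i" for i using kernel_moment_ge_1[of i] by simp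
    have need: "?b\<^sup>2 + 16 * R'' / (\<beta> * n) + 2 * (t + 1) * sqrt (16 * R' * R'' * \<kappa> / \<beta>) / n \<le> ?\<rho>\<^sup>2"
    proof -
      have "?b\<^sup>2 + A / n + 2 * (t + 1) * sqrt (16 * R' * R'' * \<kappa> / \<beta>) / n \<le> (C1\<^sup>2 + A + 2 * C2 * sqrt B) * (r powr ex)\<^sup>2"
        unfolding ex_def r_def
      proof (rule rate_arithmetic[OF \<delta>' n], unfold ex_def[symmetric] r_def[symmetric])
        show "0 \<le> ?b" using L0 M0 assms(11) by (intro mult_nonneg_nonneg sum_nonneg) auto
        have "(\<Sum>i\<in>UNIV. R * bandwidth m i powr \<delta> i * kernel_moment i) \<le> (\<Sum>i\<in>UNIV. R * r powr ex * kernel_moment i)"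
          using m1 M0 assms(11) by (intro sum_mono mult_right_mono mult_left_mono) auto
        also have "\<dots> = (\<Sum>i\<in>UNIV. R * kernel_moment i) * r powr ex" by (simp add: sum_distrib_left sum_distrib_right mult_ac)
        finally show "?b \<le> C1 * r powr ex" unfolding C1_def mult.assoc using L0 by (intro mult_left_mono) auto
        show "0 \<le> t" using l\<alpha> product_weight_pos[of m] by (simp add: t_def)
        have "t + 1 \<le> exp 1 * (ln (1 / \<alpha>) * ln (ln n) + W * ln (ln n) + 2 * ln (ln n)) + ln (ln n)"
          unfolding t_def using m3 n mult_left_mono[OF n(2), of "ln (1 / \<alpha>)"] l\<alpha>
          by (intro add_mono mult_left_mono) auto
        also have "\<dots> = C2 * ln (ln n)" by (simp add: C2_def algebra_simps)
        finally show "t + 1 \<le> C2 * ln (ln n)" .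
        show "0 \<le> 16 * R' * R'' * \<kappa> / \<beta>" using assms \<kappa> by simp
        have "\<kappa> \<le> \<kappa>0 * (2 ^ CARD('d) * r powr (- (2 / (1 + 4 * \<delta>'))))"
          unfolding \<kappa>_def using \<kappa>0 by (intro mult_left_mono m2) auto
        then have "16 * R' * R'' / \<beta> * \<kappa> \<le> 16 * R' * R'' / \<beta> * (\<kappa>0 * (2 ^ CARD('d) * r powr (- (2 / (1 + 4 * \<delta>')))))"
          using assms by (intro mult_left_mono) auto
        then show "16 * R' * R'' * \<kappa> / \<beta> \<le> B * r powr (- (2 / (1 + 4 * \<delta>')))"
          by (simp add: B_def mult_ac)
      qed (use A B C2 in auto)
      also have "\<dots> = ?\<rho>\<^sup>2" using Cpos by (simp add: C_def power_mult_distrib)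
      finally show ?thesis by (simp add: A_def)
    qed
    have "separation_rate P (Phi4 k \<alpha>) (besov_class \<delta> R R' R'') \<beta> \<le> ereal ?\<rho>"
      unfolding separation_rate_def
    proof (rule INF_lower, rule CollectI, intro conjI)
      show "0 < ?\<rho>" using C r0 by simp
      show "(SUP (f, g)\<in>{(f, g). (f, g) \<in> besov_class \<delta> R R' R'' \<and> L2_norm (\<lambda>x. f x - g x) > ?\<rho>}.
          emeasure (P f g) {\<omega> \<in> space (P f g). Phi4 k \<alpha> \<omega> = 0}) \<le> ennreal \<beta>"
      proof (rule SUP_least, clarify)
        fix f g assume fg: "(f, g) \<in> besov_class \<delta> R R' R''" and far: "?\<rho> < L2_norm (\<lambda>x. f x - g x)"
        have "intensity f" "intensity g" using fg by (auto simp: besov_class_def)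
        with law have law': "two_sample_law (scale_measure (ennreal n) lborel) f g (P f g)" by blast
        have "?\<rho>\<^sup>2 \<le> (L2_norm (\<lambda>x. f x - g x))\<^sup>2" using far C r0 by (intro power_mono) auto
        with need have "?b\<^sup>2 + 16 * R'' / (\<beta> * n) + 2 * (t + 1) * sqrt (16 * R' * R'' * \<kappa> / \<beta>) / n
            \<le> (L2_norm (\<lambda>x. f x - g x))\<^sup>2" by (rule order_trans)
        then show "emeasure (P f g) {\<omega> \<in> space (P f g). Phi4 k \<alpha> \<omega> = 0} \<le> ennreal \<beta>"
          using n by (intro Phi4_type_two[OF law' _ fg assms(1,2,3,11,12,13) t_def \<kappa>le \<kappa>]) auto
      qed
    qed
    then show "let \<delta>bar = 1 / (\<Sum>i\<in>UNIV. 1 / \<delta> i) in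
       separation_rate P (Phi4 k \<alpha>) (besov_class \<delta> R R' R'') \<beta>
         \<le> ereal (C * (ln (ln n) / n) powr (2 * \<delta>bar / (1 + 4 * \<delta>bar)))"
      unfolding Let_def r_def ex_def \<delta>'_def .
  qed
qed

end
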